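(* Let $c\in(1,\tfrac{18}{17})$ be fixed, put $\gamma=1/c$, and let $\varepsilon>0$ be sufficiently small. For all coprime integers $a$ and $d$ with $d\ge 1$, and all $x\ge 2$, $$ \pi_c(x;d,a)=\gamma x^{\gamma-1}\,\pi(x;d,a) +\gamma(1-\gamma)\int_2^x u^{\gamma-2}\,\pi(u;d,a)\,du +O\bigl(x^{17/39+7\gamma/13+\varepsilon}\bigr), $$ where the implied constant depends only on $c$ and $\varepsilon$.
   Context: $\lfloor t\rfloor$ is the integer part of the real number $t$. With $p$ denoting primes, $$\pi(x;d,a)=\#\{p\le x:p\equiv a \bmod d\},\qquad \pi_c(x;d,a)=\#\{p\le x:p\in\mathscr{P}^{(c)},\ p\equiv a\bmod d\},$$ where $\mathscr{P}^{(c)}=\{p\text{ prime}:p=\lfloor n^c\rfloor\text{ for some }n\in\mathbb{N}\}$. *)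

theory Defs
  imports "HOL-Analysis.Analysis" "HOL-Number_Theory.Number_Theory"
begin

definition PS_primes :: "real \<Rightarrow> nat set" where
  "PS_primes c = {p. prime p \<and> (\<exists>n::nat. int p = \<lfloor>real n powr c\<rfloor>)}"

definition prime_count_ap :: "real \<Rightarrow> int \<Rightarrow> int \<Rightarrow> nat" where
  "prime_count_ap x d a = card {p::nat. prime p \<and> real p \<le> x \<and> [int p = a] (mod d)}"

definition PS_prime_count_ap :: "real \<Rightarrow> real \<Rightarrow> int \<Rightarrow> int \<Rightarrow> nat" where
  "PS_prime_count_ap c x d a =
     card {p::nat. p \<in> PS_primes c \<and> real p \<le> x \<and> [int p = a] (mod d)}"

end

theory Submission
  imports Defs "HOL-Computational_Algebra.Squarefree"
begin

text \<open>
  A prime \<open>p\<close> has the form \<open>\<lfloor>n\<^sup>c\<rfloor>\<close> iff an integer lies in \<open>[p\<^sup>\<gamma>, (p + 1)\<^sup>\<gamma>)\<close>. Writing the number of such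
  integers with the sawtooth function, the main term is the sum of \<open>(p + 1)\<^sup>\<gamma> - p\<^sup>\<gamma>\<close>, and the error is a sum of
  differences of sawtooth values at \<open>-(p + 1)\<^sup>\<gamma>\<close> and \<open>-p\<^sup>\<gamma>\<close>. Truncating the Fourier series of the sawtooth at
  \<open>H = N\<^sup>1\<^sup>-\<^sup>E\<close>, where \<open>E = 17/39 + 7\<gamma>/13\<close>, reduces the error over primes \<open>N < p \<le> 2N\<close> to sums of
  \<open>\<Lambda>(n) e(h n\<^sup>\<gamma> + \<alpha> n)\<close> with \<open>h \<le> H\<close>. The linear phase comes from detecting the residue class by additive
  characters, and since van der Corput's second derivative test ignores linear phases, everything is uniform in
  the modulus. Vaughan's identity with both parameters \<open>N\<^sup>1\<^sup>/\<^sup>3\<close> leaves type I sums, which are easy, and type II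
  sums in which one variable lies between \<open>N\<^sup>1\<^sup>/\<^sup>3\<close> and \<open>2N\<^sup>2\<^sup>/\<^sup>3\<close>. That variable is cut into blocks of length
  \<open>N\<^sup>2\<^sup>s\<close> with \<open>s = (5 - 3\<gamma>)/39\<close>; on each block Cauchy--Schwarz and van der Corput's test save a factor
  \<open>N\<^sup>s\<close>, which is exactly what is needed because \<open>1 + \<gamma> - s = 2E\<close>.
\<close>

section \<open>Exponential sums\<close>

text \<open>Two equations fix the exponents. Writing e(h (n+1)^\<gamma>) - e(h n^\<gamma>) as a
  slowly varying factor times e(h n^\<gamma>) gains h N^(\<gamma>-1), and this h cancels against the
  Fourier coefficient 1/(\<pi> h). So each of the N^(1-E) frequencies contributes N^(\<gamma>-1)
  times a prime sum of size N^(1-s), while truncation costs N/H = N^E; equality of the two is 1 +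
  \<gamma> - s = 2E. In the type II sums, with X = H N^\<gamma>, block length K = N^(2s) and l up to
  N^(2/3), the diagonal leaves 1/K and the off-diagonal terms leave (X K N^(2/3))^(1/2) / N;
  equality is \<gamma> + 1 - E + 6s = 4/3. Solving both gives E and s, and E < \<gamma> holds
  exactly for \<gamma> > 17/18, that is c < 18/17. The truncation error is dominated by nonnegative
  trigonometric polynomials. There the sum over primes can be enlarged to all integers, so that this
  error needs van der Corput's test only. Powers of log N are absorbed by \<epsilon>.\<close>

definition ee :: "real \<Rightarrow> complex" where
  "ee t = cis (2 * pi * t)"

lemma norm_ee [simp]: "norm (ee t) = 1"
  by (simp add: ee_def)

lemma ee_0 [simp]: "ee 0 = 1"
  by (simp add: ee_def)

lemma ee_add: "ee (s + t) = ee s * ee t"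
  by (simp add: ee_def cis_mult algebra_simps)

lemma ee_minus: "ee (- t) = cnj (ee t)"
  by (simp add: ee_def cis_cnj)

lemma ee_int [simp]: "ee (of_int k) = 1"
  by (simp add: ee_def cis_multiple_2pi)

lemma ee_power: "ee t ^ n = ee (of_nat n * t)"
  by (simp add: ee_def Complex.DeMoivre mult_ac)

text \<open>A chord of the unit circle is at most its arc.\<close>

lemma norm_ee_diff_le: "norm (ee s - ee t) \<le> 2 * pi * \<bar>s - t\<bar>"
proof -
  have *: "norm (cis u - 1) \<le> \<bar>u\<bar>" for u :: real
  proof -
    have "norm (cis u - 1) = 2 * \<bar>sin (u / 2)\<bar>"
      using dist_exp_i_1[of u] by (simp add: cis_conv_exp)
    also have "\<dots> \<le> 2 * \<bar>u / 2\<bar>"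
      by (intro mult_left_mono abs_sin_x_le_abs_x) simp
    finally show ?thesis by simp
  qed
  have "ee s - ee t = ee t * (cis (2 * pi * (s - t)) - 1)"
    using ee_add[of t "s - t"] by (simp add: ee_def algebra_simps)
  then have "norm (ee s - ee t) = norm (cis (2 * pi * (s - t)) - 1)"
    by (simp add: norm_mult)
  also have "\<dots> \<le> \<bar>2 * pi * (s - t)\<bar>" by (rule *)
  finally show ?thesis by (simp add: abs_mult)
qed

section \<open>Partial summation\<close>

lemma partial_summation:
  fixes c W :: "nat \<Rightarrow> complex"
  assumes "a \<le> b"
  shows "(\<Sum>n\<in>{a<..b}. W n * c n) = W b * (\<Sum>n\<in>{a<..b}. c n)
           - (\<Sum>n\<in>{a<..<b}. (W (Suc n) - W n) * (\<Sum>k\<in>{a<..n}. c k))"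
  using assms
proof (induction b rule: dec_induct)
  case base
  then show ?case by simp
next
  case (step b)
  show ?case
  proof (cases "a = b")
    case True
    then have "{a<..Suc b} = {Suc b}" "{a<..<Suc b} = {}" by auto
    then show ?thesis by simp
  next
    case False
    with step have "a < b" by simp
    then have "{a<..<Suc b} = insert b {a<..<b}" "{a<..Suc b} = insert (Suc b) {a<..b}"
      by auto
    then show ?thesis using step.IH by (simp add: algebra_simps)
  qed
qed

text \<open>A bound on every initial segment is required, which is why the estimates fed into this
  lemma allow an arbitrary upper end. For the weights used below the variation telescopes by
  monotonicity.\<close>

lemma partial_summation_bound:
  fixes c W :: "nat \<Rightarrow> complex"
  assumes "a \<le> b" and B: "\<And>t. a \<le> t \<Longrightarrow> t \<le> b \<Longrightarrow> norm (\<Sum>n\<in>{a<..t}. c n) \<le> B"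
  shows "norm (\<Sum>n\<in>{a<..b}. W n * c n)
           \<le> B * (norm (W b) + (\<Sum>n\<in>{a<..<b}. norm (W (Suc n) - W n)))"
proof -
  have "norm (\<Sum>n\<in>{a<..b}. W n * c n) \<le> norm (W b * (\<Sum>n\<in>{a<..b}. c n))
      + norm (\<Sum>n\<in>{a<..<b}. (W (Suc n) - W n) * (\<Sum>k\<in>{a<..n}. c k))"
    unfolding partial_summation[OF assms(1)] by (rule norm_triangle_ineq4)
  also have "\<dots> \<le> norm (W b) * B + (\<Sum>n\<in>{a<..<b}. norm (W (Suc n) - W n) * B)"
    by (intro add_mono sum_norm_le)
       (auto simp: norm_mult intro!: mult_left_mono B assms(1))
  finally show ?thesis by (simp add: algebra_simps sum_distrib_left)
qed

section \<open>The Kusmin--Landau inequality and van der Corput's test\<close>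

text \<open>The real part of \<open>1 / (1 - ee x)\<close> is constantly \<open>1 / 2\<close> and its imaginary part is
  half the cotangent of \<open>\<pi> x\<close>, so its total variation telescopes along monotone sequences.\<close>

lemma inverse_one_minus_ee:
  assumes "sin (pi * x) \<noteq> 0"
  shows "inverse (1 - ee x) = Complex (1 / 2) (cot (pi * x) / 2)" and "ee x \<noteq> 1"
proof -
  let ?s = "sin (pi * x)" and ?c = "cos (pi * x)"
  have e: "ee x = Complex (1 - 2 * ?s\<^sup>2) (2 * ?s * ?c)"
    using cos_double_sin[of "pi * x"] sin_double[of "pi * x"]
    by (simp add: ee_def complex_eq_iff mult.assoc)
  have sq: "?c\<^sup>2 = 1 - ?s\<^sup>2" by (simp add: cos_squared_eq)
  have 1: "(1 - ee x) * Complex (1 / 2) (cot (pi * x) / 2) = 1"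
    using assms sq unfolding e
    by (simp add: complex_eq_iff cot_def divide_simps power2_eq_square)
  then show "ee x \<noteq> 1" by auto
  from 1 show "inverse (1 - ee x) = Complex (1 / 2) (cot (pi * x) / 2)"
    by (rule inverse_unique)
qed

text \<open>Jordan's inequality: by concavity the sine lies above its chord on [0, \<pi>/2], and the
  reflection x -> 1 - x covers the other half.\<close>

lemma sin_pi_ge:
  fixes x :: real
  assumes "\<theta> \<le> x" "x \<le> 1 - \<theta>" "0 < \<theta>"
  shows "sin (pi * x) \<ge> 2 * \<theta>"
proof -
  have conc: "concave_on {0..pi} sin"
    by (rule f''_le0_imp_concave[where f' = cos and f'' = "\<lambda>x. - sin x"])
       (auto intro!: derivative_eq_intros sin_ge_zero)
  have *: "sin (pi * y) \<ge> 2 * y" if "0 \<le> y" "y \<le> 1 / 2" for y :: real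
    using concave_onD[OF conc, of "2 * y" 0 "pi / 2"] that by (simp add: mult.commute)
  show ?thesis
  proof (cases "x \<le> 1 / 2")
    case True
    then show ?thesis using *[of x] assms by simp
  next
    case False
    have "sin (pi * x) = sin (pi * (1 - x))"
      by (simp add: algebra_simps)
    then show ?thesis using *[of "1 - x"] assms False by simp
  qed
qed

lemma sum_Suc_diff_telescope:
  fixes f :: "nat \<Rightarrow> real"
  assumes "a < b"
  shows "(\<Sum>n\<in>{a<..<b}. f (Suc n) - f n) = f b - f (Suc a)"
proof -
  have "{a<..<b} = {Suc a..<b}" by auto
  then show ?thesis using sum_Suc_diff'[of "Suc a" b f] assms by simp
qed

text \<open>Division by \<open>1 - ee (g n)\<close> turns each term into a difference of consecutive
  exponentials, whose partial sums telescope to norm at most 2. Partial summation then costs only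
  the size and the variation of the weight \<open>W\<close>. Both are of order 1/\<theta>, because
  \<open>g\<close> stays \<theta> away from the integers and the cotangent decreases along the
  monotone \<open>g\<close>.\<close>

lemma kusmin_landau_unit:
  fixes f :: "nat \<Rightarrow> real"
  defines "g \<equiv> \<lambda>n. f (Suc n) - f n"
  assumes \<theta>: "0 < \<theta>" and ab: "a < b"
    and rng: "\<And>n. n \<in> {a<..b} \<Longrightarrow> \<theta> \<le> g n \<and> g n \<le> 1 - \<theta>"
    and mono: "\<And>n. n \<in> {a<..<b} \<Longrightarrow> g n \<le> g (Suc n)"
  shows "norm (\<Sum>n\<in>{a<..b}. ee (f n)) \<le> 2 / \<theta>"
proof -
  define W where "W n = inverse (1 - ee (g n))" for n
  have s: "sin (pi * g n) \<ge> 2 * \<theta>" if "n \<in> {a<..b}" for n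
    using sin_pi_ge rng[OF that] \<theta> by blast
  have s0: "sin (pi * g n) \<noteq> 0" if "n \<in> {a<..b}" for n
    using s[OF that] \<theta> by linarith
  have W: "W n = Complex (1 / 2) (cot (pi * g n) / 2)" if "n \<in> {a<..b}" for n
    unfolding W_def using inverse_one_minus_ee s0 that by blast
  have nW: "norm (W n) \<le> 1 / (4 * \<theta>)" if "n \<in> {a<..b}" for n
  proof -
    have "1 - ee (g n) = - (cis (pi * g n) * (2 * \<i> * sin (pi * g n)))"
      using cos_double_sin[of "pi * g n"] sin_double[of "pi * g n"]
      by (simp add: ee_def complex_eq_iff mult.assoc power2_eq_square)
    then have "norm (1 - ee (g n)) = 2 * \<bar>sin (pi * g n)\<bar>"
      by (simp add: norm_mult)
    then have "norm (1 - ee (g n)) \<ge> 4 * \<theta>" using s[OF that] by linarith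
    then show ?thesis using \<theta> unfolding W_def norm_inverse
      by (simp add: divide_simps)
  qed
  have step: "norm (W (Suc n) - W n) = Im (W n) - Im (W (Suc n))" if "n \<in> {a<..<b}" for n
  proof -
    from that have n: "n \<in> {a<..b}" "Suc n \<in> {a<..b}" by auto
    let ?x = "pi * g n" and ?y = "pi * g (Suc n)"
    \<comment> \<open>Monotonicity of the cotangent is read off the formula for
      \<open>cot ?x - cot ?y\<close> below; its numerator is nonnegative because the two angles
      differ by at most \<pi>.\<close>
    have "sin (?y - ?x) \<ge> 0"
    proof (rule sin_ge_zero)
      show "0 \<le> ?y - ?x" using mono[OF that] by simp
      have "g (Suc n) - g n \<le> 1" using rng[OF n(1)] rng[OF n(2)] \<theta> by linarith
      then show "?y - ?x \<le> pi" using pi_gt_zero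
        by (metis mult.right_neutral mult_left_mono pi_ge_zero right_diff_distrib)
    qed
    moreover have "cot ?x - cot ?y = sin (?y - ?x) / (sin ?x * sin ?y)"
      using s0[OF n(1)] s0[OF n(2)] by (simp add: cot_def sin_diff field_simps)
    moreover have "sin ?x * sin ?y > 0"
      using s[OF n(1)] s[OF n(2)] \<theta> by (intro mult_pos_pos) linarith+
    ultimately have "cot ?y \<le> cot ?x"
      by (metis diff_ge_0_iff_ge divide_nonneg_pos)
    moreover have "W (Suc n) - W n = Complex 0 (cot ?y / 2 - cot ?x / 2)"
      by (simp add: W[OF n(1)] W[OF n(2)] complex_eq_iff)
    ultimately show ?thesis
      by (simp add: W[OF n(1)] W[OF n(2)] cmod_def)
  qed
  have "(\<Sum>n\<in>{a<..b}. ee (f n)) = (\<Sum>n\<in>{a<..b}. W n * (ee (f n) - ee (f (Suc n))))"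
  proof (rule sum.cong[OF refl])
    fix n assume n: "n \<in> {a<..b}"
    have "ee (f (Suc n)) = ee (f n) * ee (g n)"
      unfolding ee_add[symmetric] g_def by simp
    then have "ee (f n) - ee (f (Suc n)) = (1 - ee (g n)) * ee (f n)"
      by (simp add: algebra_simps)
    moreover have "1 - ee (g n) \<noteq> 0"
      using inverse_one_minus_ee(2)[OF s0[OF n]] by simp
    ultimately show "ee (f n) = W n * (ee (f n) - ee (f (Suc n)))"
      by (simp add: W_def)
  qed
  also have "norm \<dots> \<le> 2 * (norm (W b) + (\<Sum>n\<in>{a<..<b}. norm (W (Suc n) - W n)))"
  proof (rule partial_summation_bound)
    fix t assume "a \<le> t" "t \<le> b"
    have "{a<..t} = {Suc a..t}" by auto
    then have "(\<Sum>n\<in>{a<..t}. ee (f n) - ee (f (Suc n))) = ee (f (Suc a)) - ee (f (Suc t))"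
      using sum_Suc_diff[of "Suc a" t "\<lambda>n. - ee (f n)"] \<open>a \<le> t\<close> by simp
    also have "norm \<dots> \<le> 2"
      using norm_triangle_ineq4[of "ee (f (Suc a))" "ee (f (Suc t))"] by simp
    finally show "norm (\<Sum>n\<in>{a<..t}. ee (f n) - ee (f (Suc n))) \<le> 2" .
  qed (use ab in simp)
  also have "(\<Sum>n\<in>{a<..<b}. norm (W (Suc n) - W n)) = Im (W (Suc a)) - Im (W b)"
    using sum_Suc_diff_telescope[OF ab, of "\<lambda>n. - Im (W n)"] step by simp
  also have "\<dots> \<le> 1 / (4 * \<theta>) + 1 / (4 * \<theta>)"
    using nW[of "Suc a"] nW[of b] abs_Im_le_cmod[of "W (Suc a)"] abs_Im_le_cmod[of "W b"] ab
    by simp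
  also have "2 * (norm (W b) + (1 / (4 * \<theta>) + 1 / (4 * \<theta>))) \<le> 2 * (3 * (1 / (4 * \<theta>)))"
    using nW[of b] ab by simp
  also have "\<dots> \<le> 2 / \<theta>" using \<theta> by (simp add: field_simps)
  finally show ?thesis by simp
qed

text \<open>Subtracting k n from the phase shifts the first difference by k and leaves every
  exponential unchanged, so the unit interval may be replaced by [k, k+1].\<close>

lemma kusmin_landau:
  fixes f :: "nat \<Rightarrow> real"
  defines "g \<equiv> \<lambda>n. f (Suc n) - f n"
  assumes \<theta>: "0 < \<theta>"
    and rng: "\<And>n. n \<in> {a<..b} \<Longrightarrow> of_int k + \<theta> \<le> g n \<and> g n \<le> of_int k + 1 - \<theta>"
    and mono: "\<And>n. n \<in> {a<..<b} \<Longrightarrow> g n \<le> g (Suc n)"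
  shows "norm (\<Sum>n\<in>{a<..b}. ee (f n)) \<le> 2 / \<theta>"
proof (cases "a < b")
  case True
  define F where "F n = f n - real n * of_int k" for n
  have "ee (F n) = ee (f n)" for n
    using ee_int[of "- (int n * k)"] ee_add[of "f n" "of_int (- (int n * k))"]
    by (simp add: F_def)
  moreover have "norm (\<Sum>n\<in>{a<..b}. ee (F n)) \<le> 2 / \<theta>"
    using rng mono by (intro kusmin_landau_unit[OF \<theta> True]) (force simp: F_def g_def algebra_simps)+
  ultimately show ?thesis by simp
qed (use \<theta> in simp)

text \<open>A sequence that grows by at least \<delta> per step can stay in an interval of length
  \<open>L\<close> for at most L/\<delta> steps. This counts the terms whose first difference is
  close to an integer.\<close>

lemma card_bounded_increments:
  fixes g :: "nat \<Rightarrow> real"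
  assumes "0 < \<delta>" "0 \<le> L" and T: "T \<subseteq> {a<..b}" "\<And>n. n \<in> T \<Longrightarrow> u \<le> g n \<and> g n \<le> u + L"
    and inc: "\<And>n. n \<in> {a<..<b} \<Longrightarrow> \<delta> \<le> g (Suc n) - g n"
  shows "real (card T) \<le> L / \<delta> + 1"
proof (cases "T = {}")
  case False
  have fin: "finite T" using T(1) finite_subset by blast
  let ?m = "Min T" and ?M = "Max T"
  have mM: "?m \<in> T" "?M \<in> T" "?m \<le> ?M" using fin False by auto
  have *: "real j * \<delta> \<le> g (?m + j) - g ?m" if "?m + j \<le> ?M" for j
    using that
  proof (induction j)
    case (Suc j)
    have "?m + j \<in> {a<..<b}" using Suc.prems mM T(1) by fastforce
    from inc[OF this] Suc show ?case by (simp add: algebra_simps)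
  qed simp
  have "real (?M - ?m) * \<delta> \<le> L"
    using *[of "?M - ?m"] T(2)[OF mM(1)] T(2)[OF mM(2)] mM(3) by simp
  then have "real (?M - ?m) \<le> L / \<delta>" using assms(1) by (simp add: field_simps)
  moreover have "T \<subseteq> {?m..?M}" using fin by auto
  then have "card T \<le> card {?m..?M}" by (intro card_mono) auto
  ultimately show ?thesis using mM(3) by (simp add: of_nat_diff)
qed (use assms in simp)

lemma norm_sum_ee_le_card: "norm (\<Sum>n\<in>T. ee (f n)) \<le> real (card T)"
  using sum_norm_le[of T "\<lambda>n. ee (f n)" "\<lambda>_. 1"] by simp

lemma mono_of_increments:
  fixes g :: "nat \<Rightarrow> real"
  assumes inc: "\<And>n. n \<in> {a<..<b} \<Longrightarrow> g n \<le> g (Suc n)" and "a < m" "m \<le> n" "n \<le> b"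
  shows "g m \<le> g n"
  using assms(3,4)
proof (induction n rule: dec_induct)
  case (step n)
  then show ?case using inc[of n] \<open>a < m\<close> by simp
qed simp

text \<open>The terms are grouped by the integer part of the first difference \<open>g\<close>; in each group
  \<open>g\<close> is close to an integer only rarely, and Kusmin--Landau handles the rest.\<close>

lemma van_der_corput:
  fixes f :: "nat \<Rightarrow> real"
  defines "g \<equiv> \<lambda>n. f (Suc n) - f n"
  assumes \<delta>: "0 < \<delta>" "1 \<le> A" and ab: "a \<le> b"
    and inc: "\<And>n. n \<in> {a<..<b} \<Longrightarrow> \<delta> \<le> g (Suc n) - g n \<and> g (Suc n) - g n \<le> A * \<delta>"
  shows "norm (\<Sum>n\<in>{a<..b}. ee (f n)) \<le> 6 * A * real (b - a) * sqrt \<delta> + 12 / sqrt \<delta>"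
proof (cases "\<delta> < 1 / 4 \<and> a < b")
  case False
  \<comment> \<open>The trivial bound suffices: for \<delta> at least 1/4 the factor 6 A
    sqrt(\<delta>) exceeds 1, and otherwise the sum is empty.\<close>
  have "norm (\<Sum>n\<in>{a<..b}. ee (f n)) \<le> real (b - a)"
    using norm_sum_ee_le_card[of f "{a<..b}"] by simp
  also have "\<dots> \<le> real (b - a) * (6 * A * sqrt \<delta>)"
  proof (cases "a < b")
    case True
    with False have "1 / 4 \<le> \<delta>" by simp
    then have "sqrt (1 / 4) \<le> sqrt \<delta>" by (rule real_sqrt_le_mono)
    then have "1 / 2 \<le> sqrt \<delta>" by (simp add: real_sqrt_divide)
    then have "1 * (1 / 2) \<le> A * sqrt \<delta>" using \<delta> by (intro mult_mono) auto
    then show ?thesis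
      using mult_left_mono[of 1 "6 * A * sqrt \<delta>" "real (b - a)"] by simp
  qed (use False in simp)
  also have "\<dots> = 6 * A * real (b - a) * sqrt \<delta>" by simp
  also have "\<dots> \<le> 6 * A * real (b - a) * sqrt \<delta> + 12 / sqrt \<delta>" using \<delta> by simp
  finally show ?thesis .
next
  case True
  \<comment> \<open>This choice balances the number \<theta>/\<delta> of terms with \<open>g\<close>
    near an integer against the Kusmin--Landau bound of order 1/\<theta> for the others.\<close>
  define \<theta> where "\<theta> = sqrt \<delta>"
  have sq: "\<theta> * \<theta> = \<delta>" using \<delta> by (simp add: \<theta>_def)
  have \<theta>: "0 < \<theta>" using \<delta> by (simp add: \<theta>_def)
  have "\<theta> < sqrt (1 / 4)" unfolding \<theta>_def using True by (intro real_sqrt_less_mono) simp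
  then have \<theta>2: "\<theta> < 1 / 2" by (simp add: real_sqrt_divide)
  have gmono: "g m \<le> g n" if "a < m" "m \<le> n" "n \<le> b" for m n
    using mono_of_increments[of a b g] inc \<delta> that by (smt (verit))
  define S where "S k = {n \<in> {a<..b}. \<lfloor>g n\<rfloor> = k}" for k
  have bound: "norm (\<Sum>n\<in>S k. ee (f n)) \<le> 6 / \<theta>" for k
  proof -
    define T1 where "T1 = {n \<in> {a<..b}. of_int k \<le> g n \<and> g n < of_int k + \<theta>}"
    define T2 where "T2 = {n \<in> {a<..b}. of_int k + \<theta> \<le> g n \<and> g n \<le> of_int k + 1 - \<theta>}"
    define T3 where "T3 = {n \<in> {a<..b}. of_int k + 1 - \<theta> < g n \<and> g n < of_int k + 1}"
    have fin: "finite T1" "finite T2" "finite T3" by (auto simp: T1_def T2_def T3_def)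
    have S: "S k = T1 \<union> T2 \<union> T3" using \<theta> \<theta>2
      unfolding S_def T1_def T2_def T3_def by (auto simp: floor_eq_iff)
    have disj: "T1 \<inter> T2 = {}" "(T1 \<union> T2) \<inter> T3 = {}" using \<theta> \<theta>2
      unfolding T1_def T2_def T3_def by auto
    have "real (card T1) \<le> \<theta> / \<delta> + 1"
      by (rule card_bounded_increments[of _ _ _ a b "of_int k" g])
         (use \<delta> \<theta> inc in \<open>auto simp: T1_def\<close>)
    moreover have "real (card T3) \<le> \<theta> / \<delta> + 1"
      by (rule card_bounded_increments[of _ _ _ a b "of_int k + 1 - \<theta>" g])
         (use \<delta> \<theta> inc in \<open>auto simp: T3_def\<close>)
    moreover have "norm (\<Sum>n\<in>T2. ee (f n)) \<le> 2 / \<theta>"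
    proof (cases "T2 = {}")
      case False
      let ?m = "Min T2" and ?M = "Max T2"
      have mM: "?m \<in> T2" "?M \<in> T2" using fin False by auto
      then have "a < ?m" "?M \<le> b" by (auto simp: T2_def)
      \<comment> \<open>Monotonicity of \<open>g\<close> makes \<open>T2\<close> a block of
        consecutive integers, as Kusmin--Landau requires. Since \<open>?m\<close> exceeds
        \<open>a\<close>, the subtraction is not truncated.\<close>
      have "T2 = {?m - 1<..?M}"
      proof
        show "T2 \<subseteq> {?m - 1<..?M}"
        proof
          fix n assume n: "n \<in> T2"
          then have "?m \<le> n" "n \<le> ?M" using fin by auto
          then show "n \<in> {?m - 1<..?M}" using \<open>a < ?m\<close> by auto
        qed
        show "{?m - 1<..?M} \<subseteq> T2"
        proof
          fix n assume "n \<in> {?m - 1<..?M}"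
          then have n: "?m \<le> n" "n \<le> ?M" by auto
          then show "n \<in> T2"
            using gmono[of ?m n] gmono[of n ?M] mM unfolding T2_def by auto
        qed
      qed
      moreover have "norm (\<Sum>n\<in>{?m - 1<..?M}. ee (f n)) \<le> 2 / \<theta>"
      proof (rule kusmin_landau[OF \<theta>])
        fix n assume "n \<in> {?m - 1<..?M}"
        with calculation have "n \<in> T2" by simp
        then show "real_of_int k + \<theta> \<le> f (Suc n) - f n \<and> f (Suc n) - f n \<le> real_of_int k + 1 - \<theta>"
          by (auto simp: T2_def g_def)
      next
        fix n assume "n \<in> {?m - 1<..<?M}"
        then have "n \<in> {a<..<b}" using \<open>a < ?m\<close> \<open>?M \<le> b\<close> by auto
        then show "f (Suc n) - f n \<le> f (Suc (Suc n)) - f (Suc n)"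
          using inc[of n] \<delta> by (simp add: g_def)
      qed
      ultimately show ?thesis by simp
    qed (use \<theta> in simp)
    moreover have "(\<Sum>n\<in>S k. ee (f n)) = (\<Sum>n\<in>T1. ee (f n)) + (\<Sum>n\<in>T2. ee (f n)) + (\<Sum>n\<in>T3. ee (f n))"
      unfolding S using fin disj by (simp add: sum.union_disjoint)
    then have "norm (\<Sum>n\<in>S k. ee (f n)) \<le> norm (\<Sum>n\<in>T1. ee (f n)) + norm (\<Sum>n\<in>T2. ee (f n))
        + norm (\<Sum>n\<in>T3. ee (f n))"
      by (metis norm_triangle_mono norm_triangle_ineq order_refl)
    ultimately have "norm (\<Sum>n\<in>S k. ee (f n)) \<le> 2 * (\<theta> / \<delta> + 1) + 2 / \<theta>"
      using norm_sum_ee_le_card[of f T1] norm_sum_ee_le_card[of f T3]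
      unfolding distrib_left by (smt (verit))
    also have "\<theta> / \<delta> = 1 / \<theta>" using sq \<theta> \<delta> by (simp add: field_simps)
    also have "2 * (1 / \<theta> + 1) + 2 / \<theta> \<le> 6 / \<theta>" using \<theta> \<theta>2 by (simp add: field_simps)
    finally show ?thesis .
  qed
  define k0 where "k0 = \<lfloor>g (Suc a)\<rfloor>"
  define k1 where "k1 = \<lfloor>g b\<rfloor>"
  \<comment> \<open>The number of groups is the number of integer parts that \<open>g\<close> can
    take, hence at most its total increase plus 2.\<close>
  have "g b - g (Suc a) = (\<Sum>n\<in>{a<..<b}. g (Suc n) - g n)"
    using sum_Suc_diff_telescope[of a b g] True by simp
  also have "\<dots> \<le> real (card {a<..<b}) * (A * \<delta>)"
    by (rule sum_bounded_above) (use inc in auto)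
  also have "\<dots> \<le> real (b - a) * (A * \<delta>)"
    using \<delta> by (intro mult_right_mono) auto
  finally have rng: "g b - g (Suc a) \<le> real (b - a) * (A * \<delta>)" .
  have k: "k0 \<le> k1" unfolding k0_def k1_def using gmono[of "Suc a" b] True
    by (intro floor_mono) auto
  have "real (card {k0..k1}) = of_int k1 - of_int k0 + 1" using k by simp
  also have "\<dots> \<le> real (b - a) * (A * \<delta>) + 2"
    using rng unfolding k0_def k1_def by linarith
  finally have card: "real (card {k0..k1}) \<le> real (b - a) * (A * \<delta>) + 2" .
  have "(\<Sum>n\<in>{a<..b}. ee (f n)) = (\<Sum>k\<in>{k0..k1}. \<Sum>n\<in>S k. ee (f n))"
    unfolding S_def
  proof (rule sum.group[symmetric])
    show "(\<lambda>n. \<lfloor>g n\<rfloor>) ` {a<..b} \<subseteq> {k0..k1}"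
      unfolding k0_def k1_def by (auto intro!: floor_mono gmono)
  qed auto
  also have "norm \<dots> \<le> (\<Sum>k\<in>{k0..k1}. 6 / \<theta>)"
    by (intro sum_norm_le bound)
  also have "\<dots> = real (card {k0..k1}) * (6 / \<theta>)" by simp
  also have "\<dots> \<le> (real (b - a) * (A * \<delta>) + 2) * (6 / \<theta>)"
    using card \<theta> by (intro mult_right_mono) auto
  also have "\<dots> = 6 * A * real (b - a) * \<theta> + 12 / \<theta>"
    using \<theta> unfolding sq[symmetric] by (simp add: field_simps)
  finally show ?thesis by (simp add: \<theta>_def)
qed

section \<open>Van der Corput's test for power phases\<close>

text \<open>Two applications of the mean value theorem, to the unit difference and then to its
  derivative. The size of the value feeds van der Corput's test; its sign later shows that the
  increments of the power decrease.\<close>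

lemma second_difference_powr:
  fixes n \<gamma> :: real
  assumes "0 < n"
  shows "\<exists>\<eta>. n < \<eta> \<and> \<eta> < n + 2 \<and>
    ((n + 2) powr \<gamma> - (n + 1) powr \<gamma>) - ((n + 1) powr \<gamma> - n powr \<gamma>)
      = - (\<gamma> * (1 - \<gamma>) * \<eta> powr (\<gamma> - 2))"
proof -
  define D where "D = (\<lambda>t. (t + 1) powr \<gamma> - t powr \<gamma>)"
  have "\<exists>\<xi>>n. \<xi> < n + 1 \<and> D (n + 1) - D n
      = (n + 1 - n) * (\<gamma> * (\<xi> + 1) powr (\<gamma> - 1) - \<gamma> * \<xi> powr (\<gamma> - 1))"
    unfolding D_def using assms by (intro MVT2) (auto intro!: derivative_eq_intros)
  then obtain \<xi> where \<xi>: "n < \<xi>" "\<xi> < n + 1"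
    "D (n + 1) - D n = \<gamma> * (\<xi> + 1) powr (\<gamma> - 1) - \<gamma> * \<xi> powr (\<gamma> - 1)" by auto
  have "\<exists>\<eta>>\<xi>. \<eta> < \<xi> + 1 \<and> (\<gamma> * (\<xi> + 1) powr (\<gamma> - 1) - \<gamma> * \<xi> powr (\<gamma> - 1))
      = (\<xi> + 1 - \<xi>) * (\<gamma> * ((\<gamma> - 1) * \<eta> powr (\<gamma> - 1 - 1)))"
    using assms \<xi> by (intro MVT2) (auto intro!: derivative_eq_intros)
  then obtain \<eta> where "\<xi> < \<eta>" "\<eta> < \<xi> + 1"
    "D (n + 1) - D n = \<gamma> * ((\<gamma> - 1) * \<eta> powr (\<gamma> - 1 - 1))" using \<xi> by auto
  then show ?thesis using \<xi> unfolding D_def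
    by (intro exI[of _ \<eta>]) (auto simp: algebra_simps)
qed

text \<open>The second derivative of c t^\<gamma> has order |c| M^(\<gamma>-2) throughout the range,
  and a linear phase does not affect second differences. The constant is therefore uniform in the
  coefficients and in the interval. The range [M, 4M] leaves room for both variables of a product to
  vary by a factor 2.\<close>

lemma van_der_corput_powr:
  fixes \<gamma> :: real
  assumes \<gamma>: "0 < \<gamma>" "\<gamma> < 1"
  shows "\<exists>C>0. \<forall>c \<beta> M a b. c \<noteq> 0 \<longrightarrow> 0 < M \<longrightarrow> (\<forall>n\<in>{a<..b}. M \<le> real n \<and> real n \<le> 4 * M) \<longrightarrow>
    norm (\<Sum>n\<in>{a<..b}. ee (c * real n powr \<gamma> + \<beta> * real n))
      \<le> C * (sqrt (\<bar>c\<bar> * M powr \<gamma>) + M / sqrt (\<bar>c\<bar> * M powr \<gamma>))"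
proof -
  \<comment> \<open>The mean value point lies below n + 2 \<le> 3n \<le> 12 M, so the second
    differences vary at most by the factor 12^(2-\<gamma>).\<close>
  define \<kappa> where "\<kappa> = \<gamma> * (1 - \<gamma>) * 12 powr (\<gamma> - 2)"
  define A :: real where "A = 12 powr (2 - \<gamma>)"
  define C where "C = 24 * A * sqrt \<kappa> + 12 / sqrt \<kappa>"
  have \<kappa>: "\<kappa> > 0" using \<gamma> by (simp add: \<kappa>_def)
  have A: "A \<ge> 1" using \<gamma> by (simp add: A_def ge_one_powr_ge_zero)
  have C: "C > 0" using \<kappa> A by (simp add: C_def add_pos_pos)
  have main: "norm (\<Sum>n\<in>{a<..b}. ee (\<beta> * real n - c * real n powr \<gamma>))
      \<le> C * (sqrt (c * M powr \<gamma>) + M / sqrt (c * M powr \<gamma>))"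
    if c: "0 < c" and M: "0 < M" and rng: "\<forall>n\<in>{a<..b}. M \<le> real n \<and> real n \<le> 4 * M"
    for c \<beta> M :: real and a b :: nat
  proof (cases "a < b")
    case False
    then show ?thesis using C c M by (simp add: add_nonneg_nonneg)
  next
    case True
    define f where "f n = \<beta> * real n - c * real n powr \<gamma>" for n :: nat
    define \<delta> where "\<delta> = c * \<kappa> * M powr (\<gamma> - 2)"
    define Y where "Y = sqrt (c * M powr \<gamma>)"
    have Y: "Y > 0" using c M by (simp add: Y_def)
    have \<delta>: "\<delta> > 0" using c \<kappa> M by (simp add: \<delta>_def)
    have "M powr (\<gamma> - 2) = M powr \<gamma> / M\<^sup>2" using M by (simp add: powr_diff)
    then have sd: "sqrt \<delta> = sqrt \<kappa> * Y / M"
      using M by (simp add: \<delta>_def Y_def real_sqrt_mult real_sqrt_divide)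
    have "norm (\<Sum>n\<in>{a<..b}. ee (f n)) \<le> 6 * A * real (b - a) * sqrt \<delta> + 12 / sqrt \<delta>"
    proof (rule van_der_corput[OF \<delta> A])
      fix n assume n: "n \<in> {a<..<b}"
      then have n1: "M \<le> real n" "real n \<le> 4 * M" "1 \<le> real n" using rng by auto
      then obtain \<eta> where \<eta>: "real n < \<eta>" "\<eta> < real n + 2"
        "((real n + 2) powr \<gamma> - (real n + 1) powr \<gamma>) - ((real n + 1) powr \<gamma> - real n powr \<gamma>)
           = - (\<gamma> * (1 - \<gamma>) * \<eta> powr (\<gamma> - 2))"
        using second_difference_powr[of "real n" \<gamma>] by auto
      have eq: "f (Suc (Suc n)) - f (Suc n) - (f (Suc n) - f n) = c * (\<gamma> * (1 - \<gamma>) * \<eta> powr (\<gamma> - 2))"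
      proof -
        have "f (Suc (Suc n)) - f (Suc n) - (f (Suc n) - f n) =
          - c * (((real n + 2) powr \<gamma> - (real n + 1) powr \<gamma>) - ((real n + 1) powr \<gamma> - real n powr \<gamma>))"
          unfolding f_def of_nat_Suc by (simp add: algebra_simps)
        then show ?thesis unfolding \<eta>(3) by simp
      qed
      have "\<eta> \<le> 3 * real n" using \<eta>(2) n1(3) by simp
      then have e12: "\<eta> \<le> 12 * M" using n1(2) by simp
      have e0: "0 < \<eta>" using \<eta>(1) n1(3) by simp
      have lo: "(12 * M) powr (\<gamma> - 2) \<le> \<eta> powr (\<gamma> - 2)"
        using \<gamma> by (intro powr_mono2'[OF _ e0 e12]) simp
      have hi: "\<eta> powr (\<gamma> - 2) \<le> M powr (\<gamma> - 2)"
        using \<eta> n1 M \<gamma> by (intro powr_mono2') auto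
      have "\<delta> = c * (\<gamma> * (1 - \<gamma>) * (12 * M) powr (\<gamma> - 2))"
        using M by (simp add: \<delta>_def \<kappa>_def powr_mult)
      also have "\<dots> \<le> c * (\<gamma> * (1 - \<gamma>) * \<eta> powr (\<gamma> - 2))"
        using c \<gamma> lo by (intro mult_left_mono) auto
      finally have 1: "\<delta> \<le> f (Suc (Suc n)) - f (Suc n) - (f (Suc n) - f n)" unfolding eq .
      have "A * \<delta> = c * (\<gamma> * (1 - \<gamma>) * M powr (\<gamma> - 2)) * (12 powr (2 - \<gamma>) * 12 powr (\<gamma> - 2))"
        by (simp add: \<delta>_def \<kappa>_def A_def)
      also have "(12::real) powr (2 - \<gamma>) * 12 powr (\<gamma> - 2) = 1"
        by (simp add: powr_add[symmetric])
      finally have "c * (\<gamma> * (1 - \<gamma>) * \<eta> powr (\<gamma> - 2)) \<le> A * \<delta>"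
        using c \<gamma> hi by (simp add: mult_left_mono)
      with 1 show "\<delta> \<le> f (Suc (Suc n)) - f (Suc n) - (f (Suc n) - f n) \<and>
          f (Suc (Suc n)) - f (Suc n) - (f (Suc n) - f n) \<le> A * \<delta>" unfolding eq by simp
    qed (use True in simp)
    also have "\<dots> \<le> 6 * A * (4 * M) * sqrt \<delta> + 12 / sqrt \<delta>"
    proof -
      have "real (b - a) \<le> 4 * M" using rng True by force
      then show ?thesis using A \<delta> by (intro add_mono mult_right_mono mult_left_mono) auto
    qed
    also have "\<dots> = 24 * A * sqrt \<kappa> * Y + 12 / sqrt \<kappa> * (M / Y)"
      unfolding sd using M Y \<kappa> by (simp add: field_simps)
    also have "\<dots> \<le> C * Y + C * (M / Y)"
      using \<kappa> A M Y unfolding C_def by (intro add_mono mult_right_mono) auto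
    finally show ?thesis by (simp add: f_def Y_def algebra_simps)
  qed
  have "norm (\<Sum>n\<in>{a<..b}. ee (c * real n powr \<gamma> + \<beta> * real n))
      \<le> C * (sqrt (\<bar>c\<bar> * M powr \<gamma>) + M / sqrt (\<bar>c\<bar> * M powr \<gamma>))"
    if c: "c \<noteq> 0" and M: "0 < M" and rng: "\<forall>n\<in>{a<..b}. M \<le> real n \<and> real n \<le> 4 * M"
    for c \<beta> M :: real and a b :: nat
  proof (cases "c < 0")
    case True
    then show ?thesis using main[of "- c" M a b \<beta>] M rng by (simp add: add.commute)
  next
    case False
    \<comment> \<open>For positive c the phase is concave, while the test is stated for positive
      second differences; conjugation reverses the sign of both coefficients.\<close>
    have "(\<Sum>n\<in>{a<..b}. ee (c * real n powr \<gamma> + \<beta> * real n))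
       = cnj (\<Sum>n\<in>{a<..b}. ee (- \<beta> * real n - c * real n powr \<gamma>))"
      unfolding cnj_sum by (intro sum.cong refl) (simp add: ee_minus[symmetric])
    then show ?thesis using main[of c M a b "- \<beta>"] False c M rng
      by (simp del: cnj_sum)
  qed
  with C show ?thesis by blast
qed

section \<open>The sawtooth function\<close>

definition saw :: "real \<Rightarrow> real" where
  "saw t = frac t - 1 / 2"

text \<open>The truncated Fourier series of the sawtooth with its sign reversed: \<open>saw\<close>
  is approximated by minus this sum.\<close>

definition saw_sum :: "nat \<Rightarrow> real \<Rightarrow> real" where
  "saw_sum H t = (\<Sum>h\<in>{1..H}. Im (ee (real h * t)) / (pi * real h))"

text \<open>The Fejer kernel of order \<open>q\<close>, written as a square so that nonnegativity is
  evident and its sums over n expand into exponential sums.\<close>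

definition fejer :: "nat \<Rightarrow> real \<Rightarrow> real" where
  "fejer q t = (norm (\<Sum>h<q. ee (real h * t)))\<^sup>2 / real q"

lemma fejer_nonneg: "0 \<le> fejer q t"
  by (simp add: fejer_def)

lemma ee_add_int: "ee (real h * (t + of_int k)) = ee (real h * t)"
  using ee_add[of "real h * t" "of_int (int h * k)"] ee_int[of "int h * k"]
  by (simp add: distrib_left del: ee_int)

lemma fejer_add_int: "fejer q (t + of_int k) = fejer q t"
  by (simp add: fejer_def ee_add_int)

lemma saw_sum_add_int: "saw_sum q (t + of_int k) = saw_sum q t"
  by (simp add: saw_sum_def ee_add_int)

lemma fejer_minus: "fejer q (- t) = fejer q t"
proof -
  have "(\<Sum>h<q. ee (real h * - t)) = cnj (\<Sum>h<q. ee (real h * t))"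
    unfolding cnj_sum by (simp add: ee_minus[symmetric])
  then show ?thesis by (simp add: fejer_def del: cnj_sum)
qed

lemma saw_sum_minus: "saw_sum q (- t) = - saw_sum q t"
  by (simp add: saw_sum_def ee_minus sum_negf)

text \<open>For such t all phases stay within 60 degrees of 0, so every summand has real part at
  least 1/2; this is the origin of the 6.\<close>

lemma fejer_ge:
  assumes "0 \<le> t" "t \<le> 1 / (6 * real q)" "0 < q"
  shows "fejer q t \<ge> real q / 4"
proof -
  have "1 / 2 \<le> Re (ee (real h * t))" if "h < q" for h
  proof -
    have "real h * t \<le> real q * (1 / (6 * real q))"
      using that assms by (intro mult_mono) auto
    then have "real h * t \<le> 1 / 6" using assms by simp
    then have "2 * pi * (real h * t) \<le> 2 * pi * (1 / 6)" by (intro mult_left_mono) auto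
    then have "cos (pi / 3) \<le> cos (2 * pi * (real h * t))"
      using assms by (intro cos_monotone_0_pi_le) auto
    then show ?thesis by (simp add: ee_def cos_60)
  qed
  then have "(\<Sum>h<q. 1 / 2) \<le> (\<Sum>h<q. Re (ee (real h * t)))"
    by (intro sum_mono) auto
  then have "real q / 2 \<le> norm (\<Sum>h<q. ee (real h * t))"
    using complex_Re_le_cmod[of "\<Sum>h<q. ee (real h * t)"] by simp
  then have "(real q / 2)\<^sup>2 \<le> (norm (\<Sum>h<q. ee (real h * t)))\<^sup>2"
    by (intro power_mono) auto
  then show ?thesis using assms
    by (simp add: fejer_def field_simps power2_eq_square)
qed

text \<open>The product form avoids a division at the zeros of the sine. Each product of sine and
  cosine is a difference of sines, and the sum telescopes.\<close>

lemma dirichlet_kernel: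
  "sin (pi * u) * (1 + 2 * (\<Sum>h\<in>{1..H}. cos (2 * pi * (real h * u)))) = sin ((2 * real H + 1) * pi * u)"
proof (induction H)
  case (Suc H)
  have *: "2 * (sin x * cos y) = sin (y + x) - sin (y - x)" for x y :: real
    by (simp add: sin_add sin_diff)
  have 1: "2 * (sin (pi * u) * cos (2 * pi * (real (Suc H) * u)))
      = sin ((2 * real (Suc H) + 1) * pi * u) - sin ((2 * real H + 1) * pi * u)"
    unfolding * by (intro arg_cong2[where f = "(-)"] arg_cong[where f = sin]) (auto simp: algebra_simps)
  have "sin (pi * u) * (1 + 2 * (\<Sum>h\<in>{1..Suc H}. cos (2 * pi * (real h * u))))
     = sin (pi * u) * (1 + 2 * (\<Sum>h\<in>{1..H}. cos (2 * pi * (real h * u))))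
       + 2 * (sin (pi * u) * cos (2 * pi * (real (Suc H) * u)))"
    by (simp add: algebra_simps)
  then show ?case unfolding Suc.IH 1 by simp
qed simp

text \<open>The derivative of the difference \<open>E\<close> is the Dirichlet kernel \<open>sin (m t) / sin (\<pi> t)\<close>;
  \<open>P\<close> is the main term of its antiderivative and \<open>Q\<close> dominates the remainder.\<close>

lemma saw_sum_error:
  assumes t: "0 < t" "t \<le> 1 / 2" and H: "0 < H"
  shows "\<bar>t - 1 / 2 + saw_sum H t\<bar> \<le> 1 / (real H * t)"
proof -
  define m where "m = (2 * real H + 1) * pi"
  define E where "E u = u - 1 / 2 + saw_sum H u" for u
  define P where "P u = - cos (m * u) / (m * sin (pi * u))" for u
  define Q where "Q u = 1 / (m * sin (pi * u))" for u
  have m: "m > 0" by (simp add: m_def add_pos_pos)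
  have s: "sin (pi * u) > 0" if "t \<le> u" "u \<le> 1 / 2" for u
    using sin_pi_ge[of u u] t that by simp
  have c: "cos (pi * u) \<ge> 0" if "t \<le> u" "u \<le> 1 / 2" for u
  proof (rule cos_ge_zero)
    have "pi * u \<le> pi * (1 / 2)" using that by (intro mult_left_mono) auto
    then show "pi * u \<le> pi / 2" by simp
    show "- (pi / 2) \<le> pi * u" using that t pi_gt_zero
      by (smt (verit) mult_nonneg_nonneg divide_nonneg_nonneg)
  qed
  have dE: "(E has_real_derivative sin (m * u) / sin (pi * u)) (at u)" if "t \<le> u" "u \<le> 1 / 2" for u
  proof -
    have "(E has_real_derivative 1 + (\<Sum>h\<in>{1..H}. 2 * cos (2 * pi * (real h * u)))) (at u)"
      unfolding E_def saw_sum_def ee_def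
      by (auto intro!: derivative_eq_intros sum.cong simp: field_simps)
    moreover have "1 + (\<Sum>h\<in>{1..H}. 2 * cos (2 * pi * (real h * u))) = sin (m * u) / sin (pi * u)"
      using dirichlet_kernel[of u H] s[OF that] by (simp add: m_def field_simps sum_distrib_left)
    ultimately show ?thesis by simp
  qed
  have dP: "(P has_real_derivative sin (m * u) / sin (pi * u)
      + pi * cos (m * u) * cos (pi * u) / (m * (sin (pi * u))\<^sup>2)) (at u)" if "t \<le> u" "u \<le> 1 / 2" for u
    unfolding P_def using s[OF that] m
    by (auto intro!: derivative_eq_intros simp: field_simps power2_eq_square)
  have dQ: "(Q has_real_derivative - (pi * cos (pi * u) / (m * (sin (pi * u))\<^sup>2))) (at u)"
    if "t \<le> u" "u \<le> 1 / 2" for u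
    unfolding Q_def using s[OF that] m
    by (auto intro!: derivative_eq_intros simp: field_simps power2_eq_square)
  have w: "pi * cos (pi * u) / (m * (sin (pi * u))\<^sup>2) \<ge> 0" if "t \<le> u" "u \<le> 1 / 2" for u
    using c[OF that] m by simp
  \<comment> \<open>The point 1/2 anchors the comparison: all sines of the series vanish there, and
    m/2 is an odd multiple of \<pi>/2, which kills the cosine in \<open>P\<close>.\<close>
  have half: "E (1 / 2) = 0" "P (1 / 2) = 0" "Q (1 / 2) > 0"
  proof -
    have "sin (2 * pi * (real h * (1 / 2))) = 0" for h :: nat
      using sin_npi[of h] by (simp add: mult.commute)
    then show "E (1 / 2) = 0" unfolding E_def saw_sum_def ee_def by simp
    have "m * (1 / 2) = real H * pi + pi / 2" by (simp add: m_def algebra_simps)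
    then have "cos (m * (1 / 2)) = 0" by (simp only: cos_add) simp
    then show "P (1 / 2) = 0" by (simp add: P_def)
    show "Q (1 / 2) > 0" using m by (simp add: Q_def)
  qed
  \<comment> \<open>The derivative of \<open>E - P\<close> is -w cos(m u) with w \<ge> 0, and that
    of \<open>Q\<close> is -w. Hence \<open>E - P - Q\<close> increases and \<open>E - P + Q\<close>
    decreases on [t, 1/2], which traps \<open>E - P\<close> at t between -\<open>Q\<close> and
    \<open>Q\<close>.\<close>
  have "E t - P t - Q t \<le> E (1 / 2) - P (1 / 2) - Q (1 / 2)"
  proof (rule DERIV_nonneg_imp_nondecreasing[OF t(2)])
    fix u assume u: "t \<le> u" "u \<le> 1 / 2"
    let ?w = "pi * cos (pi * u) / (m * (sin (pi * u))\<^sup>2)"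
    have "((\<lambda>u. E u - P u - Q u) has_real_derivative ?w * (1 - cos (m * u))) (at u)"
      by (auto intro!: derivative_eq_intros dE[OF u] dP[OF u] dQ[OF u] simp: algebra_simps add_divide_distrib diff_divide_distrib)
    moreover have "?w * (1 - cos (m * u)) \<ge> 0" using w[OF u] by (intro mult_nonneg_nonneg) auto
    ultimately show "\<exists>y. ((\<lambda>u. E u - P u - Q u) has_real_derivative y) (at u) \<and> 0 \<le> y" by blast
  qed
  moreover have "E t - P t + Q t \<ge> E (1 / 2) - P (1 / 2) + Q (1 / 2)"
  proof (rule DERIV_nonpos_imp_nonincreasing[OF t(2)])
    fix u assume u: "t \<le> u" "u \<le> 1 / 2"
    let ?w = "pi * cos (pi * u) / (m * (sin (pi * u))\<^sup>2)"
    have "((\<lambda>u. E u - P u + Q u) has_real_derivative - (?w * (1 + cos (m * u)))) (at u)"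
      by (auto intro!: derivative_eq_intros dE[OF u] dP[OF u] dQ[OF u] simp: algebra_simps add_divide_distrib diff_divide_distrib)
    moreover have "?w * (1 + cos (m * u)) \<ge> 0"
      using w[OF u] cos_ge_minus_one[of "m * u"] by (intro mult_nonneg_nonneg) linarith+
    ultimately show "\<exists>y. ((\<lambda>u. E u - P u + Q u) has_real_derivative y) (at u) \<and> y \<le> 0"
      by (meson neg_le_0_iff_le)
  qed
  moreover have "\<bar>P t\<bar> \<le> Q t"
    using s[of t] t m by (simp add: P_def Q_def abs_mult divide_simps)
  ultimately have "\<bar>E t\<bar> \<le> 2 * Q t" using half by linarith
  also have "\<dots> \<le> 2 / (m * (2 * t))"
  proof -
    have "m * (2 * t) \<le> m * sin (pi * t)"
      using sin_pi_ge[of t t] t m by (intro mult_left_mono) auto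
    then have "1 / (m * sin (pi * t)) \<le> 1 / (m * (2 * t))"
      using t m by (intro divide_left_mono mult_pos_pos s) auto
    then show ?thesis unfolding Q_def by simp
  qed
  also have "\<dots> \<le> 1 / (real H * t)"
  proof -
    have "real H * 1 \<le> (2 * real H + 1) * pi"
      using pi_gt3 by (intro mult_mono) auto
    then have "real H \<le> m" by (simp add: m_def)
    then show ?thesis using t H m by (simp add: frac_le)
  qed
  finally show ?thesis by (simp add: E_def)
qed

text \<open>The error is of order min(1, 1/(H t)). For t of size 1/2^j the kernel of order 2^j is of
  size 1/t, so the dyadic kernels together dominate it after division by H. The number of kernels is
  only logarithmic in H.\<close>

lemma saw_sum_fejer_half:
  assumes t: "0 \<le> t" "t \<le> 1 / 2" and H: "H = 2 ^ J"
  shows "\<bar>t - 1 / 2 + saw_sum H t\<bar> \<le> 48 / real H * (\<Sum>j\<le>J. fejer (2 ^ j) t)"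
proof -
  have H0: "real H > 0" by (simp add: H)
  have single: "fejer (2 ^ j) t \<le> (\<Sum>j\<le>J. fejer (2 ^ j) t)" if "j \<le> J" for j
    using that by (intro member_le_sum) (auto simp: fejer_nonneg)
  show ?thesis
  proof (cases "t \<le> 1 / (6 * real H)")
    case True
    have "\<bar>saw_sum H t\<bar> \<le> (\<Sum>h\<in>{1..H}. 2 * t)"
      unfolding saw_sum_def
    proof (rule order.trans[OF sum_abs], rule sum_mono)
      fix h assume h: "h \<in> {1..H}"
      have "\<bar>sin (2 * pi * (real h * t))\<bar> \<le> \<bar>2 * pi * (real h * t)\<bar>"
        by (rule abs_sin_x_le_abs_x)
      then show "\<bar>Im (ee (real h * t)) / (pi * real h)\<bar> \<le> 2 * t"
        using h t by (simp add: ee_def abs_mult field_simps)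
    qed
    also have "\<dots> = 2 * (real H * t)" by simp
    also have "\<dots> \<le> 1 / 3" using True H0 by (simp add: field_simps)
    finally have "\<bar>t - 1 / 2 + saw_sum H t\<bar> \<le> 1" using t by linarith
    also have "1 \<le> 48 / real H * fejer (2 ^ J) t"
      using fejer_ge[OF t(1) True] H0 fejer_nonneg[of "2 ^ J" t] by (simp add: H field_simps)
    also have "\<dots> \<le> 48 / real H * (\<Sum>j\<le>J. fejer (2 ^ j) t)"
      using single[of J] H0 by (intro mult_left_mono) auto
    finally show ?thesis .
  next
    case False
    have t0: "t > 0" using False H0 by (smt (verit) divide_nonneg_nonneg)
    have "\<bar>t - 1 / 2 + saw_sum H t\<bar> \<le> 1 / (real H * t)"
      by (rule saw_sum_error) (use t0 t H0 in auto)
    also have "\<exists>j\<le>J. 1 / (real H * t) \<le> 48 / real H * fejer (2 ^ j) t"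
    proof (cases "t \<le> 1 / 6")
      case small: True
      \<comment> \<open>The largest power of two below 1/(6t) is the order at which
        \<open>fejer_ge\<close> still applies. It gives at least (1/4)(?y/2) = 1/(48 t), the origin
        of the 48.\<close>
      let ?y = "1 / (6 * t)"
      have "?y \<ge> 1" using small t0 by (simp add: field_simps)
      then have "1 \<le> nat \<lfloor>?y\<rfloor>" by linarith
      then obtain j where j: "2 ^ j \<le> nat \<lfloor>?y\<rfloor>" "nat \<lfloor>?y\<rfloor> < 2 ^ (j + 1)"
        using ex_power_ivl1[of 2 "nat \<lfloor>?y\<rfloor>"] by auto
      have "real (2 ^ j) \<le> real (nat \<lfloor>?y\<rfloor>)" using j(1) of_nat_mono by blast
      then have j1: "real (2 ^ j) \<le> ?y" using \<open>?y \<ge> 1\<close> by linarith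
      have "real (nat \<lfloor>?y\<rfloor>) + 1 \<le> real (2 ^ (j + 1))" using j(2) by linarith
      then have j2: "?y \<le> real (2 ^ (j + 1))" using \<open>?y \<ge> 1\<close> by linarith
      have "?y < real H" using False t0 H0 by (simp add: field_simps)
      then have "real (2 ^ j) < real H" using j1 by (rule le_less_trans[rotated])
      then have "(2::real) ^ j < 2 ^ J" by (simp add: H)
      then have "j \<le> J" by simp
      moreover have "t \<le> 1 / (6 * real (2 ^ j))" using j1 t0 by (simp add: field_simps)
      then have "real (2 ^ j) / 4 \<le> fejer (2 ^ j) t" using fejer_ge[OF t(1), of "2 ^ j"] by simp
      then have "?y / 8 \<le> fejer (2 ^ j) t" using j2 by simp
      then have "48 / real H * (?y / 8) \<le> 48 / real H * fejer (2 ^ j) t"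
        using H0 by (intro mult_left_mono) auto
      ultimately show ?thesis using t0 by (intro exI[of _ j]) auto
    next
      case False
      have "fejer (2 ^ 0) t = 1" by (simp add: fejer_def)
      moreover have "1 / (real H * t) \<le> 48 / real H" using False t0 H0
        by (simp add: field_simps)
      ultimately show ?thesis by (intro exI[of _ 0]) simp
    qed
    then obtain j where "j \<le> J" "1 / (real H * t) \<le> 48 / real H * fejer (2 ^ j) t" by blast
    note this(2)
    also have "48 / real H * fejer (2 ^ j) t \<le> 48 / real H * (\<Sum>j\<le>J. fejer (2 ^ j) t)"
      using single[OF \<open>j \<le> J\<close>] H0 by (intro mult_left_mono) auto
    finally show ?thesis .
  qed
qed

text \<open>Periodicity and the reflection r = 1 - {t} reduce to [0, 1/2]. The jumps at the integers
  are included: the kernel of order \<open>H\<close> equals \<open>H\<close> there.\<close>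

lemma saw_approximation:
  assumes H: "H = 2 ^ J"
  shows "\<bar>saw t + saw_sum H t\<bar> \<le> 48 / real H * (\<Sum>j\<le>J. fejer (2 ^ j) t)"
proof (cases "frac t \<le> 1 / 2")
  case True
  have t: "t = frac t + of_int \<lfloor>t\<rfloor>" by (simp add: frac_def)
  have "saw_sum H t = saw_sum H (frac t)" "fejer q t = fejer q (frac t)" for q
    by (metis t saw_sum_add_int, metis t fejer_add_int)
  then show ?thesis
    using saw_sum_fejer_half[OF _ True H] by (simp add: saw_def frac_ge_0)
next
  case False
  define r where "r = 1 - frac t"
  have t: "t = - r + of_int (\<lfloor>t\<rfloor> + 1)" by (simp add: r_def frac_def)
  have "saw_sum H t = - saw_sum H r" "fejer q t = fejer q r" for q
    by (metis t saw_sum_add_int saw_sum_minus, metis t fejer_add_int fejer_minus)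
  moreover have "saw t = - (r - 1 / 2)" by (simp add: saw_def r_def)
  moreover have "0 \<le> r" "r \<le> 1 / 2" using False frac_lt_1[of t] by (auto simp: r_def)
  ultimately show ?thesis
    using saw_sum_fejer_half[OF _ _ H, of r] by (simp add: abs_minus_commute)
qed

section \<open>Vaughan's identity and divisor sums\<close>

definition moeb :: "nat \<Rightarrow> real" where
  "moeb n = (if squarefree n then (- 1) ^ card (prime_factors n) else 0)"

lemma abs_moeb_le: "\<bar>moeb n\<bar> \<le> 1"
  by (simp add: moeb_def)

lemma moeb_1 [simp]: "moeb (Suc 0) = 1"
  by (simp add: moeb_def)

lemma moeb_prime_mult:
  assumes p: "prime p" "\<not> p dvd d" and d: "squarefree d"
  shows "moeb (p * d) = - moeb d"
proof -
  have cop: "coprime p d" using p by (simp add: prime_imp_coprime)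
  have d0: "d \<noteq> 0" using d not_squarefree_0 by metis
  have "squarefree (p * d)" using squarefree_mult_coprime[OF cop] p d
    by (simp add: squarefree_prime)
  moreover have "prime_factors (p * d) = insert p (prime_factors d)"
    using p d0 by (subst prime_factors_product) (auto simp: prime_prime_factors)
  moreover have "p \<notin> prime_factors d" using p by (auto simp: in_prime_factors_iff)
  ultimately show ?thesis using d by (simp add: moeb_def)
qed

text \<open>For a fixed prime p dividing n, the squarefree divisors fall into pairs d, p d with p
  not dividing d, and the two signs cancel.\<close>

lemma moeb_sum:
  fixes n :: nat
  assumes "n > 0"
  shows "(\<Sum>d | d dvd n. moeb d) = (if n = 1 then 1 else 0)"
proof (cases "n = 1")
  case False
  then obtain p where p: "prime p" "p dvd n" using prime_factor_nat by blast
  define A where "A = {d. d dvd n \<and> squarefree d \<and> \<not> p dvd d}"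
  have fin: "finite {d. d dvd n}" using assms by simp
  then have finA: "finite A" unfolding A_def by (rule rev_finite_subset) auto
  have eq: "{d. d dvd n \<and> squarefree d} = A \<union> (*) p ` A"
  proof (intro equalityI subsetI)
    fix d assume d: "d \<in> {d. d dvd n \<and> squarefree d}"
    show "d \<in> A \<union> (*) p ` A"
    proof (cases "p dvd d")
      case True
      then obtain e where e: "d = p * e" by blast
      have "\<not> p dvd e"
      proof
        assume "p dvd e"
        then have "p\<^sup>2 dvd d" by (simp add: e power2_eq_square)
        then show False using d p by (auto simp: squarefree_def)
      qed
      moreover have "squarefree e" "e dvd n"
        using d e by (auto dest: squarefree_multD dvd_mult_right)
      ultimately show ?thesis using e by (auto simp: A_def)
    qed (use d in \<open>auto simp: A_def\<close>)
  next
    fix d assume "d \<in> A \<union> (*) p ` A"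
    moreover have "p * e dvd n \<and> squarefree (p * e)" if "e \<in> A" for e
    proof -
      have cop: "coprime p e" using p that by (simp add: A_def prime_imp_coprime)
      then show ?thesis using that p squarefree_mult_coprime[OF cop]
        by (auto simp: A_def squarefree_prime intro: divides_mult)
    qed
    ultimately show "d \<in> {d. d dvd n \<and> squarefree d}" by (auto simp: A_def)
  qed
  have "(\<Sum>d | d dvd n. moeb d) = (\<Sum>d | d dvd n \<and> squarefree d. moeb d)"
    using fin by (intro sum.mono_neutral_right) (auto simp: moeb_def)
  also have "\<dots> = (\<Sum>d\<in>A. moeb d) + (\<Sum>d\<in>(*) p ` A. moeb d)"
    unfolding eq using finA by (intro sum.union_disjoint) (auto simp: A_def)
  also have "(\<Sum>d\<in>(*) p ` A. moeb d) = (\<Sum>d\<in>A. moeb (p * d))"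
    using p by (subst sum.reindex) (auto simp: inj_on_def)
  also have "\<dots> = (\<Sum>d\<in>A. - moeb d)"
    using p by (intro sum.cong) (auto simp: A_def moeb_prime_mult)
  finally show ?thesis using False by (simp add: sum_negf)
qed simp

lemma mangoldt_le_ln:
  assumes "n > 0"
  shows "(mangoldt n :: real) \<le> ln (real n)"
proof -
  have "(mangoldt n :: real) \<le> (\<Sum>d | d dvd n. mangoldt d)"
    using assms by (intro member_le_sum) (auto simp: mangoldt_nonneg)
  then show ?thesis using mangoldt_sum[of n, where 'a = real] assms by simp
qed

section \<open>Vaughan's identity\<close>

text \<open>Both sides run over the pairs (b, c) with b c dividing n.\<close>

lemma sum_divisor_pairs_swap:
  fixes F :: "nat \<Rightarrow> nat \<Rightarrow> 'a::comm_monoid_add"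
  assumes n: "n > 0"
  shows "(\<Sum>c | c dvd n. \<Sum>b | b dvd n div c. F b c) = (\<Sum>b | b dvd n. \<Sum>c | c dvd n div b. F b c)"
proof -
  let ?D = "{d. d dvd n}"
  have fin: "finite ?D" using n by simp
  have eq: "{y. y dvd n div x} = {y \<in> ?D. x * y dvd n}" if "x \<in> ?D" for x
    using that n by (auto elim!: dvdE intro: dvd_mult_right)
  have "(\<Sum>c\<in>?D. \<Sum>b | b dvd n div c. F b c) = (\<Sum>c\<in>?D. \<Sum>b | b \<in> ?D \<and> c * b dvd n. F b c)"
    using eq by (intro sum.cong) auto
  also have "\<dots> = (\<Sum>b\<in>?D. \<Sum>c | c \<in> ?D \<and> c * b dvd n. F b c)"
    by (rule sum.swap_restrict) (use fin in auto)
  also have "\<dots> = (\<Sum>b\<in>?D. \<Sum>c | c dvd n div b. F b c)"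
    using eq by (intro sum.cong) (auto simp: mult.commute)
  finally show ?thesis .
qed

text \<open>The left side groups the pairs (b, c) with b c dividing n by their product l;
  associativity of Dirichlet convolution.\<close>

lemma sum_divisor_chain:
  fixes G :: "nat \<Rightarrow> nat \<Rightarrow> 'a::comm_monoid_add"
  assumes n: "n > 0"
  shows "(\<Sum>l | l dvd n. \<Sum>b | b dvd l. G b (l div b)) = (\<Sum>b | b dvd n. \<Sum>c | c dvd n div b. G b c)"
proof -
  let ?D = "{d. d dvd n}"
  have fin: "finite ?D" using n by simp
  have "(\<Sum>l\<in>?D. \<Sum>b | b dvd l. G b (l div b)) = (\<Sum>l\<in>?D. \<Sum>b | b \<in> ?D \<and> b dvd l. G b (l div b))"
    by (intro sum.cong) (auto intro: dvd_trans)
  also have "\<dots> = (\<Sum>b\<in>?D. \<Sum>l | l \<in> ?D \<and> b dvd l. G b (l div b))"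
    by (rule sum.swap_restrict) (use fin in auto)
  also have "\<dots> = (\<Sum>b\<in>?D. \<Sum>c | c dvd n div b. G b c)"
  proof (rule sum.cong[OF refl])
    fix b assume b: "b \<in> ?D"
    then have "b > 0" using n by (auto intro!: Nat.gr0I)
    then show "(\<Sum>l | l \<in> ?D \<and> b dvd l. G b (l div b)) = (\<Sum>c | c dvd n div b. G b c)"
      using b by (intro sum.reindex_bij_witness[of _ "\<lambda>c. b * c" "\<lambda>l. l div b"]) (auto elim!: dvdE)
  qed
  finally show ?thesis .
qed

text \<open>The Dirichlet convolution of the Moebius and von Mangoldt functions, both cut off at
  \<open>Z\<close>; it is supported on l \<le> Z^2.\<close>

definition vaughan_w :: "nat \<Rightarrow> nat \<Rightarrow> real" where
  "vaughan_w Z l = (\<Sum>b | b dvd l. if b \<le> Z \<and> l div b \<le> Z then moeb b * mangoldt (l div b) else 0)"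

text \<open>The convolution of the constant 1 with the Moebius function restricted to arguments
  above \<open>Z\<close>. It vanishes for 1 \<le> m \<le> Z, which keeps both variables of the
  bilinear term above \<open>Z\<close>.\<close>

definition vaughan_v :: "nat \<Rightarrow> nat \<Rightarrow> real" where
  "vaughan_v Z m = (\<Sum>b | b dvd m. if Z < b then moeb b else 0)"

text \<open>For n > Z the value at n is the sum over c > Z dividing n of \<Lambda>(c) times the
  indicator of n/c = 1. Expanding the indicator by Moebius and splitting at b = Z gives the bilinear
  term from b > Z; for b \<le> Z the sum over c > Z is completed to all c, which yields a logarithm
  minus the part with c \<le> Z.\<close>

theorem vaughan_identity:
  assumes n: "n > Z" "Z \<ge> 1"
  shows "mangoldt n = (\<Sum>b | b dvd n. (if b \<le> Z then moeb b else 0) * ln (real (n div b)))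
    - (\<Sum>l | l dvd n. vaughan_w Z l)
    + (\<Sum>c | c dvd n. (if Z < c then mangoldt c else 0) * vaughan_v Z (n div c))"
proof -
  have n0: "n > 0" using n by simp
  let ?L = "\<lambda>c. if Z < c then mangoldt c else 0 :: real"
  let ?M = "\<lambda>b. if b \<le> Z then moeb b else 0 :: real"
  have pos: "n div c > 0" if "c dvd n" for c using that n0 by (auto elim!: dvdE)
  have "mangoldt n = (\<Sum>c | c dvd n. ?L c * (if n div c = 1 then 1 else 0))"
  proof -
    have "(\<Sum>c | c dvd n. ?L c * (if n div c = 1 then 1 else 0)) = (\<Sum>c\<in>{n}. ?L c)"
      using n0 by (intro sum.mono_neutral_cong_right) (auto elim!: dvdE)
    then show ?thesis using n by simp
  qed
  also have "\<dots> = (\<Sum>c | c dvd n. ?L c * (\<Sum>b | b dvd n div c. moeb b))"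
    using moeb_sum pos by (intro sum.cong) auto
  also have "\<dots> = (\<Sum>c | c dvd n. ?L c * (vaughan_v Z (n div c) + (\<Sum>b | b dvd n div c. ?M b)))"
    unfolding vaughan_v_def sum.distrib[symmetric]
    by (intro sum.cong arg_cong2[where f = "(*)"]) auto
  also have "\<dots> = (\<Sum>c | c dvd n. ?L c * vaughan_v Z (n div c))
      + (\<Sum>c | c dvd n. \<Sum>b | b dvd n div c. ?M b * ?L c)"
    by (simp add: algebra_simps sum.distrib sum_distrib_left)
  also have "(\<Sum>c | c dvd n. \<Sum>b | b dvd n div c. ?M b * ?L c)
      = (\<Sum>b | b dvd n. \<Sum>c | c dvd n div b. ?M b * ?L c)"
    by (rule sum_divisor_pairs_swap[OF n0])
  \<comment> \<open>Completion in c: the full sum of \<Lambda> over the divisors of n/b is a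
    logarithm, and the terms c \<le> Z are subtracted again.\<close>
  also have "\<dots> = (\<Sum>b | b dvd n. ?M b * ln (real (n div b))
      - (\<Sum>c | c dvd n div b. if b \<le> Z \<and> c \<le> Z then moeb b * mangoldt c else 0))"
  proof (intro sum.cong refl)
    fix b assume b: "b \<in> {b. b dvd n}"
    have "ln (real (n div b)) = (\<Sum>c | c dvd n div b. mangoldt c :: real)"
      using mangoldt_sum[of "n div b", where 'a = real] pos b by simp
    then have "?M b * ln (real (n div b)) = (\<Sum>c | c dvd n div b. ?M b * mangoldt c)"
      by (simp add: sum_distrib_left)
    then show "(\<Sum>c | c dvd n div b. ?M b * ?L c) = ?M b * ln (real (n div b))
      - (\<Sum>c | c dvd n div b. if b \<le> Z \<and> c \<le> Z then moeb b * mangoldt c else 0)"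
      unfolding sum_subtractf[symmetric]
      by (simp add: sum_subtractf[symmetric]) (intro sum.cong impI, auto)
  qed
  also have "\<dots> = (\<Sum>b | b dvd n. ?M b * ln (real (n div b))) - (\<Sum>l | l dvd n. vaughan_w Z l)"
    unfolding sum_subtractf vaughan_w_def
    by (subst sum_divisor_chain[OF n0, where G = "\<lambda>b c. if b \<le> Z \<and> c \<le> Z then moeb b * mangoldt c else 0"]) simp
  finally show ?thesis by simp
qed

text \<open>Dropping both truncations and the signs leaves the full divisor sum of \<Lambda>, which
  is the logarithm.\<close>

lemma abs_vaughan_w_le:
  assumes "l > 0"
  shows "\<bar>vaughan_w Z l\<bar> \<le> ln (real l)"
proof -
  have "\<bar>vaughan_w Z l\<bar> \<le> (\<Sum>b | b dvd l. mangoldt (l div b))"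
    unfolding vaughan_w_def
  proof (rule order.trans[OF sum_abs], rule sum_mono)
    fix b assume "b \<in> {b. b dvd l}"
    show "\<bar>if b \<le> Z \<and> l div b \<le> Z then moeb b * mangoldt (l div b) else 0\<bar> \<le> mangoldt (l div b)"
      using mult_right_mono[OF abs_moeb_le[of b], of "mangoldt (l div b)"]
      by (auto simp: mangoldt_nonneg abs_mult)
  qed
  also have "\<dots> = (\<Sum>d | d dvd l. mangoldt d)"
    using assms by (intro sum.reindex_bij_witness[of _ "\<lambda>d. l div d" "\<lambda>d. l div d"]) (auto elim!: dvdE)
  also have "\<dots> = ln (real l)" using mangoldt_sum[of l, where 'a = real] assms by simp
  finally show ?thesis .
qed

lemma vaughan_w_eq_0:
  assumes "l > Z\<^sup>2"
  shows "vaughan_w Z l = 0"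
  unfolding vaughan_w_def
proof (rule sum.neutral, clarify)
  fix b assume "b dvd l"
  then have "l = b * (l div b)" by simp
  moreover have "b * (l div b) \<le> Z * Z" if "b \<le> Z" "l div b \<le> Z"
    using that by (intro mult_mono) auto
  ultimately have "\<not> (b \<le> Z \<and> l div b \<le> Z)"
    using assms by (auto simp: power2_eq_square)
  then show "(if b \<le> Z \<and> l div b \<le> Z then moeb b * mangoldt (l div b) else 0) = 0" by auto
qed

lemma abs_vaughan_v_le: "\<bar>vaughan_v Z m\<bar> \<le> real (card {d. d dvd m})"
proof -
  have "\<bar>vaughan_v Z m\<bar> \<le> (\<Sum>b | b dvd m. 1)"
    unfolding vaughan_v_def
    by (rule order.trans[OF sum_abs], rule sum_mono) (use abs_moeb_le in auto)
  then show ?thesis by simp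
qed

lemma vaughan_v_eq_0:
  assumes "m \<le> Z" "m > 0"
  shows "vaughan_v Z m = 0"
  unfolding vaughan_v_def using assms by (intro sum.neutral) (auto dest: dvd_imp_le)

text \<open>Substitution n = l m; the conditions N < l m \<le> N1 translate exactly into the rounded
  quotients.\<close>

lemma sum_divisors_interval:
  fixes F :: "nat \<Rightarrow> nat \<Rightarrow> 'a::comm_monoid_add"
  shows "(\<Sum>n\<in>{N<..N1}. \<Sum>l | l dvd n. F l (n div l))
    = (\<Sum>l\<in>{1..N1}. \<Sum>m\<in>{N div l<..N1 div l}. F l m)"
proof -
  have "(\<Sum>n\<in>{N<..N1}. \<Sum>l | l dvd n. F l (n div l))
      = (\<Sum>n\<in>{N<..N1}. \<Sum>l | l \<in> {1..N1} \<and> l dvd n. F l (n div l))"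
  proof (rule sum.cong[OF refl])
    fix n assume n: "n \<in> {N<..N1}"
    have "l \<in> {1..N1}" if "l dvd n" for l
      using that n dvd_imp_le[OF that] by (cases l) auto
    then have "{l. l dvd n} = {l. l \<in> {1..N1} \<and> l dvd n}" by blast
    then show "(\<Sum>l | l dvd n. F l (n div l)) = (\<Sum>l | l \<in> {1..N1} \<and> l dvd n. F l (n div l))"
      by simp
  qed
  also have "\<dots> = (\<Sum>l\<in>{1..N1}. \<Sum>n | n \<in> {N<..N1} \<and> l dvd n. F l (n div l))"
    by (rule sum.swap_restrict) auto
  also have "\<dots> = (\<Sum>l\<in>{1..N1}. \<Sum>m\<in>{N div l<..N1 div l}. F l m)"
  proof (rule sum.cong[OF refl])
    fix l assume "l \<in> {1..N1}"
    then have l: "l > 0" by simp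
    show "(\<Sum>n | n \<in> {N<..N1} \<and> l dvd n. F l (n div l)) = (\<Sum>m\<in>{N div l<..N1 div l}. F l m)"
      using l by (intro sum.reindex_bij_witness[of _ "\<lambda>m. l * m" "\<lambda>n. n div l"])
        (auto simp: div_less_iff_less_mult less_eq_div_iff_mult_less_eq mult.commute elim!: dvdE)
  qed
  finally show ?thesis .
qed

section \<open>Moments of the divisor function\<close>

definition num_divisors :: "nat \<Rightarrow> nat" where
  "num_divisors n = card {d. d dvd n}"

lemma num_divisors_mult_le:
  assumes "a > 0" "b > 0"
  shows "num_divisors (a * b) \<le> num_divisors a * num_divisors b"
proof -
  have "{d. d dvd a * b} \<subseteq> (\<lambda>(x, y). x * y) ` ({d. d dvd a} \<times> {d. d dvd b})"
  proof
    fix d assume "d \<in> {d. d dvd a * b}"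
    then obtain x y where "d = x * y" "x dvd a" "y dvd b" using division_decomp by blast
    then show "d \<in> (\<lambda>(x, y). x * y) ` ({d. d dvd a} \<times> {d. d dvd b})" by force
  qed
  then have "card {d. d dvd a * b} \<le> card ({d. d dvd a} \<times> {d. d dvd b})"
    using assms by (intro surj_card_le) auto
  then show ?thesis by (simp add: num_divisors_def card_cartesian_product)
qed

lemma harm_alt: "harm n = (\<Sum>k\<in>{1..n}. 1 / real k)"
  by (simp add: harm_def inverse_eq_divide)

lemma harm_mono_le: "m \<le> n \<Longrightarrow> (harm m :: real) \<le> harm n"
  unfolding harm_alt by (intro sum_mono2) auto

lemma sum_num_divisors_le: "(\<Sum>n\<in>{1..M}. real (num_divisors n)) \<le> real M * harm M"
proof -
  have "(\<Sum>n\<in>{1..M}. real (num_divisors n)) = (\<Sum>n\<in>{0<..M}. \<Sum>l | l dvd n. 1)"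
    by (intro sum.cong) (auto simp: num_divisors_def)
  also have "\<dots> = (\<Sum>l\<in>{1..M}. \<Sum>m\<in>{0 div l<..M div l}. 1)"
    by (rule sum_divisors_interval)
  also have "\<dots> \<le> (\<Sum>l\<in>{1..M}. real M / real l)"
    using of_nat_div_le_of_nat by (intro sum_mono) auto
  finally show ?thesis by (simp add: harm_alt sum_distrib_left)
qed

lemma sum_num_divisors_over_le: "(\<Sum>n\<in>{1..M}. real (num_divisors n) / real n) \<le> (harm M)\<^sup>2"
proof -
  have "(\<Sum>n\<in>{1..M}. real (num_divisors n) / real n)
      = (\<Sum>n\<in>{0<..M}. \<Sum>l | l dvd n. 1 / (real l * real (n div l)))"
    by (intro sum.cong) (auto simp: num_divisors_def simp flip: of_nat_mult)
  also have "\<dots> = (\<Sum>l\<in>{1..M}. \<Sum>m\<in>{0 div l<..M div l}. 1 / (real l * real m))"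
    by (rule sum_divisors_interval)
  also have "\<dots> \<le> (\<Sum>l\<in>{1..M}. \<Sum>m\<in>{1..M}. 1 / (real l * real m))"
    by (intro sum_mono sum_mono2) (auto dest: order.trans[OF _ div_le_dividend])
  also have "\<dots> = (harm M)\<^sup>2"
    by (simp add: harm_alt power2_eq_square sum_product)
  finally show ?thesis .
qed

text \<open>One factor d(n) is opened as a sum over l dividing n, the other is bounded by d(l)
  d(n/l), and the two first moments above finish. This mean square controls \<open>vaughan_v\<close>
  after Cauchy--Schwarz.\<close>

lemma sum_num_divisors_square_le:
  "(\<Sum>n\<in>{1..M}. (real (num_divisors n))\<^sup>2) \<le> real M * harm M ^ 3"
proof -
  have "(\<Sum>n\<in>{1..M}. (real (num_divisors n))\<^sup>2)
      = (\<Sum>n\<in>{0<..M}. \<Sum>l | l dvd n. real (num_divisors (l * (n div l))))"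
    by (intro sum.cong) (auto simp: num_divisors_def power2_eq_square)
  also have "\<dots> = (\<Sum>l\<in>{1..M}. \<Sum>m\<in>{0 div l<..M div l}. real (num_divisors (l * m)))"
    by (rule sum_divisors_interval)
  also have "\<dots> \<le> (\<Sum>l\<in>{1..M}. \<Sum>m\<in>{0 div l<..M div l}. real (num_divisors l) * real (num_divisors m))"
  proof (intro sum_mono)
    fix l m assume "l \<in> {1..M}" "m \<in> {0 div l<..M div l}"
    then show "real (num_divisors (l * m)) \<le> real (num_divisors l) * real (num_divisors m)"
      using num_divisors_mult_le[of l m] by (simp flip: of_nat_mult)
  qed
  also have "\<dots> = (\<Sum>l\<in>{1..M}. real (num_divisors l) * (\<Sum>m\<in>{1..M div l}. real (num_divisors m)))"
    unfolding sum_distrib_left by (intro sum.cong) auto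
  also have "\<dots> \<le> (\<Sum>l\<in>{1..M}. real (num_divisors l) * (real M / real l * harm M))"
  proof (intro sum_mono mult_left_mono)
    fix l assume "l \<in> {1..M}"
    have "(\<Sum>m\<in>{1..M div l}. real (num_divisors m)) \<le> real (M div l) * harm (M div l)"
      by (rule sum_num_divisors_le)
    also have "\<dots> \<le> real M / real l * harm M"
      by (intro mult_mono of_nat_div_le_of_nat harm_mono_le) (auto simp: harm_nonneg)
    finally show "(\<Sum>m\<in>{1..M div l}. real (num_divisors m)) \<le> real M / real l * harm M" .
  qed simp
  also have "\<dots> = (\<Sum>l\<in>{1..M}. real (num_divisors l) / real l) * (real M * harm M)"
    unfolding sum_distrib_right by (intro sum.cong) auto
  also have "\<dots> \<le> (harm M)\<^sup>2 * (real M * harm M)"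
    by (intro mult_right_mono sum_num_divisors_over_le) (auto simp: harm_nonneg)
  finally show ?thesis by (simp add: power2_eq_square power3_eq_cube mult_ac)
qed

section \<open>Type I and type II sums\<close>

definition phase :: "real \<Rightarrow> real \<Rightarrow> real \<Rightarrow> nat \<Rightarrow> complex" where
  "phase \<gamma> h \<alpha> n = ee (h * real n powr \<gamma> + \<alpha> * real n)"

lemma norm_phase [simp]: "norm (phase \<gamma> h \<alpha> n) = 1"
  by (simp add: phase_def)

text \<open>A name for "C is an admissible constant in van der Corput's test for the exponent
  \<gamma>", so that a fixed constant can be handed to the type I, type II and Fejer
  estimates.\<close>

definition vdc_const :: "real \<Rightarrow> real \<Rightarrow> bool" where
  "vdc_const \<gamma> C \<longleftrightarrow> C > 0 \<and>
    (\<forall>c \<beta> M a b. c \<noteq> 0 \<longrightarrow> 0 < M \<longrightarrow> (\<forall>n\<in>{a<..b}. M \<le> real n \<and> real n \<le> 4 * M) \<longrightarrow>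
      norm (\<Sum>n\<in>{a<..b}. ee (c * real n powr \<gamma> + \<beta> * real n))
        \<le> C * (sqrt (\<bar>c\<bar> * M powr \<gamma>) + M / sqrt (\<bar>c\<bar> * M powr \<gamma>)))"

lemma phase_sum_bound:
  assumes "vdc_const \<gamma> C" "c \<noteq> 0" "0 < M"
    and "\<And>n. n \<in> {a<..b} \<Longrightarrow> M \<le> real n \<and> real n \<le> 4 * M"
    and y: "0 < y" "y \<le> \<bar>c\<bar> * M powr \<gamma>" "\<bar>c\<bar> * M powr \<gamma> \<le> Y"
  shows "norm (\<Sum>n\<in>{a<..b}. ee (c * real n powr \<gamma> + \<beta> * real n)) \<le> C * (sqrt Y + M / sqrt y)"
proof -
  have "norm (\<Sum>n\<in>{a<..b}. ee (c * real n powr \<gamma> + \<beta> * real n))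
        \<le> C * (sqrt (\<bar>c\<bar> * M powr \<gamma>) + M / sqrt (\<bar>c\<bar> * M powr \<gamma>))"
    using assms(1-4) unfolding vdc_const_def by blast
  also have "\<dots> \<le> C * (sqrt Y + M / sqrt y)"
    using assms y unfolding vdc_const_def
    by (intro mult_left_mono add_mono divide_left_mono) auto
  finally show ?thesis .
qed

lemma powr_diff_bounds:
  fixes x y A \<gamma> :: real
  assumes \<gamma>: "0 < \<gamma>" "\<gamma> < 1" and A: "0 < A" "A \<le> x" "x < y" "y \<le> 2 * A"
  shows "\<gamma> * (2 * A) powr (\<gamma> - 1) * (y - x) \<le> y powr \<gamma> - x powr \<gamma>"
    and "y powr \<gamma> - x powr \<gamma> \<le> \<gamma> * A powr (\<gamma> - 1) * (y - x)"
proof -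
  have "\<exists>\<xi>>x. \<xi> < y \<and> y powr \<gamma> - x powr \<gamma> = (y - x) * (\<gamma> * \<xi> powr (\<gamma> - 1))"
    using A by (intro MVT2) (auto intro!: derivative_eq_intros)
  then obtain \<xi> where \<xi>: "x < \<xi>" "\<xi> < y" "y powr \<gamma> - x powr \<gamma> = (y - x) * (\<gamma> * \<xi> powr (\<gamma> - 1))"
    by blast
  have "(2 * A) powr (\<gamma> - 1) \<le> \<xi> powr (\<gamma> - 1)" "\<xi> powr (\<gamma> - 1) \<le> A powr (\<gamma> - 1)"
    using A \<xi> \<gamma> by (auto intro!: powr_mono2')
  then show "\<gamma> * (2 * A) powr (\<gamma> - 1) * (y - x) \<le> y powr \<gamma> - x powr \<gamma>"
    "y powr \<gamma> - x powr \<gamma> \<le> \<gamma> * A powr (\<gamma> - 1) * (y - x)"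
    unfolding \<xi>(3) using A \<gamma> by (auto simp: mult_ac intro!: mult_left_mono)
qed

text \<open>The square is expanded and the sum over m is moved inside, where the correlation of two
  fixed l, k is an exponential sum.\<close>

lemma norm_sum_square_le:
  fixes z :: "nat \<Rightarrow> nat \<Rightarrow> complex"
  shows "(\<Sum>m\<in>Ms. (norm (\<Sum>l\<in>B. z l m))\<^sup>2)
    \<le> (\<Sum>l\<in>B. \<Sum>k\<in>B. norm (\<Sum>m\<in>Ms. z l m * cnj (z k m)))"
proof -
  have "of_real (\<Sum>m\<in>Ms. (norm (\<Sum>l\<in>B. z l m))\<^sup>2)
      = (\<Sum>m\<in>Ms. \<Sum>l\<in>B. \<Sum>k\<in>B. z l m * cnj (z k m))"
    unfolding of_real_sum complex_norm_square cnj_sum sum_product ..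
  also have "\<dots> = (\<Sum>l\<in>B. \<Sum>m\<in>Ms. \<Sum>k\<in>B. z l m * cnj (z k m))"
    by (rule sum.swap)
  also have "\<dots> = (\<Sum>l\<in>B. \<Sum>k\<in>B. \<Sum>m\<in>Ms. z l m * cnj (z k m))"
    by (intro sum.cong refl sum.swap)
  finally have "norm (complex_of_real (\<Sum>m\<in>Ms. (norm (\<Sum>l\<in>B. z l m))\<^sup>2))
      \<le> (\<Sum>l\<in>B. \<Sum>k\<in>B. norm (\<Sum>m\<in>Ms. z l m * cnj (z k m)))"
    by (simp only:) (intro order.trans[OF norm_sum] sum_mono norm_sum)
  then show ?thesis unfolding norm_of_real by (simp add: sum_nonneg)
qed

text \<open>The correlation of the rows l and k is again a power phase in m, with coefficient h
  (k^\<gamma> - l^\<gamma>) and some linear term. By the mean value theorem this coefficient lies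
  between constant multiples of h A^(\<gamma>-1) and h A^(\<gamma>-1) K.\<close>

lemma type_II_pair:
  fixes l k A K N N1 :: nat and X :: real
  assumes \<gamma>: "0 < \<gamma>" "\<gamma> < 1" and C: "vdc_const \<gamma> C" and h: "0 < h"
    and A: "1 \<le> A" "K \<le> A" and N: "1 \<le> N" "N1 \<le> 2 * N"
    and l: "A \<le> l" "l < k" "k < A + K"
    and X: "X = h * real N powr \<gamma>"
  shows "norm (\<Sum>m\<in>{max (N div l) (N div k)<..min (N1 div l) (N1 div k)}.
      phase \<gamma> h \<alpha> (k * m) * cnj (phase \<gamma> h \<alpha> (l * m)))
    \<le> C * (sqrt (X * real K / real A) + real N / real A * sqrt (real A / (\<gamma> * X)))"
proof -
  let ?I = "{max (N div l) (N div k)<..min (N1 div l) (N1 div k)}"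
  \<comment> \<open>From A \<le> l < 2A and N < l m \<le> 2N it follows that m lies between N/(2A)
    and 2N/A, a ratio of 4.\<close>
  define M where "M = real N / (2 * real A)"
  define c where "c = h * (real k powr \<gamma> - real l powr \<gamma>)"
  have M: "M > 0" using N A by (simp add: M_def)
  have X0: "X > 0" using N h by (simp add: X)
  have diff: "\<gamma> * (2 * real A) powr (\<gamma> - 1) * (real k - real l) \<le> real k powr \<gamma> - real l powr \<gamma>"
    "real k powr \<gamma> - real l powr \<gamma> \<le> \<gamma> * real A powr (\<gamma> - 1) * (real k - real l)"
    using \<gamma> A l by (auto intro!: powr_diff_bounds)
  have "\<gamma> * (2 * real A) powr (\<gamma> - 1) * 1 \<le> \<gamma> * (2 * real A) powr (\<gamma> - 1) * (real k - real l)"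
    using \<gamma> l by (intro mult_left_mono) auto
  with diff(1) have lo: "\<gamma> * (2 * real A) powr (\<gamma> - 1) \<le> real k powr \<gamma> - real l powr \<gamma>" by simp
  have "\<gamma> * real A powr (\<gamma> - 1) * (real k - real l) \<le> 1 * real A powr (\<gamma> - 1) * real K"
    using \<gamma> l by (intro mult_mono) auto
  with diff(2) have hi: "real k powr \<gamma> - real l powr \<gamma> \<le> real A powr (\<gamma> - 1) * real K" by simp
  have lo0: "0 < \<gamma> * (2 * real A) powr (\<gamma> - 1)" using \<gamma> A by simp
  have c0: "c > 0" using lo lo0 h unfolding c_def by simp
  have Mp: "M powr \<gamma> = real N powr \<gamma> / (2 * real A) powr \<gamma>"
    using N A by (simp add: M_def powr_divide)
  have "\<gamma> * X / (2 * real A) = h * (\<gamma> * (2 * real A) powr (\<gamma> - 1)) * M powr \<gamma>"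
    unfolding Mp X using A by (simp add: powr_diff field_simps)
  also have "\<dots> \<le> \<bar>c\<bar> * M powr \<gamma>"
    using c0 lo h unfolding c_def by (intro mult_right_mono) auto
  finally have y: "\<gamma> * X / (2 * real A) \<le> \<bar>c\<bar> * M powr \<gamma>" .
  have "\<bar>c\<bar> * M powr \<gamma> \<le> h * (real A powr (\<gamma> - 1) * real K) * M powr \<gamma>"
    using c0 hi h unfolding c_def by (intro mult_right_mono) auto
  also have "M powr \<gamma> \<le> real N powr \<gamma> / real A powr \<gamma>"
    unfolding Mp using A \<gamma> by (intro divide_left_mono powr_mono2) auto
  also have "h * (real A powr (\<gamma> - 1) * real K) * (real N powr \<gamma> / real A powr \<gamma>) = X * real K / real A"
    unfolding X using A by (simp add: powr_diff field_simps)
  finally have Y: "\<bar>c\<bar> * M powr \<gamma> \<le> X * real K / real A" using h by (simp add: mult_left_mono)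
  have "(\<Sum>m\<in>?I. phase \<gamma> h \<alpha> (k * m) * cnj (phase \<gamma> h \<alpha> (l * m)))
      = (\<Sum>m\<in>?I. ee (c * real m powr \<gamma> + \<alpha> * (real k - real l) * real m))"
  proof (rule sum.cong[OF refl])
    fix m
    show "phase \<gamma> h \<alpha> (k * m) * cnj (phase \<gamma> h \<alpha> (l * m))
      = ee (c * real m powr \<gamma> + \<alpha> * (real k - real l) * real m)"
      unfolding phase_def ee_minus[symmetric] ee_add[symmetric] c_def
      by (rule arg_cong[where f = ee]) (simp add: powr_mult algebra_simps)
  qed
  also have "norm \<dots> \<le> C * (sqrt (X * real K / real A) + M / sqrt (\<gamma> * X / (2 * real A)))"
  proof (rule phase_sum_bound[OF C _ M _ _ y Y])
    fix m assume "m \<in> ?I"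
    then have "N div l < m" "m \<le> N1 div l" by auto
    then have m: "N < m * l" "m * l \<le> N1"
      using A l by (auto simp: div_less_iff_less_mult less_eq_div_iff_mult_less_eq)
    have "m * l \<le> m * (2 * A)" using A l by (intro mult_left_mono) auto
    then have "N \<le> m * (2 * A)" using m by linarith
    then have "real N \<le> real (m * (2 * A))" by (rule of_nat_mono)
    then have "M \<le> real m" using A by (simp add: M_def field_simps)
    moreover have "m * A \<le> m * l" using l by (intro mult_left_mono) auto
    then have "m * A \<le> 2 * N" using m N by linarith
    then have "real (m * A) \<le> real (2 * N)" by (rule of_nat_mono)
    then have "real m \<le> 4 * M" using A by (simp add: M_def field_simps)
    ultimately show "M \<le> real m \<and> real m \<le> 4 * M" by simp
  qed (use c0 \<gamma> X0 A in auto)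
  also have "\<dots> \<le> C * (sqrt (X * real K / real A) + real N / real A * sqrt (real A / (\<gamma> * X)))"
  proof (intro mult_left_mono add_mono order.refl)
    have "M / sqrt (\<gamma> * X / (2 * real A)) = M * sqrt (2 * (A / (\<gamma> * X)))"
      by (simp add: real_sqrt_divide real_sqrt_mult)
    also have "\<dots> \<le> M * (2 * sqrt (real A / (\<gamma> * X)))"
    proof -
      have "sqrt (2 * (A / (\<gamma> * X))) \<le> sqrt (4 * (A / (\<gamma> * X)))"
        using \<gamma> X0 by (intro real_sqrt_le_mono mult_right_mono) auto
      also have "\<dots> = 2 * sqrt (real A / (\<gamma> * X))" by (simp only: real_sqrt_mult real_sqrt_four)
      finally show ?thesis using M by (intro mult_left_mono) auto
    qed
    also have "\<dots> = real N / real A * sqrt (real A / (\<gamma> * X))" by (simp add: M_def)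
    finally show "M / sqrt (\<gamma> * X / (2 * real A)) \<le> real N / real A * sqrt (real A / (\<gamma> * X))" .
  qed (use C in \<open>auto simp: vdc_const_def\<close>)
  finally show ?thesis .
qed

text \<open>Cauchy--Schwarz in m removes \<open>v\<close>, of which only a mean square is known, and
  leaves pairs of rows from a block of at most \<open>K\<close> values l. There are at most
  \<open>K\<close> diagonal pairs, bounded trivially, and the others are bounded by
  \<open>type_II_pair\<close>.\<close>

lemma type_II_block:
  fixes A K N N1 :: nat and X :: real and u v :: "nat \<Rightarrow> complex"
  assumes \<gamma>: "0 < \<gamma>" "\<gamma> < 1" and C: "vdc_const \<gamma> C" and h: "0 < h"
    and A: "1 \<le> A" "1 \<le> K" "K \<le> A" and N: "1 \<le> N" "N1 \<le> 2 * N"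
    and B: "B \<subseteq> {A..<A + K}"
    and X: "X = h * real N powr \<gamma>"
    and u: "\<And>l. l \<in> B \<Longrightarrow> norm (u l) \<le> G"
    and v: "(\<Sum>m\<in>{1..N1 div A}. (norm (v m))\<^sup>2) \<le> F\<^sup>2 * real (N1 div A)"
  shows "(norm (\<Sum>l\<in>B. \<Sum>m\<in>{N div l<..N1 div l}. u l * v m * phase \<gamma> h \<alpha> (l * m)))\<^sup>2
    \<le> F\<^sup>2 * G\<^sup>2 * (2 * real N / real A) * (real K * (2 * real N / real A)
        + (real K)\<^sup>2 * (C * (sqrt (X * real K / real A) + real N / real A * sqrt (real A / (\<gamma> * X)))))"
proof -
  let ?Ms = "{1..N1 div A}"
  let ?R = "C * (sqrt (X * real K / real A) + real N / real A * sqrt (real A / (\<gamma> * X)))"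
  have X0: "X > 0" using N h by (simp add: X)
  have R0: "?R \<ge> 0" using C X0 \<gamma> unfolding vdc_const_def
    by (intro mult_nonneg_nonneg add_nonneg_nonneg) auto
  have fin: "finite B" using B finite_subset by blast
  define I where "I l k = {max (N div l) (N div k)<..min (N1 div l) (N1 div k)}" for l k
  \<comment> \<open>Extension by zero makes the range of m independent of l, as the interchange of
    sums requires.\<close>
  define z where "z l m = (if m \<in> {N div l<..N1 div l} then u l * phase \<gamma> h \<alpha> (l * m) else 0)" for l m
  have sub: "{N div l<..N1 div l} \<subseteq> ?Ms" if "l \<in> B" for l
  proof -
    have "N1 div l \<le> N1 div A" using that B A by (intro div_le_mono2) auto
    then show ?thesis by auto
  qed
  have NA: "real (N1 div A) \<le> 2 * real N / real A"
  proof -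
    have "real (N1 div A) \<le> real N1 / real A" by (rule of_nat_div_le_of_nat)
    also have "\<dots> \<le> real (2 * N) / real A" using N A by (intro divide_right_mono of_nat_mono) auto
    finally show ?thesis by simp
  qed
  have "(\<Sum>l\<in>B. \<Sum>m\<in>{N div l<..N1 div l}. u l * v m * phase \<gamma> h \<alpha> (l * m))
      = (\<Sum>l\<in>B. \<Sum>m\<in>?Ms. v m * z l m)"
  proof (rule sum.cong[OF refl])
    fix l assume l: "l \<in> B"
    show "(\<Sum>m\<in>{N div l<..N1 div l}. u l * v m * phase \<gamma> h \<alpha> (l * m)) = (\<Sum>m\<in>?Ms. v m * z l m)"
      by (rule sum.mono_neutral_cong_left) (use sub[OF l] in \<open>auto simp: z_def\<close>)
  qed
  also have "\<dots> = (\<Sum>m\<in>?Ms. v m * (\<Sum>l\<in>B. z l m))"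
    unfolding sum_distrib_left by (rule sum.swap)
  finally have eq: "(\<Sum>l\<in>B. \<Sum>m\<in>{N div l<..N1 div l}. u l * v m * phase \<gamma> h \<alpha> (l * m))
      = (\<Sum>m\<in>?Ms. v m * (\<Sum>l\<in>B. z l m))" .
  have "norm (\<Sum>m\<in>?Ms. v m * (\<Sum>l\<in>B. z l m)) \<le> (\<Sum>m\<in>?Ms. norm (v m) * norm (\<Sum>l\<in>B. z l m))"
    by (rule sum_norm_le) (simp add: norm_mult)
  then have "(norm (\<Sum>m\<in>?Ms. v m * (\<Sum>l\<in>B. z l m)))\<^sup>2
      \<le> (\<Sum>m\<in>?Ms. norm (v m) * norm (\<Sum>l\<in>B. z l m))\<^sup>2"
    by (intro power_mono) auto
  also have "\<dots> \<le> (\<Sum>m\<in>?Ms. (norm (v m))\<^sup>2) * (\<Sum>m\<in>?Ms. (norm (\<Sum>l\<in>B. z l m))\<^sup>2)"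
    by (rule Cauchy_Schwarz_ineq_sum)
  also have "\<dots> \<le> (F\<^sup>2 * (2 * real N / real A)) * (G\<^sup>2 * (real K * (2 * real N / real A) + (real K)\<^sup>2 * ?R))"
  proof (intro mult_mono)
    show "(\<Sum>m\<in>?Ms. (norm (v m))\<^sup>2) \<le> F\<^sup>2 * (2 * real N / real A)"
      using v mult_left_mono[OF NA, of "F\<^sup>2"] by simp
    \<comment> \<open>The off-diagonal bound is added on the diagonal as well, so that the double
      sum evaluates in closed form.\<close>
    have pair: "norm (\<Sum>m\<in>?Ms. z l m * cnj (z k m)) \<le> G\<^sup>2 * ((if l = k then 2 * real N / real A else 0) + ?R)"
      if lk: "l \<in> B" "k \<in> B" for l k
    proof -
      have "(\<Sum>m\<in>?Ms. z l m * cnj (z k m))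
          = (\<Sum>m\<in>I l k. u l * cnj (u k) * (phase \<gamma> h \<alpha> (l * m) * cnj (phase \<gamma> h \<alpha> (k * m))))"
        by (rule sum.mono_neutral_cong_right)
           (use sub[OF lk(1)] in \<open>auto simp: z_def I_def\<close>)
      also have "norm \<dots> = norm (u l) * norm (u k)
          * norm (\<Sum>m\<in>I l k. phase \<gamma> h \<alpha> (l * m) * cnj (phase \<gamma> h \<alpha> (k * m)))"
        unfolding sum_distrib_left[symmetric] by (simp add: norm_mult)
      also have "\<dots> \<le> G * G * ((if l = k then 2 * real N / real A else 0) + ?R)"
      proof (intro mult_mono u lk)
        show "0 \<le> G" using u[OF lk(1)] norm_ge_zero order.trans by blast
        show "norm (\<Sum>m\<in>I l k. phase \<gamma> h \<alpha> (l * m) * cnj (phase \<gamma> h \<alpha> (k * m)))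
            \<le> (if l = k then 2 * real N / real A else 0) + ?R"
        proof (cases l k rule: linorder_cases)
          case equal
          have "norm (\<Sum>m\<in>I l k. phase \<gamma> h \<alpha> (l * m) * cnj (phase \<gamma> h \<alpha> (k * m)))
              \<le> (\<Sum>m\<in>I l k. 1)"
            by (rule sum_norm_le) (simp add: norm_mult)
          also have "\<dots> \<le> real (card ?Ms)"
            using sub[OF lk(1)] by (simp del: card_atLeastAtMost card_greaterThanAtMost)
              (intro card_mono, auto simp: I_def)
          also have "\<dots> \<le> 2 * real N / real A" using NA by simp
          finally show ?thesis using equal R0 by simp
        next
          case less
          have "norm (\<Sum>m\<in>I l k. phase \<gamma> h \<alpha> (k * m) * cnj (phase \<gamma> h \<alpha> (l * m))) \<le> ?R"
            unfolding I_def using lk B less A by (intro type_II_pair[OF \<gamma> C h _ _ N _ _ _ X]) auto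
          moreover have "(\<Sum>m\<in>I l k. phase \<gamma> h \<alpha> (l * m) * cnj (phase \<gamma> h \<alpha> (k * m)))
            = cnj (\<Sum>m\<in>I l k. phase \<gamma> h \<alpha> (k * m) * cnj (phase \<gamma> h \<alpha> (l * m)))"
            unfolding cnj_sum by (simp add: mult.commute)
          ultimately show ?thesis using less by (simp del: cnj_sum)
        next
          case greater
          have "norm (\<Sum>m\<in>I k l. phase \<gamma> h \<alpha> (l * m) * cnj (phase \<gamma> h \<alpha> (k * m))) \<le> ?R"
            unfolding I_def using lk B greater A by (intro type_II_pair[OF \<gamma> C h _ _ N _ _ _ X]) auto
          moreover have "I k l = I l k" by (simp add: I_def max.commute min.commute)
          ultimately show ?thesis using greater by simp
        qed
      qed (use R0 in \<open>auto simp: intro!: mult_nonneg_nonneg order.trans[OF norm_ge_zero u[OF lk(1)]]\<close>)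
      finally show ?thesis by (simp add: power2_eq_square)
    qed
    have "(\<Sum>m\<in>?Ms. (norm (\<Sum>l\<in>B. z l m))\<^sup>2)
        \<le> (\<Sum>l\<in>B. \<Sum>k\<in>B. norm (\<Sum>m\<in>?Ms. z l m * cnj (z k m)))"
      by (rule norm_sum_square_le)
    also have "\<dots> \<le> (\<Sum>l\<in>B. \<Sum>k\<in>B. G\<^sup>2 * ((if l = k then 2 * real N / real A else 0) + ?R))"
      by (intro sum_mono pair)
    also have "\<dots> = G\<^sup>2 * (real (card B) * (2 * real N / real A) + (real (card B))\<^sup>2 * ?R)"
    proof -
      have "(\<Sum>l\<in>B. \<Sum>k\<in>B. g * ((if l = k then x else 0) + y))
          = g * (real (card B) * x + (real (card B))\<^sup>2 * y)" for g x y :: real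
        using fin by (simp add: sum_distrib_left[symmetric] sum.distrib sum.delta
          power2_eq_square distrib_left mult.assoc)
      then show ?thesis .
    qed
    also have "\<dots> \<le> G\<^sup>2 * (real K * (2 * real N / real A) + (real K)\<^sup>2 * ?R)"
    proof -
      have "card B \<le> K" using card_mono[OF _ B] by simp
      then show ?thesis using R0
        by (intro mult_left_mono add_mono mult_right_mono of_nat_mono power_mono) auto
    qed
    finally show "(\<Sum>m\<in>?Ms. (norm (\<Sum>l\<in>B. z l m))\<^sup>2) \<le> G\<^sup>2 * (real K * (2 * real N / real A) + (real K)\<^sup>2 * ?R)" .
  qed (auto intro: sum_nonneg)
  finally show ?thesis unfolding eq by (simp add: mult_ac)
qed

text \<open>The range of l is cut into blocks with constant l div K. The block at A = j K
  contributes N/j times a common saving, and summing over j costs only a harmonic number. The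
  condition K \<le> L0 excludes j = 0, where a block would not lie in a range [A, 2A].\<close>

theorem type_II_sum:
  assumes \<gamma>: "0 < \<gamma>" "\<gamma> < 1"
  shows "\<exists>D>0. \<forall>h \<alpha> N N1 K L0 L1 G F u v. 0 < h \<longrightarrow> 1 \<le> K \<longrightarrow> K \<le> L0 \<longrightarrow> 1 \<le> N \<longrightarrow> N1 \<le> 2 * N \<longrightarrow>
    0 \<le> G \<longrightarrow> 0 \<le> F \<longrightarrow> (\<forall>l\<in>{L0..L1}. norm (u l) \<le> G) \<longrightarrow>
    (\<forall>Y. Y \<le> N1 \<longrightarrow> (\<Sum>m\<in>{1..Y}. (norm (v m))\<^sup>2) \<le> F\<^sup>2 * real Y) \<longrightarrow>
    norm (\<Sum>l\<in>{L0..L1}. \<Sum>m\<in>{N div l<..N1 div l}. u l * v m * phase \<gamma> h \<alpha> (l * m))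
      \<le> D * F * G * real N * harm L1 * sqrt (1 / real K
          + sqrt (h * real N powr \<gamma> * real K * real L1) / real N + sqrt (real L1 / (h * real N powr \<gamma>)))"
proof -
  obtain C where C: "vdc_const \<gamma> C" using van_der_corput_powr[OF \<gamma>] unfolding vdc_const_def by blast
  have C0: "C > 0" using C by (simp add: vdc_const_def)
  define D2 where "D2 = 4 + 2 * C + 2 * C / sqrt \<gamma>"
  have D2: "D2 > 0" "4 \<le> D2" "2 * C \<le> D2" "2 * C / sqrt \<gamma> \<le> D2"
    using C0 \<gamma> by (auto simp: D2_def add_pos_pos)
  show ?thesis
  proof (intro exI[of _ "sqrt D2"] conjI allI impI)
    fix h \<alpha> :: real and N N1 K L0 L1 :: nat and G F :: real and u v :: "nat \<Rightarrow> complex"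
    assume h: "0 < h" and K: "1 \<le> K" "K \<le> L0" and N: "1 \<le> N" "N1 \<le> 2 * N"
      and GF: "0 \<le> G" "0 \<le> F" and u: "\<forall>l\<in>{L0..L1}. norm (u l) \<le> G"
      and v: "\<forall>Y. Y \<le> N1 \<longrightarrow> (\<Sum>m\<in>{1..Y}. (norm (v m))\<^sup>2) \<le> F\<^sup>2 * real Y"
    define X where "X = h * real N powr \<gamma>"
    have X0: "X > 0" using N h by (simp add: X_def)
    define R where "R = 1 / real K + sqrt (X * real K * real L1) / real N + sqrt (real L1 / X)"
    have R0: "R \<ge> 0" using X0 by (simp add: R_def)
    define T where "T l = (\<Sum>m\<in>{N div l<..N1 div l}. u l * v m * phase \<gamma> h \<alpha> (l * m))" for l
    define B where "B j = {l \<in> {L0..L1}. l div K = j}" for j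
    have block: "norm (\<Sum>l\<in>B j. T l) \<le> F * G * (real N / real j) * (sqrt D2 * sqrt R)"
      if j: "j \<in> {1..L1}" for j
    proof (cases "B j = {}")
      case True
      then show ?thesis using GF D2 R0 by simp
    next
      case False
      define A where "A = j * K"
      have A: "1 \<le> A" "K \<le> A" using j K by (auto simp: A_def)
      have sub: "B j \<subseteq> {A..<A + K}"
      proof
        fix l assume "l \<in> B j"
        then have "l div K = j" by (simp add: B_def)
        then show "l \<in> {A..<A + K}" using K dividend_less_div_times[of K l]
          by (auto simp: A_def add.commute)
      qed
      have AL: "A \<le> L1"
      proof -
        obtain l where "l \<in> B j" using False by blast
        then have "A \<le> l" "l \<le> L1" using sub by (auto simp: B_def)
        then show ?thesis by simp
      qed
      have "(norm (\<Sum>l\<in>B j. T l))\<^sup>2 \<le> F\<^sup>2 * G\<^sup>2 * (2 * real N / real A) * (real K * (2 * real N / real A)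
        + (real K)\<^sup>2 * (C * (sqrt (X * real K / real A) + real N / real A * sqrt (real A / (\<gamma> * X)))))"
        unfolding T_def
      proof (rule type_II_block[OF \<gamma> C h A(1) K(1) A(2) N sub X_def])
        show "norm (u l) \<le> G" if "l \<in> B j" for l using u that by (auto simp: B_def)
        show "(\<Sum>m\<in>{1..N1 div A}. (norm (v m))\<^sup>2) \<le> F\<^sup>2 * real (N1 div A)"
          using v by simp
      qed
      \<comment> \<open>With A = j K the extracted factor is (N/j)^2. The bracket lists the relative
        size of the diagonal and of the two terms of van der Corput's bound.\<close>
      also have "\<dots> = F\<^sup>2 * G\<^sup>2 * (real N * real K / real A)\<^sup>2 * (4 * (1 / real K) + 2 * C * (real A / real N * sqrt (X * real K / real A))
          + 2 * C / sqrt \<gamma> * sqrt (real A / X))"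
        using A K N \<gamma> by (simp add: real_sqrt_mult real_sqrt_divide field_simps power2_eq_square)
      also have "\<dots> \<le> F\<^sup>2 * G\<^sup>2 * (real N * real K / real A)\<^sup>2 * (D2 * (1 / real K) + D2 * (sqrt (X * real K * real L1) / real N)
          + D2 * sqrt (real L1 / X))"
      proof (intro mult_left_mono add_mono mult_mono)
        have "real A / real N * sqrt (X * real K / real A) = sqrt (X * real K * real A) / real N"
        proof -
          have "X * real K * real A = X * real K / real A * (real A)\<^sup>2"
            using A by (simp add: power2_eq_square)
          then have "sqrt (X * real K * real A) = sqrt (X * real K / real A) * real A"
            by (simp only: real_sqrt_mult real_sqrt_abs abs_of_nat)
          then show ?thesis by simp
        qed
        also have "\<dots> \<le> sqrt (X * real K * real L1) / real N"
          using AL X0 by (intro divide_right_mono real_sqrt_le_mono mult_left_mono) auto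
        finally show "real A / real N * sqrt (X * real K / real A) \<le> sqrt (X * real K * real L1) / real N" .
        show "sqrt (real A / X) \<le> sqrt (real L1 / X)"
          using AL X0 by (intro real_sqrt_le_mono divide_right_mono) auto
      qed (use D2 C0 X0 in \<open>auto intro!: mult_nonneg_nonneg\<close>)
      also have "\<dots> = F\<^sup>2 * G\<^sup>2 * (real N / real j)\<^sup>2 * (D2 * R)"
        using K j by (simp add: A_def R_def algebra_simps)
      also have "\<dots> = (F * G * (real N / real j) * (sqrt D2 * sqrt R))\<^sup>2"
        using D2 R0 unfolding power_mult_distrib by simp
      finally show ?thesis
        by (rule power2_le_imp_le) (use GF D2 R0 in \<open>auto intro!: mult_nonneg_nonneg\<close>)
    qed
    have "(\<Sum>l\<in>{L0..L1}. T l) = (\<Sum>j\<in>{1..L1}. \<Sum>l\<in>B j. T l)"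
      unfolding B_def
    proof (rule sum.group[symmetric])
      show "(\<lambda>l. l div K) ` {L0..L1} \<subseteq> {1..L1}"
      proof clarify
        fix l assume l: "l \<in> {L0..L1}"
        then have "K div K \<le> l div K" using K by (intro div_le_mono) auto
        then show "l div K \<in> {1..L1}" using K l
          by (auto intro: order.trans[OF div_le_dividend])
      qed
    qed auto
    also have "norm \<dots> \<le> (\<Sum>j\<in>{1..L1}. F * G * (real N / real j) * (sqrt D2 * sqrt R))"
      by (intro sum_norm_le block)
    also have "\<dots> = sqrt D2 * F * G * real N * harm L1 * sqrt R"
      unfolding harm_alt sum_distrib_left sum_distrib_right by (intro sum.cong) auto
    finally show "norm (\<Sum>l\<in>{L0..L1}. \<Sum>m\<in>{N div l<..N1 div l}. u l * v m * phase \<gamma> h \<alpha> (l * m))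
      \<le> sqrt D2 * F * G * real N * harm L1 * sqrt (1 / real K
          + sqrt (h * real N powr \<gamma> * real K * real L1) / real N + sqrt (real L1 / (h * real N powr \<gamma>)))"
      unfolding T_def R_def X_def .
  qed (use D2 in simp)
qed

section \<open>Type I sums\<close>

text \<open>For fixed l the phase in m has coefficient h l^\<gamma> and m has size N/l, so the
  governing quantity h l^\<gamma> (N/l)^\<gamma> equals \<open>X\<close> for every l.\<close>

lemma type_I_inner:
  fixes l N N1 :: nat and X :: real
  assumes C: "vdc_const \<gamma> C" and h: "0 < h" and N: "1 \<le> N" "N1 \<le> 2 * N" and l: "1 \<le> l"
    and X: "X = h * real N powr \<gamma>" and t: "t \<le> N1 div l"
  shows "norm (\<Sum>m\<in>{N div l<..t}. phase \<gamma> h \<alpha> (l * m)) \<le> C * (sqrt X + real N / real l / sqrt X)"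
proof -
  define c where "c = h * real l powr \<gamma>"
  have c: "c > 0" using h l by (simp add: c_def)
  have X0: "X > 0" using N h by (simp add: X)
  have cM: "\<bar>c\<bar> * (real N / real l) powr \<gamma> = X"
    using l N c by (simp add: c_def X powr_divide)
  have "(\<Sum>m\<in>{N div l<..t}. phase \<gamma> h \<alpha> (l * m))
      = (\<Sum>m\<in>{N div l<..t}. ee (c * real m powr \<gamma> + \<alpha> * real l * real m))"
    by (intro sum.cong refl) (simp add: phase_def c_def powr_mult mult_ac)
  also have "norm \<dots> \<le> C * (sqrt X + real N / real l / sqrt X)"
  proof (rule phase_sum_bound[OF C])
    fix m assume "m \<in> {N div l<..t}"
    then have "N div l < m" "m \<le> N1 div l" using t by auto
    then have m: "N < m * l" "m * l \<le> N1"
      using l by (auto simp: div_less_iff_less_mult less_eq_div_iff_mult_less_eq)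
    then have "real N \<le> real (m * l)" "real (m * l) \<le> real (2 * N)"
      using N by (auto simp del: of_nat_mult)
    then show "real N / real l \<le> real m \<and> real m \<le> 4 * (real N / real l)"
      using l by (simp add: field_simps)
  qed (use c X0 N l cM in auto)
  finally show ?thesis .
qed

text \<open>Partial summation removes the logarithm. It is increasing, so its end value and its
  variation are each at most ln(2N).\<close>

lemma type_I_log:
  fixes l N N1 :: nat and X :: real
  assumes C: "vdc_const \<gamma> C" and h: "0 < h" and N: "1 \<le> N" "N \<le> N1" "N1 \<le> 2 * N" and l: "1 \<le> l" "l \<le> N"
    and X: "X = h * real N powr \<gamma>"
  shows "norm (\<Sum>m\<in>{N div l<..N1 div l}. of_real (ln (real m)) * phase \<gamma> h \<alpha> (l * m))
    \<le> C * (sqrt X + real N / real l / sqrt X) * (2 * ln (2 * real N))"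
proof -
  let ?a = "N div l" and ?b = "N1 div l"
  let ?R = "C * (sqrt X + real N / real l / sqrt X)"
  have X0: "X > 0" using N h by (simp add: X)
  have R0: "?R \<ge> 0" using C X0 unfolding vdc_const_def
    by (intro mult_nonneg_nonneg add_nonneg_nonneg) auto
  have ab: "?a \<le> ?b" using N by (intro div_le_mono)
  have a1: "1 \<le> ?a" using div_le_mono[of l N l] l by simp
  have "norm (\<Sum>m\<in>{?a<..?b}. of_real (ln (real m)) * phase \<gamma> h \<alpha> (l * m))
    \<le> ?R * (norm (complex_of_real (ln (real ?b)))
      + (\<Sum>n\<in>{?a<..<?b}. norm (complex_of_real (ln (real (Suc n))) - of_real (ln (real n)))))"
    by (rule partial_summation_bound[OF ab]) (rule type_I_inner[OF C h N(1,3) l(1) X])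
  also have "\<dots> \<le> ?R * (2 * ln (2 * real N))"
  proof (rule mult_left_mono[OF _ R0])
    have b1: "real ?b \<le> 2 * real N"
    proof -
      have "?b \<le> 2 * N" using div_le_dividend[of N1 l] N by linarith
      then show ?thesis by linarith
    qed
    have lb: "0 \<le> ln (real ?b)" "ln (real ?b) \<le> ln (2 * real N)"
      using a1 ab b1 by auto
    have "(\<Sum>n\<in>{?a<..<?b}. norm (complex_of_real (ln (real (Suc n))) - of_real (ln (real n))))
      = (\<Sum>n\<in>{?a<..<?b}. ln (real (Suc n)) - ln (real n))"
      by (intro sum.cong refl) (simp flip: of_real_diff)
    also have "\<dots> \<le> ln (2 * real N)"
    proof (cases "?a < ?b")
      case True
      have "0 \<le> ln (real (Suc ?a))" by simp
      then show ?thesis using lb sum_Suc_diff_telescope[OF True, of "\<lambda>n. ln (real n)"] by linarith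
    next
      case False
      then have "{?a<..<?b} = {}" by auto
      then show ?thesis using N by (simp only: sum.empty) simp
    qed
    finally show "norm (complex_of_real (ln (real ?b)))
      + (\<Sum>n\<in>{?a<..<?b}. norm (complex_of_real (ln (real (Suc n))) - of_real (ln (real n))))
      \<le> 2 * ln (2 * real N)" using lb by simp
  qed
  finally show ?thesis .
qed

section \<open>Exponential sums over primes\<close>

lemma log_power_bound:
  fixes \<epsilon> :: real
  assumes "0 < \<epsilon>"
  shows "\<exists>C>0. \<forall>N::nat. 1 \<le> N \<longrightarrow> (1 + ln (2 * real N)) ^ k \<le> C * real N powr \<epsilon>"
proof (cases "k = 0")
  case True
  then show ?thesis using assms by (intro exI[of _ 1]) (auto intro!: ge_one_powr_ge_zero)
next
  case False
  define \<delta> where "\<delta> = \<epsilon> / real k"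
  have \<delta>: "\<delta> > 0" using assms False by (simp add: \<delta>_def)
  define c where "c = 1 + 2 powr \<delta> / \<delta>"
  have c: "c > 0" using \<delta> by (simp add: c_def add_pos_nonneg)
  show ?thesis
  proof (intro exI[of _ "c ^ k"] conjI allI impI)
    fix N :: nat assume N: "1 \<le> N"
    have "ln (2 * real N) \<le> (2 * real N) powr \<delta> / \<delta>"
      using N \<delta> by (intro ln_powr_bound) auto
    also have "\<dots> = 2 powr \<delta> / \<delta> * real N powr \<delta>" by (simp add: powr_mult)
    finally have "1 + ln (2 * real N) \<le> 1 * real N powr \<delta> + 2 powr \<delta> / \<delta> * real N powr \<delta>"
      using N \<delta> by (simp add: ge_one_powr_ge_zero add_mono)
    also have "\<dots> = c * real N powr \<delta>" by (simp add: c_def algebra_simps)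
    finally have "(1 + ln (2 * real N)) ^ k \<le> (c * real N powr \<delta>) ^ k"
      using N by (intro power_mono) auto
    also have "\<dots> = c ^ k * real N powr \<epsilon>"
      using N False by (simp add: power_mult_distrib powr_power \<delta>_def)
    finally show "(1 + ln (2 * real N)) ^ k \<le> c ^ k * real N powr \<epsilon>" .
  qed (use c in simp)
qed

lemma harm_le_log:
  assumes "n \<le> 2 * N" "1 \<le> N"
  shows "harm n \<le> 1 + ln (2 * real N)"
proof -
  have "harm (2 * N) \<le> ln (real (2 * N)) + (1 :: real)"
    using euler_mascheroni_sequence_decreasing[of 1 "2 * N"] assms by (simp add: harm_def)
  then show ?thesis using harm_mono_le[OF assms(1)] by simp
qed

lemma floor_nat_bounds:
  fixes y :: real
  assumes "1 \<le> y"
  shows "1 \<le> nat \<lfloor>y\<rfloor>" "real (nat \<lfloor>y\<rfloor>) \<le> y" "y \<le> 2 * real (nat \<lfloor>y\<rfloor>)" "y < real (nat \<lfloor>y\<rfloor>) + 1"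
proof -
  have "1 \<le> \<lfloor>y\<rfloor>" using assms by simp
  then have "real (nat \<lfloor>y\<rfloor>) = of_int \<lfloor>y\<rfloor>" "(1::real) \<le> of_int \<lfloor>y\<rfloor>" "1 \<le> nat \<lfloor>y\<rfloor>" by linarith+
  then show "1 \<le> nat \<lfloor>y\<rfloor>" "real (nat \<lfloor>y\<rfloor>) \<le> y" "y \<le> 2 * real (nat \<lfloor>y\<rfloor>)" "y < real (nat \<lfloor>y\<rfloor>) + 1"
    by linarith+
qed

lemma sum_divisors_phase:
  "(\<Sum>n\<in>{N<..N1}. of_real (\<Sum>l | l dvd n. f l (n div l)) * phase \<gamma> h \<alpha> n)
    = (\<Sum>l\<in>{1..N1}. \<Sum>m\<in>{N div l<..N1 div l}. of_real (f l m) * phase \<gamma> h \<alpha> (l * m))"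
proof -
  have "(\<Sum>n\<in>{N<..N1}. of_real (\<Sum>l | l dvd n. f l (n div l)) * phase \<gamma> h \<alpha> n)
     = (\<Sum>n\<in>{N<..N1}. \<Sum>l | l dvd n. of_real (f l (n div l)) * phase \<gamma> h \<alpha> (l * (n div l)))"
    by (intro sum.cong refl) (auto simp: sum_distrib_right intro!: sum.cong)
  then show ?thesis by (simp only: sum_divisors_interval[of "\<lambda>l m. of_real (f l m) * phase \<gamma> h \<alpha> (l * m)"])
qed

text \<open>Vanishing beyond both \<open>L1\<close> and \<open>N1\<close> lets the upper end be
  exchanged without knowing which of the two is larger.\<close>

lemma sum_truncate:
  fixes T :: "nat \<Rightarrow> complex"
  assumes "Z \<le> L1" and "\<And>l. L1 < l \<Longrightarrow> T l = 0" and "\<And>l. N1 < l \<Longrightarrow> T l = 0"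
  shows "(\<Sum>l\<in>{1..N1}. T l) = (\<Sum>l\<in>{1..Z}. T l) + (\<Sum>l\<in>{Suc Z..L1}. T l)"
proof -
  have "(\<Sum>l\<in>{1..N1}. T l) = (\<Sum>l\<in>{1..max N1 L1}. T l)"
    by (intro sum.mono_neutral_left) (auto intro: assms)
  also have "\<dots> = (\<Sum>l\<in>{1..L1}. T l)"
    by (intro sum.mono_neutral_right) (auto intro: assms)
  also have "{1..L1} = {1..Z} \<union> {Suc Z..L1}" using assms(1) by auto
  also have "(\<Sum>l\<in>\<dots>. T l) = (\<Sum>l\<in>{1..Z}. T l) + (\<Sum>l\<in>{Suc Z..L1}. T l)"
    by (intro sum.union_disjoint) auto
  finally show ?thesis .
qed

text \<open>The parameters balance exactly: with \<open>K = N\<^sup>2\<^sup>s\<close>, \<open>X = h N\<^sup>\<gamma> \<le> 2 N\<^sup>1\<^sup>+\<^sup>\<gamma>\<^sup>-\<^sup>E\<close> and \<open>L1 = N\<^sup>2\<^sup>/\<^sup>3\<close> the first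
  two terms of the type II estimate are both of order \<open>N\<^sup>-\<^sup>2\<^sup>s\<close>.\<close>

theorem mangoldt_phase_sum:
  fixes \<gamma> \<epsilon> :: real
  defines "E \<equiv> 17 / 39 + 7 * \<gamma> / 13" and "s \<equiv> (5 - 3 * \<gamma>) / 39"
  assumes \<gamma>: "17 / 18 < \<gamma>" "\<gamma> < 1" and \<epsilon>: "0 < \<epsilon>"
  shows "\<exists>C>0. \<forall>N N1 h \<alpha>. 1 \<le> N \<longrightarrow> N \<le> N1 \<longrightarrow> N1 \<le> 2 * N \<longrightarrow> 1 \<le> h \<longrightarrow> h \<le> 2 * real N powr (1 - E) \<longrightarrow>
    norm (\<Sum>n\<in>{N<..N1}. of_real (mangoldt n) * phase \<gamma> h \<alpha> n) \<le> C * real N powr (1 - s + \<epsilon>)"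
proof -
  have \<gamma>01: "0 < \<gamma>" "\<gamma> < 1" using \<gamma> by auto
  obtain C where C: "vdc_const \<gamma> C" using van_der_corput_powr[OF \<gamma>01] unfolding vdc_const_def by blast
  have C0: "C > 0" using C by (simp add: vdc_const_def)
  obtain D where D0: "D > 0" and DD: "\<forall>h \<alpha> N N1 K L0 L1 G F u v. 0 < h \<longrightarrow> 1 \<le> K \<longrightarrow> K \<le> L0 \<longrightarrow> 1 \<le> N \<longrightarrow> N1 \<le> 2 * N \<longrightarrow>
    0 \<le> G \<longrightarrow> 0 \<le> F \<longrightarrow> (\<forall>l\<in>{L0..L1}. norm (u l) \<le> G) \<longrightarrow>
    (\<forall>Y. Y \<le> N1 \<longrightarrow> (\<Sum>m\<in>{1..Y}. (norm (v m))\<^sup>2) \<le> F\<^sup>2 * real Y) \<longrightarrow>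
    norm (\<Sum>l\<in>{L0..L1}. \<Sum>m\<in>{N div l<..N1 div l}. u l * v m * phase \<gamma> h \<alpha> (l * m))
      \<le> D * F * G * real N * harm L1 * sqrt (1 / real K
          + sqrt (h * real N powr \<gamma> * real K * real L1) / real N + sqrt (real L1 / (h * real N powr \<gamma>)))"
    using type_II_sum[OF \<gamma>01] by (elim exE conjE)
  note D = DD[rule_format]
  obtain B where B0: "B > 0" and B: "\<And>N::nat. 1 \<le> N \<Longrightarrow> (1 + ln (2 * real N)) ^ 4 \<le> B * real N powr \<epsilon>"
    using log_power_bound[OF \<epsilon>, of 4] by blast
  \<comment> \<open>The second bound gives K \<le> Z, so that no type II block starts below
    \<open>K\<close>; the third puts N / sqrt(X) below N^(1-s).\<close>
  have s: "0 < s" "2 * s \<le> 1 / 3" "s \<le> \<gamma> / 2" using \<gamma> by (auto simp: s_def field_simps)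
  show ?thesis
  proof (intro exI[of _ "(12 * C + 6 * D) * B"] conjI allI impI)
    fix N N1 :: nat and h \<alpha> :: real
    assume N: "1 \<le> N" "N \<le> N1" "N1 \<le> 2 * N" and h: "1 \<le> h" "h \<le> 2 * real N powr (1 - E)"
    define X where "X = h * real N powr \<gamma>"
    define Lg where "Lg = 1 + ln (2 * real N)"
    define Z where "Z = nat \<lfloor>real N powr (1 / 3)\<rfloor>"
    define K where "K = nat \<lfloor>real N powr (2 * s)\<rfloor>"
    \<comment> \<open>The factor 2 is chosen so that l > L1 together with m > Z would force l m >
      2N.\<close>
    define L1 where "L1 = nat \<lfloor>2 * real N powr (2 / 3)\<rfloor>"
    define P where "P = real N powr (1 - s)"
    have h0: "h > 0" using h by simp
    have N0: "real N \<ge> 1" "real N > 0" using N by auto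
    have one: "1 \<le> real N powr a" if "0 \<le> a" for a using N0 that by (intro ge_one_powr_ge_zero) auto
    have mono: "real N powr a \<le> real N powr b" if "a \<le> b" for a b using N0 that by (intro powr_mono) auto
    have Lg: "Lg \<ge> 1" using N0 by (simp add: Lg_def)
    have P0: "P > 0" using N0 by (simp add: P_def)
    note Z = floor_nat_bounds[OF one, of "1 / 3", folded Z_def]
    have Z1: "1 \<le> Z" "real Z \<le> real N powr (1 / 3)" "real N powr (1 / 3) < real Z + 1" using Z by auto
    have K: "1 \<le> K" "real K \<le> real N powr (2 * s)" "real N powr (2 * s) \<le> 2 * real K"
      using floor_nat_bounds[OF one, of "2 * s", folded K_def] s by auto
    have KZ: "K \<le> Z" unfolding K_def Z_def by (intro nat_mono floor_mono mono s)
    have "1 \<le> 2 * real N powr (2 / 3)" using one[of "2 / 3"] by simp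
    note L1 = floor_nat_bounds[OF this, folded L1_def]
    have "real Z \<le> real N powr 1" using Z1(2) mono[of "1 / 3" 1] by linarith
    then have ZN: "Z \<le> N" using N0 by simp
    have "2 * real N powr (2 / 3) \<le> 2 * real N powr 1" by (intro mult_left_mono mono) auto
    then have L1N: "L1 \<le> 2 * N" using L1(2) N0 by simp
    have "real N powr (1 / 3) \<le> 2 * real N powr (2 / 3)" using mono[of "1 / 3" "2 / 3"] one[of "2 / 3"] by linarith
    then have ZL: "Z \<le> L1" unfolding Z_def L1_def by (intro nat_mono floor_mono)
    have "Z\<^sup>2 \<le> L1"
    proof -
      have "(real Z)\<^sup>2 \<le> (real N powr (1 / 3))\<^sup>2" using Z1(2) by (intro power_mono) auto
      also have "\<dots> = real N powr (2 / 3)" using N0 by (simp add: powr_power)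
      finally have "real (Z\<^sup>2) \<le> real N powr (2 / 3)" by simp
      then have "real (Z\<^sup>2) < real L1 + 1" using L1(4) one[of "2 / 3"] by linarith
      then show ?thesis by linarith
    qed
    have X: "real N powr \<gamma> \<le> X" "X \<le> 2 * real N powr (\<gamma> + 1 - E)"
    proof -
      show "real N powr \<gamma> \<le> X" using mult_right_mono[OF h(1), of "real N powr \<gamma>"] by (simp add: X_def)
      have "X \<le> 2 * real N powr (1 - E) * real N powr \<gamma>"
        unfolding X_def by (intro mult_right_mono h) auto
      also have "\<dots> = 2 * real N powr (\<gamma> + 1 - E)" by (simp flip: powr_add add: algebra_simps)
      finally show "X \<le> 2 * real N powr (\<gamma> + 1 - E)" .
    qed
    have X0: "X > 0" using X(1) N0 by (smt (verit) powr_gt_zero)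
    have harmL: "harm n \<le> Lg" if "n \<le> 2 * N" for n
      using harm_le_log[OF that] N by (simp add: Lg_def)
    have lnL: "ln (real l) \<le> Lg" if "l \<le> 2 * N" "1 \<le> l" for l
    proof -
      have "real l \<le> real (2 * N)" using that(1) by (rule of_nat_mono)
      then have "ln (real l) \<le> ln (real (2 * N))" using that N by (subst ln_le_cancel_iff) auto
      then show ?thesis by (simp add: Lg_def)
    qed
    have sqrt_powr: "sqrt (real N powr a) = real N powr (a / 2)" for a
      using N0 by (simp add: powr_half_sqrt[symmetric] powr_powr)

    have bracket: "sqrt (1 / real K + sqrt (h * real N powr \<gamma> * real K * real L1) / real N
        + sqrt (real L1 / (h * real N powr \<gamma>))) \<le> 3 * real N powr (- s)"
    proof -
      have "1 / real K \<le> 2 * real N powr (- (2 * s))"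
        using K N0 by (simp add: powr_minus field_simps)
      moreover have "sqrt (X * real K * real L1) / real N \<le> 2 * real N powr (- (2 * s))"
      proof -
        have "X * real K * real L1 \<le> 2 * real N powr (\<gamma> + 1 - E) * real N powr (2 * s) * (2 * real N powr (2 / 3))"
          using X X0 K L1 by (intro mult_mono) auto
        also have "\<dots> = 4 * real N powr (\<gamma> + 1 - E + 2 * s + 2 / 3)"
          unfolding powr_add[of "real N" "\<gamma> + 1 - E + 2 * s"] powr_add[of "real N" "\<gamma> + 1 - E"] by simp
        \<comment> \<open>This identity is one of the two equations that determine E and s.\<close>
        also have "\<gamma> + 1 - E + 2 * s + 2 / 3 = 2 - 4 * s" by (simp add: E_def s_def field_simps)
        finally have "sqrt (X * real K * real L1) \<le> sqrt (4 * real N powr (2 - 4 * s))"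
          by (rule real_sqrt_le_mono)
        also have "\<dots> = 2 * real N powr ((2 - 4 * s) / 2)" by (simp add: real_sqrt_mult sqrt_powr)
        also have "(2 - 4 * s) / 2 = 1 + - (2 * s)" by simp
        finally have "sqrt (X * real K * real L1) \<le> 2 * (real N * real N powr (- (2 * s)))"
          using N0 by (simp only: powr_add powr_one)
        then show ?thesis using N0 by (simp add: field_simps)
      qed
      moreover have "sqrt (real L1 / X) \<le> 2 * real N powr (- (2 * s))"
      proof -
        have "real L1 / X \<le> 2 * real N powr (2 / 3) / real N powr \<gamma>"
          using L1 X X0 N0 by (intro frac_le) auto
        also have "\<dots> = 2 * real N powr (2 / 3 - \<gamma>)" by (simp add: powr_diff)
        \<comment> \<open>The exponent inequality 2/3 - \<gamma> \<le> -4s amounts to \<gamma> \<ge>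
          46/51, which lies below 17/18.\<close>
        also have "\<dots> \<le> 4 * real N powr (- 4 * s)"
          using \<gamma> by (intro mult_mono mono) (auto simp: s_def field_simps)
        finally have "sqrt (real L1 / X) \<le> sqrt (4 * real N powr (- 4 * s))" by (rule real_sqrt_le_mono)
        then show ?thesis by (simp add: real_sqrt_mult sqrt_powr)
      qed
      ultimately have "1 / real K + sqrt (X * real K * real L1) / real N + sqrt (real L1 / X)
          \<le> 6 * real N powr (- (2 * s))" by linarith
      also have "\<dots> \<le> 9 * real N powr (- (2 * s))" by simp
      finally have "sqrt (1 / real K + sqrt (X * real K * real L1) / real N + sqrt (real L1 / X))
          \<le> sqrt (9 * real N powr (- (2 * s)))" by (rule real_sqrt_le_mono)
      also have "\<dots> = 3 * real N powr (- s)"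
        using real_sqrt_abs[of 3] by (simp add: real_sqrt_mult sqrt_powr)
      finally show ?thesis by (simp add: X_def)
    qed
    \<comment> \<open>The four logarithms are two for the mean square bound \<open>F\<close>, one
      for the pointwise bound \<open>G\<close>, and one for the harmonic sum over the
      blocks.\<close>
    have type2: "norm (\<Sum>l\<in>{Suc Z..L1}. \<Sum>m\<in>{N div l<..N1 div l}. u l * v m * phase \<gamma> h \<alpha> (l * m))
        \<le> 3 * D * (P * Lg ^ 4)"
      if u: "\<forall>l\<in>{Suc Z..L1}. norm (u l) \<le> Lg"
        and v: "\<forall>Y. Y \<le> N1 \<longrightarrow> (\<Sum>m\<in>{1..Y}. (norm (v m))\<^sup>2) \<le> (Lg\<^sup>2)\<^sup>2 * real Y" for u v
    proof -
      have "norm (\<Sum>l\<in>{Suc Z..L1}. \<Sum>m\<in>{N div l<..N1 div l}. u l * v m * phase \<gamma> h \<alpha> (l * m))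
        \<le> D * Lg\<^sup>2 * Lg * real N * harm L1 * sqrt (1 / real K
          + sqrt (h * real N powr \<gamma> * real K * real L1) / real N + sqrt (real L1 / (h * real N powr \<gamma>)))"
        using h0 K KZ N Lg by (intro D u[rule_format] v[rule_format]) auto
      also have "\<dots> \<le> D * Lg\<^sup>2 * Lg * real N * Lg * (3 * real N powr (- s))"
        using D0 Lg N0 h0 harmL[OF L1N] bracket by (intro mult_mono) (auto simp: harm_nonneg)
      also have "\<dots> = 3 * D * (real N powr (1 + - s) * Lg ^ 4)"
        using N0 unfolding powr_add by (simp add: power2_eq_square power4_eq_xxxx)
      finally show ?thesis by (simp add: P_def)
    qed
    have type1: "(\<Sum>l\<in>{1..Z}. C * (sqrt X + real N / real l / sqrt X) * (2 * Lg)) \<le> 6 * C * (P * Lg ^ 4)"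
    proof -
      have "(\<Sum>l\<in>{1..Z}. C * (sqrt X + real N / real l / sqrt X) * (2 * Lg))
          = 2 * C * Lg * (real Z * sqrt X + real N / sqrt X * harm Z)"
        unfolding harm_alt by (simp add: sum_distrib_left sum.distrib algebra_simps)
      also have "\<dots> \<le> 2 * C * Lg * (2 * P + P * Lg)"
      proof -
        have "sqrt X \<le> sqrt (4 * real N powr (\<gamma> + 1 - E))"
          using X by (intro real_sqrt_le_mono) (smt (verit) powr_ge_zero)
        then have "sqrt X \<le> 2 * real N powr ((\<gamma> + 1 - E) / 2)" by (simp add: real_sqrt_mult sqrt_powr)
        then have "real Z * sqrt X \<le> real N powr (1 / 3) * (2 * real N powr ((\<gamma> + 1 - E) / 2))"
          using Z1 X0 by (intro mult_mono) auto
        also have "\<dots> = 2 * real N powr (1 / 3 + (\<gamma> + 1 - E) / 2)" by (simp add: powr_add)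
        also have "\<dots> \<le> 2 * P"
          unfolding P_def using \<gamma> by (intro mult_left_mono mono) (auto simp: E_def s_def field_simps)
        finally have 1: "real Z * sqrt X \<le> 2 * P" .
        have "sqrt (real N powr \<gamma>) \<le> sqrt X" using X(1) by (rule real_sqrt_le_mono)
        then have "real N / sqrt X \<le> real N powr 1 / real N powr (\<gamma> / 2)"
          using N0 X0 by (simp add: sqrt_powr) (intro divide_left_mono, auto)
        also have "\<dots> = real N powr (1 - \<gamma> / 2)" by (simp add: powr_diff)
        also have "\<dots> \<le> P" unfolding P_def using s by (intro mono) auto
        finally have 2: "real N / sqrt X \<le> P" .
        have "real N / sqrt X * harm Z \<le> P * Lg"
          using ZN P0 by (intro mult_mono 2 harmL) (auto simp: harm_nonneg)
        then show ?thesis using 1 C0 Lg by (intro mult_left_mono add_mono) auto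
      qed
      also have "\<dots> \<le> 2 * C * Lg * (2 * (P * Lg) + P * Lg)"
        using C0 Lg P0 by (intro mult_left_mono add_mono) auto
      also have "\<dots> = 6 * C * (P * Lg\<^sup>2)" by (simp add: power2_eq_square algebra_simps)
      also have "\<dots> \<le> 6 * C * (P * Lg ^ 4)"
        using C0 Lg P0 by (intro mult_left_mono power_increasing) auto
      finally show ?thesis .
    qed
    have R1: "0 \<le> C * (sqrt X + real N / real l / sqrt X)" for l :: nat
      using C0 X0 by (intro mult_nonneg_nonneg add_nonneg_nonneg) auto

    define T1 where "T1 l = (\<Sum>m\<in>{N div l<..N1 div l}.
      of_real ((if l \<le> Z then moeb l else 0) * ln (real m)) * phase \<gamma> h \<alpha> (l * m))" for l
    define T2 where "T2 l = (\<Sum>m\<in>{N div l<..N1 div l}. of_real (vaughan_w Z l) * phase \<gamma> h \<alpha> (l * m))" for l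
    define T3 where "T3 l = (\<Sum>m\<in>{N div l<..N1 div l}.
      of_real ((if Z < l then mangoldt l else 0) * vaughan_v Z m) * phase \<gamma> h \<alpha> (l * m))" for l
    have b1: "norm (\<Sum>l\<in>{1..N1}. T1 l) \<le> 6 * C * (P * Lg ^ 4)"
    proof -
      have "(\<Sum>l\<in>{1..N1}. T1 l) = (\<Sum>l\<in>{1..Z}. T1 l)"
        using ZN N by (intro sum.mono_neutral_right) (auto simp: T1_def)
      also have "norm \<dots> \<le> (\<Sum>l\<in>{1..Z}. C * (sqrt X + real N / real l / sqrt X) * (2 * Lg))"
      proof (rule sum_norm_le)
        fix l assume l: "l \<in> {1..Z}"
        have "T1 l = of_real (moeb l) * (\<Sum>m\<in>{N div l<..N1 div l}. of_real (ln (real m)) * phase \<gamma> h \<alpha> (l * m))"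
          using l unfolding T1_def sum_distrib_left by (intro sum.cong) auto
        then have "norm (T1 l) = \<bar>moeb l\<bar> * norm (\<Sum>m\<in>{N div l<..N1 div l}. of_real (ln (real m)) * phase \<gamma> h \<alpha> (l * m))"
          by (simp add: norm_mult)
        also have "\<dots> \<le> 1 * (C * (sqrt X + real N / real l / sqrt X) * (2 * ln (2 * real N)))"
          using l ZN N by (intro mult_mono abs_moeb_le type_I_log[OF C h0 _ _ _ _ _ X_def]) auto
        also have "\<dots> \<le> C * (sqrt X + real N / real l / sqrt X) * (2 * Lg)"
          unfolding mult_1 by (intro mult_left_mono R1) (auto simp: Lg_def)
        finally show "norm (T1 l) \<le> C * (sqrt X + real N / real l / sqrt X) * (2 * Lg)" .
      qed
      finally show ?thesis using type1 by linarith
    qed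
    have b2: "norm (\<Sum>l\<in>{1..N1}. T2 l) \<le> (6 * C + 3 * D) * (P * Lg ^ 4)"
    proof -
      \<comment> \<open>The coefficient depends on l alone, so l \<le> Z is a type I sum. Beyond
        \<open>Z\<close> this would be too expensive, and the same sum is treated as type II with v
        = 1.\<close>
      have "(\<Sum>l\<in>{1..N1}. T2 l) = (\<Sum>l\<in>{1..Z}. T2 l) + (\<Sum>l\<in>{Suc Z..L1}. T2 l)"
        using \<open>Z\<^sup>2 \<le> L1\<close> by (intro sum_truncate ZL) (auto simp: T2_def vaughan_w_eq_0)
      moreover have "norm (\<Sum>l\<in>{1..Z}. T2 l) \<le> (\<Sum>l\<in>{1..Z}. C * (sqrt X + real N / real l / sqrt X) * (2 * Lg))"
      proof (rule sum_norm_le)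
        fix l assume l: "l \<in> {1..Z}"
        have "T2 l = of_real (vaughan_w Z l) * (\<Sum>m\<in>{N div l<..N1 div l}. phase \<gamma> h \<alpha> (l * m))"
          unfolding T2_def sum_distrib_left ..
        then have "norm (T2 l) = \<bar>vaughan_w Z l\<bar> * norm (\<Sum>m\<in>{N div l<..N1 div l}. phase \<gamma> h \<alpha> (l * m))"
          by (simp add: norm_mult)
        also have "\<dots> \<le> (2 * Lg) * (C * (sqrt X + real N / real l / sqrt X))"
        proof (intro mult_mono)
          have "\<bar>vaughan_w Z l\<bar> \<le> Lg"
            using abs_vaughan_w_le[of l Z] lnL[of l] l ZN by auto
          then show "\<bar>vaughan_w Z l\<bar> \<le> 2 * Lg" using Lg by linarith
          show "norm (\<Sum>m\<in>{N div l<..N1 div l}. phase \<gamma> h \<alpha> (l * m)) \<le> C * (sqrt X + real N / real l / sqrt X)"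
            using l N by (intro type_I_inner[OF C h0 _ _ _ X_def]) auto
        qed (use Lg in auto)
        finally show "norm (T2 l) \<le> C * (sqrt X + real N / real l / sqrt X) * (2 * Lg)"
          by (simp only: mult.commute)
      qed
      moreover have "norm (\<Sum>l\<in>{Suc Z..L1}. T2 l) \<le> 3 * D * (P * Lg ^ 4)"
      proof -
        have "(\<Sum>l\<in>{Suc Z..L1}. T2 l) = (\<Sum>l\<in>{Suc Z..L1}. \<Sum>m\<in>{N div l<..N1 div l}.
            of_real (vaughan_w Z l) * (\<lambda>_. 1) m * phase \<gamma> h \<alpha> (l * m))"
          by (simp add: T2_def)
        also have "norm \<dots> \<le> 3 * D * (P * Lg ^ 4)"
        proof (rule type2)
          show "\<forall>l\<in>{Suc Z..L1}. norm (complex_of_real (vaughan_w Z l)) \<le> Lg"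
          proof
            fix l assume "l \<in> {Suc Z..L1}"
            then show "norm (complex_of_real (vaughan_w Z l)) \<le> Lg"
              using abs_vaughan_w_le[of l Z] lnL[of l] L1N by simp
          qed
          have "1 \<le> (Lg\<^sup>2)\<^sup>2" using Lg by (simp add: one_le_power)
          then show "\<forall>Y\<le>N1. (\<Sum>m\<in>{1..Y}. (norm (1::complex))\<^sup>2) \<le> (Lg\<^sup>2)\<^sup>2 * real Y"
            using mult_right_mono[of 1 "(Lg\<^sup>2)\<^sup>2" "real Y" for Y] by simp
        qed
        finally show ?thesis .
      qed
      ultimately show ?thesis using type1
          norm_triangle_ineq[of "\<Sum>l\<in>{1..Z}. T2 l" "\<Sum>l\<in>{Suc Z..L1}. T2 l"]
        unfolding distrib_right by (smt (verit))
    qed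
    have b3: "norm (\<Sum>l\<in>{1..N1}. T3 l) \<le> 3 * D * (P * Lg ^ 4)"
    proof -
      have "(\<Sum>l\<in>{1..N1}. T3 l) = (\<Sum>l\<in>{1..Z}. T3 l) + (\<Sum>l\<in>{Suc Z..L1}. T3 l)"
      proof (rule sum_truncate[OF ZL])
        fix l assume l: "L1 < l"
        show "T3 l = 0" unfolding T3_def
        proof (rule sum.neutral, rule ballI)
          fix m assume m: "m \<in> {N div l<..N1 div l}"
          have "m * l \<le> N1" using m l by (auto simp: less_eq_div_iff_mult_less_eq)
          then have "real (m * l) \<le> real (2 * N)" using N by (intro of_nat_mono) simp
          \<comment> \<open>Terms with l > L1 have a cofactor at most \<open>Z\<close>, where
            \<open>vaughan_v\<close> vanishes; this bounds the type II range from above.\<close>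
          have "m \<le> Z"
          proof (rule ccontr)
            assume "\<not> m \<le> Z"
            then have m3: "real N powr (1 / 3) < real m" using Z1(3) by linarith
            then have "0 < real m" by (rule le_less_trans[rotated]) simp
            note m3
            moreover have "2 * real N powr (2 / 3) < real l" using L1(4) l by linarith
            ultimately have "real N powr (1 / 3) * (2 * real N powr (2 / 3)) < real m * real l"
              using N0 by (intro mult_strict_mono) (use \<open>0 < real m\<close> in auto)
            moreover have "real N powr (1 / 3) * (2 * real N powr (2 / 3)) = 2 * real N powr (1 / 3 + 2 / 3)"
              unfolding powr_add by simp
            ultimately show False using \<open>real (m * l) \<le> real (2 * N)\<close> N0 by simp
          qed
          then show "of_real ((if Z < l then mangoldt l else 0) * vaughan_v Z m) * phase \<gamma> h \<alpha> (l * m) = 0"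
            using m by (simp add: vaughan_v_eq_0)
        qed
      qed (simp add: T3_def)
      also have "(\<Sum>l\<in>{1..Z}. T3 l) = 0" by (intro sum.neutral) (auto simp: T3_def)
      also have "(\<Sum>l\<in>{Suc Z..L1}. T3 l) = (\<Sum>l\<in>{Suc Z..L1}. \<Sum>m\<in>{N div l<..N1 div l}.
            of_real (mangoldt l) * of_real (vaughan_v Z m) * phase \<gamma> h \<alpha> (l * m))"
        unfolding T3_def by (intro sum.cong refl) auto
      finally have eq: "(\<Sum>l\<in>{1..N1}. T3 l) = (\<Sum>l\<in>{Suc Z..L1}. \<Sum>m\<in>{N div l<..N1 div l}.
            of_real (mangoldt l) * of_real (vaughan_v Z m) * phase \<gamma> h \<alpha> (l * m))" by simp
      show ?thesis unfolding eq
      proof (rule type2)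
        show "\<forall>l\<in>{Suc Z..L1}. norm (complex_of_real (mangoldt l)) \<le> Lg"
        proof
          fix l assume "l \<in> {Suc Z..L1}"
          then have "mangoldt l \<le> Lg" using mangoldt_le_ln[of l] lnL[of l] L1N by simp
          then show "norm (complex_of_real (mangoldt l)) \<le> Lg"
            unfolding norm_of_real by (simp add: mangoldt_nonneg)
        qed
        show "\<forall>Y\<le>N1. (\<Sum>m\<in>{1..Y}. (norm (complex_of_real (vaughan_v Z m)))\<^sup>2) \<le> (Lg\<^sup>2)\<^sup>2 * real Y"
        proof (intro allI impI)
          fix Y assume Y: "Y \<le> N1"
          have "(\<Sum>m\<in>{1..Y}. (norm (complex_of_real (vaughan_v Z m)))\<^sup>2) \<le> (\<Sum>m\<in>{1..Y}. (real (num_divisors m))\<^sup>2)"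
            unfolding norm_of_real num_divisors_def
            by (intro sum_mono power_mono abs_vaughan_v_le) auto
          also have "\<dots> \<le> real Y * harm Y ^ 3" by (rule sum_num_divisors_square_le)
          also have "\<dots> \<le> real Y * Lg ^ 4"
          proof (rule mult_left_mono)
            have "harm Y ^ 3 \<le> Lg ^ 3" using harmL[of Y] Y N by (intro power_mono) (auto simp: harm_nonneg)
            also have "\<dots> \<le> Lg ^ 4" using Lg by (intro power_increasing) auto
            finally show "harm Y ^ 3 \<le> Lg ^ 4" .
          qed simp
          finally show "(\<Sum>m\<in>{1..Y}. (norm (complex_of_real (vaughan_v Z m)))\<^sup>2) \<le> (Lg\<^sup>2)\<^sup>2 * real Y"
            by (simp add: mult.commute flip: power_mult)
        qed
      qed
    qed
    have "(\<Sum>n\<in>{N<..N1}. of_real (mangoldt n) * phase \<gamma> h \<alpha> n)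
        = (\<Sum>l\<in>{1..N1}. T1 l) - (\<Sum>l\<in>{1..N1}. T2 l) + (\<Sum>l\<in>{1..N1}. T3 l)"
    proof -
      have "(\<Sum>n\<in>{N<..N1}. of_real (mangoldt n) * phase \<gamma> h \<alpha> n) = (\<Sum>n\<in>{N<..N1}.
          of_real (\<Sum>l | l dvd n. (\<lambda>l m. (if l \<le> Z then moeb l else 0) * ln (real m)) l (n div l)) * phase \<gamma> h \<alpha> n
          - of_real (\<Sum>l | l dvd n. (\<lambda>l m. vaughan_w Z l) l (n div l)) * phase \<gamma> h \<alpha> n
          + of_real (\<Sum>l | l dvd n. (\<lambda>l m. (if Z < l then mangoldt l else 0) * vaughan_v Z m) l (n div l)) * phase \<gamma> h \<alpha> n)"
      proof (rule sum.cong[OF refl])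
        fix n assume "n \<in> {N<..N1}"
        then have "n > Z" using ZN by simp
        show "of_real (mangoldt n) * phase \<gamma> h \<alpha> n =
          of_real (\<Sum>l | l dvd n. (\<lambda>l m. (if l \<le> Z then moeb l else 0) * ln (real m)) l (n div l)) * phase \<gamma> h \<alpha> n
          - of_real (\<Sum>l | l dvd n. (\<lambda>l m. vaughan_w Z l) l (n div l)) * phase \<gamma> h \<alpha> n
          + of_real (\<Sum>l | l dvd n. (\<lambda>l m. (if Z < l then mangoldt l else 0) * vaughan_v Z m) l (n div l)) * phase \<gamma> h \<alpha> n"
          unfolding left_diff_distrib[symmetric] distrib_right[symmetric] of_real_diff[symmetric] of_real_add[symmetric]
          by (subst vaughan_identity[OF \<open>n > Z\<close> Z1(1)]) simp
      qed
      moreover have "(\<Sum>n\<in>{N<..N1}. of_real (\<Sum>l | l dvd n. (\<lambda>l m. (if l \<le> Z then moeb l else 0) * ln (real m)) l (n div l)) * phase \<gamma> h \<alpha> n)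
          = (\<Sum>l\<in>{1..N1}. T1 l)"
        unfolding T1_def by (rule sum_divisors_phase)
      moreover have "(\<Sum>n\<in>{N<..N1}. of_real (\<Sum>l | l dvd n. (\<lambda>l m. vaughan_w Z l) l (n div l)) * phase \<gamma> h \<alpha> n)
          = (\<Sum>l\<in>{1..N1}. T2 l)"
        unfolding T2_def by (rule sum_divisors_phase)
      moreover have "(\<Sum>n\<in>{N<..N1}. of_real (\<Sum>l | l dvd n. (\<lambda>l m. (if Z < l then mangoldt l else 0) * vaughan_v Z m) l (n div l)) * phase \<gamma> h \<alpha> n)
          = (\<Sum>l\<in>{1..N1}. T3 l)"
        unfolding T3_def by (rule sum_divisors_phase)
      ultimately show ?thesis unfolding sum.distrib sum_subtractf by (simp only:)
    qed
    then have "norm (\<Sum>n\<in>{N<..N1}. of_real (mangoldt n) * phase \<gamma> h \<alpha> n)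
        \<le> norm (\<Sum>l\<in>{1..N1}. T1 l) + norm (\<Sum>l\<in>{1..N1}. T2 l) + norm (\<Sum>l\<in>{1..N1}. T3 l)"
      by (smt (verit) norm_triangle_ineq norm_triangle_ineq4)
    also have "\<dots> \<le> (12 * C + 6 * D) * (P * Lg ^ 4)"
      using b1 b2 b3 by (simp only: distrib_right)
    also have "\<dots> \<le> (12 * C + 6 * D) * (P * (B * real N powr \<epsilon>))"
      using B[OF N(1)] C0 D0 P0 unfolding Lg_def by (intro mult_left_mono) auto
    also have "\<dots> = (12 * C + 6 * D) * B * real N powr (1 - s + \<epsilon>)"
      by (simp add: P_def powr_add)
    finally show "norm (\<Sum>n\<in>{N<..N1}. of_real (mangoldt n) * phase \<gamma> h \<alpha> n)
      \<le> (12 * C + 6 * D) * B * real N powr (1 - s + \<epsilon>)" .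
  qed (use C0 D0 B0 in \<open>auto intro!: mult_pos_pos add_pos_pos\<close>)
qed

section \<open>From von Mangoldt weights to primes in residue classes\<close>

lemma sum_additive_characters:
  fixes D :: nat and t :: int
  assumes "0 < D"
  shows "(\<Sum>j<D. ee (real j * (of_int t / real D))) = (if int D dvd t then of_nat D else 0)"
proof -
  let ?z = "ee (of_int t / real D)"
  have eq: "(\<Sum>j<D. ee (real j * (of_int t / real D))) = (\<Sum>j<D. ?z ^ j)"
    by (simp only: ee_power)
  show ?thesis
  proof (cases "int D dvd t")
    case True
    then obtain k where "t = int D * k" by blast
    then have "?z = 1" using assms by simp
    then show ?thesis using True unfolding eq by simp
  next
    case False
    have "sin (pi * (of_int t / real D)) \<noteq> 0"
    proof
      assume "sin (pi * (of_int t / real D)) = 0"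
      then obtain i :: int where "pi * (of_int t / real D) = of_int i * pi"
        by (auto simp: sin_zero_iff_int2)
      then have "of_int t = real D * of_int i" using assms by (simp add: field_simps)
      then have "t = int D * i" by (metis of_int_eq_iff of_int_mult of_int_of_nat_eq)
      then show False using False by simp
    qed
    then have "?z \<noteq> 1" by (rule inverse_one_minus_ee(2))
    moreover have "?z ^ D = 1" using assms by (simp add: ee_power)
    ultimately show ?thesis using False unfolding eq by (simp add: geometric_sum)
  qed
qed

text \<open>The indicator of a residue class is an average of linear phases of modulus 1, so a bound
  valid for all linear twists passes to the class without any loss in the modulus.\<close>

lemma residue_class_sum_bound:
  fixes g :: "nat \<Rightarrow> complex" and a d :: int
  assumes "finite S" "1 \<le> d"
    and B: "\<And>\<beta>. norm (\<Sum>n\<in>S. g n * ee (\<beta> * real n)) \<le> B"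
  shows "norm (\<Sum>n\<in>S. (if [int n = a] (mod d) then g n else 0)) \<le> B"
proof -
  define D where "D = nat d"
  have D: "0 < D" "int D = d" using assms by (auto simp: D_def)
  have "of_nat D * (\<Sum>n\<in>S. (if [int n = a] (mod d) then g n else 0))
      = (\<Sum>n\<in>S. \<Sum>j<D. g n * ee (real j * (of_int (int n - a) / real D)))"
    unfolding sum_distrib_left
  proof (rule sum.cong[OF refl])
    fix n
    show "of_nat D * (if [int n = a] (mod d) then g n else 0)
      = (\<Sum>j<D. g n * ee (real j * (of_int (int n - a) / real D)))"
      unfolding sum_distrib_left[symmetric] sum_additive_characters[OF D(1)] D(2)
      by (simp add: cong_iff_dvd_diff)
  qed
  also have "\<dots> = (\<Sum>j<D. \<Sum>n\<in>S. g n * ee (real j * (of_int (int n - a) / real D)))"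
    by (rule sum.swap)
  also have "norm \<dots> \<le> (\<Sum>j<D. B)"
  proof (rule sum_norm_le)
    fix j
    have "g n * ee (real j * (of_int (int n - a) / real D))
        = ee (- (real j * of_int a / real D)) * (g n * ee (real j / real D * real n))" for n
    proof -
      have "real j * (of_int (int n - a) / real D) = - (real j * of_int a / real D) + real j / real D * real n"
        by (simp add: algebra_simps diff_divide_distrib)
      then show ?thesis by (simp only: ee_add mult_ac)
    qed
    then have "norm (\<Sum>n\<in>S. g n * ee (real j * (of_int (int n - a) / real D)))
      = norm (\<Sum>n\<in>S. g n * ee (real j / real D * real n))"
      by (simp only: sum_distrib_left[symmetric] norm_mult norm_ee mult_1)
    then show "norm (\<Sum>n\<in>S. g n * ee (real j * (of_int (int n - a) / real D))) \<le> B"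
      using B[of "real j / real D"] by (simp only:)
  qed
  finally have "real D * norm (\<Sum>n\<in>S. (if [int n = a] (mod d) then g n else 0)) \<le> real D * B"
    by (simp add: norm_mult)
  then show ?thesis using D by simp
qed

text \<open>A power p^k with k \<ge> 2 up to 2N has p at most sqrt(2N) and k at most logarithmic. Up
  to logarithms these n contribute N^(1/2), less than N^(1-s).\<close>

lemma card_proper_prime_powers:
  fixes N :: nat
  assumes N: "1 \<le> N"
  shows "real (card {n. n \<le> 2 * N \<and> primepow n \<and> \<not> prime n}) \<le> 4 * sqrt (real N) * (1 + ln (2 * real N))"
proof -
  define A where "A = nat \<lfloor>sqrt (2 * real N)\<rfloor>"
  define M where "M = nat \<lfloor>2 * ln (2 * real N)\<rfloor>"
  have "{n. n \<le> 2 * N \<and> primepow n \<and> \<not> prime n} \<subseteq> (\<lambda>(p, k). p ^ k) ` ({1..A} \<times> {1..M})"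
  proof
    fix n assume "n \<in> {n. n \<le> 2 * N \<and> primepow n \<and> \<not> prime n}"
    then have n: "n \<le> 2 * N" "primepow n" "\<not> prime n" by auto
    then obtain p k where pk: "prime p" "k > 0" "n = p ^ k" by (auto simp: primepow_def)
    have "k \<noteq> 1" using pk n by auto
    then have k: "k \<ge> 2" using pk by simp
    have p: "p \<ge> 2" using pk by (simp add: prime_ge_2_nat)
    have "p ^ 2 \<le> p ^ k" using k p by (intro power_increasing) auto
    then have "real (p ^ 2) \<le> real (2 * N)" using pk n by (intro of_nat_mono) simp
    then have "real p \<le> sqrt (2 * real N)" by (intro real_le_rsqrt) simp
    then have "p \<le> A" unfolding A_def by (simp add: le_nat_iff le_floor_iff)
    have "2 ^ k \<le> p ^ k" using p by (intro power_mono) auto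
    then have "2 ^ k \<le> 2 * N" using pk(3) n(1) by simp
    then have "real (2 ^ k) \<le> real (2 * N)" by (rule of_nat_mono)
    then have "ln (2 ^ k) \<le> ln (2 * real N)" by (subst ln_le_cancel_iff) (use N in auto)
    then have "real k * ln 2 \<le> ln (2 * real N)" by (simp add: ln_realpow)
    moreover have "real k * (1 / 2) \<le> real k * ln 2"
      using ln2_ge_two_thirds by (intro mult_left_mono) auto
    ultimately have "real k \<le> 2 * ln (2 * real N)" by linarith
    then have "k \<le> M" unfolding M_def by (simp add: le_nat_iff le_floor_iff)
    then show "n \<in> (\<lambda>(p, k). p ^ k) ` ({1..A} \<times> {1..M})"
      using pk p \<open>p \<le> A\<close> by (intro image_eqI[of _ _ "(p, k)"]) auto
  qed
  then have "card {n. n \<le> 2 * N \<and> primepow n \<and> \<not> prime n} \<le> card ({1..A} \<times> {1..M})"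
    by (intro surj_card_le) auto
  also have "\<dots> = A * M" by simp
  finally have "real (card {n. n \<le> 2 * N \<and> primepow n \<and> \<not> prime n}) \<le> real (A * M)" by (rule of_nat_mono)
  also have "\<dots> \<le> sqrt (2 * real N) * (2 * ln (2 * real N))"
    unfolding of_nat_mult A_def M_def using N by (intro mult_mono) auto
  also have "\<dots> \<le> (2 * sqrt (real N)) * (2 * (1 + ln (2 * real N)))"
  proof (intro mult_mono)
    have "sqrt (2 * real N) \<le> sqrt (4 * real N)" by (intro real_sqrt_le_mono) auto
    then show "sqrt (2 * real N) \<le> 2 * sqrt (real N)" by (simp add: real_sqrt_mult)
  qed (use N in auto)
  finally show ?thesis by (simp add: algebra_simps)
qed

definition ap_prime :: "int \<Rightarrow> int \<Rightarrow> nat \<Rightarrow> bool" where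
  "ap_prime a d n \<longleftrightarrow> prime n \<and> [int n = a] (mod d)"

text \<open>After detecting the class and discarding proper prime powers, the weight ln n is removed
  by partial summation. Its reciprocal decreases, so end value and variation add up to 1 / ln(N+1),
  at most 2 even for N = 1.\<close>

theorem prime_phase_sum:
  fixes \<gamma> \<epsilon> :: real
  defines "E \<equiv> 17 / 39 + 7 * \<gamma> / 13" and "s \<equiv> (5 - 3 * \<gamma>) / 39"
  assumes \<gamma>: "17 / 18 < \<gamma>" "\<gamma> < 1" and \<epsilon>: "0 < \<epsilon>"
  shows "\<exists>C>0. \<forall>N N1 h (a::int) (d::int). 1 \<le> N \<longrightarrow> N \<le> N1 \<longrightarrow> N1 \<le> 2 * N \<longrightarrow> 1 \<le> h \<longrightarrow>
    h \<le> 2 * real N powr (1 - E) \<longrightarrow> 1 \<le> d \<longrightarrow>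
    norm (\<Sum>n\<in>{N<..N1}. (if ap_prime a d n then ee (h * real n powr \<gamma>) else 0))
      \<le> C * real N powr (1 - s + \<epsilon>)"
proof -
  obtain C where C0: "C > 0" and CC: "\<forall>N N1 h \<alpha>. 1 \<le> N \<longrightarrow> N \<le> N1 \<longrightarrow> N1 \<le> 2 * N \<longrightarrow> 1 \<le> h \<longrightarrow> h \<le> 2 * real N powr (1 - E) \<longrightarrow>
    norm (\<Sum>n\<in>{N<..N1}. of_real (mangoldt n) * phase \<gamma> h \<alpha> n) \<le> C * real N powr (1 - s + \<epsilon>)"
    using mangoldt_phase_sum[OF \<gamma> \<epsilon>] unfolding E_def s_def by (elim exE conjE)
  note C = CC[rule_format]
  obtain B where B0: "B > 0" and B: "\<And>N::nat. 1 \<le> N \<Longrightarrow> (1 + ln (2 * real N)) ^ 2 \<le> B * real N powr \<epsilon>"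
    using log_power_bound[OF \<epsilon>, of 2] by blast
  show ?thesis
  proof (intro exI[of _ "2 * (C + 4 * B)"] conjI allI impI)
    fix N N1 :: nat and h :: real and a d :: int
    assume N: "1 \<le> N" "N \<le> N1" "N1 \<le> 2 * N" and h: "1 \<le> h" "h \<le> 2 * real N powr (1 - E)" and d: "1 \<le> d"
    define \<phi> where "\<phi> n = ee (h * real n powr \<gamma>)" for n :: nat
    define Q where "Q = (C + 4 * B) * real N powr (1 - s + \<epsilon>)"
    have Q0: "Q \<ge> 0" using C0 B0 by (simp add: Q_def)
    define Lg where "Lg = 1 + ln (2 * real N)"
    have Lg: "Lg \<ge> 1" using N by (simp add: Lg_def)
    have ap: "norm (\<Sum>n\<in>{N<..t}. (if [int n = a] (mod d) then of_real (mangoldt n) * \<phi> n else 0))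
        \<le> C * real N powr (1 - s + \<epsilon>)" if t: "N \<le> t" "t \<le> N1" for t
    proof (rule residue_class_sum_bound[OF _ d])
      fix \<beta>
      have "(\<Sum>n\<in>{N<..t}. of_real (mangoldt n) * \<phi> n * ee (\<beta> * real n))
        = (\<Sum>n\<in>{N<..t}. of_real (mangoldt n) * phase \<gamma> h \<beta> n)"
        by (intro sum.cong refl) (simp add: phase_def \<phi>_def ee_add)
      then show "norm (\<Sum>n\<in>{N<..t}. of_real (mangoldt n) * \<phi> n * ee (\<beta> * real n)) \<le> C * real N powr (1 - s + \<epsilon>)"
        using C[of N t h \<beta>] t N h by simp
    qed simp
    have pp: "norm (\<Sum>n\<in>{N<..t}. (if [int n = a] (mod d) \<and> \<not> prime n then of_real (mangoldt n) * \<phi> n else 0))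
        \<le> 4 * B * real N powr (1 - s + \<epsilon>)" if t: "N \<le> t" "t \<le> N1" for t
    proof -
      let ?S = "{n. n \<le> 2 * N \<and> primepow n \<and> \<not> prime n}"
      have "norm (\<Sum>n\<in>{N<..t}. (if [int n = a] (mod d) \<and> \<not> prime n then of_real (mangoldt n) * \<phi> n else 0))
          \<le> (\<Sum>n\<in>{N<..t}. if primepow n \<and> \<not> prime n then Lg else 0)"
      proof (rule sum_norm_le)
        fix n assume n: "n \<in> {N<..t}"
        have "n \<le> 2 * N" using n t N by auto
        then have "real n \<le> real (2 * N)" by (rule of_nat_mono)
        then have "ln (real n) \<le> ln (2 * real N)" using n N by (subst ln_le_cancel_iff) auto
        then have "mangoldt n \<le> Lg" using mangoldt_le_ln[of n] n by (auto simp: Lg_def)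
        then show "norm (if [int n = a] (mod d) \<and> \<not> prime n then of_real (mangoldt n) * \<phi> n else 0)
            \<le> (if primepow n \<and> \<not> prime n then Lg else 0)"
          using mangoldt_nonneg[of n] Lg
          by (auto simp: norm_mult \<phi>_def mangoldt_def[where 'a = complex] mangoldt_def[where 'a = real])
      qed
      also have "\<dots> = (\<Sum>n\<in>{n\<in>{N<..t}. primepow n \<and> \<not> prime n}. Lg)"
        by (simp only: sum.inter_filter[OF finite_greaterThanAtMost])
      also have "\<dots> = real (card {n\<in>{N<..t}. primepow n \<and> \<not> prime n}) * Lg" by simp
      also have "\<dots> \<le> real (card ?S) * Lg"
        using Lg t N by (intro mult_right_mono of_nat_mono card_mono) auto
      also have "\<dots> \<le> 4 * sqrt (real N) * (1 + ln (2 * real N)) * Lg"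
        using Lg by (intro mult_right_mono card_proper_prime_powers N) auto
      also have "\<dots> = 4 * sqrt (real N) * Lg ^ 2" by (simp add: Lg_def power2_eq_square)
      also have "\<dots> \<le> 4 * real N powr (1 - s) * (B * real N powr \<epsilon>)"
      proof -
        have "real N powr (1 / 2) \<le> real N powr (1 - s)"
          using N \<gamma> by (intro powr_mono) (auto simp: s_def field_simps)
        then have "4 * sqrt (real N) \<le> 4 * real N powr (1 - s)" by (simp add: powr_half_sqrt)
        moreover have "Lg ^ 2 \<le> B * real N powr \<epsilon>" unfolding Lg_def by (rule B[OF N(1)])
        ultimately show ?thesis by (rule mult_mono) auto
      qed
      also have "\<dots> = 4 * B * real N powr (1 - s + \<epsilon>)" by (simp add: powr_add)
      finally show ?thesis .
    qed
    have theta: "norm (\<Sum>n\<in>{N<..t}. (if ap_prime a d n then of_real (ln (real n)) * \<phi> n else 0)) \<le> Q"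
      if t: "N \<le> t" "t \<le> N1" for t
    proof -
      have "(\<Sum>n\<in>{N<..t}. (if ap_prime a d n then of_real (ln (real n)) * \<phi> n else 0))
          = (\<Sum>n\<in>{N<..t}. (if [int n = a] (mod d) then of_real (mangoldt n) * \<phi> n else 0))
          - (\<Sum>n\<in>{N<..t}. (if [int n = a] (mod d) \<and> \<not> prime n then of_real (mangoldt n) * \<phi> n else 0))"
        unfolding sum_subtractf[symmetric] by (intro sum.cong refl) (auto simp: ap_prime_def)
      then show ?thesis using ap[OF t] pp[OF t] 
        unfolding Q_def distrib_right by (smt (verit) norm_triangle_ineq4)
    qed
    have "(\<Sum>n\<in>{N<..N1}. (if ap_prime a d n then \<phi> n else 0))
      = (\<Sum>n\<in>{N<..N1}. of_real (1 / ln (real n)) * (if ap_prime a d n then of_real (ln (real n)) * \<phi> n else 0))"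
    proof (rule sum.cong[OF refl])
      fix n assume "n \<in> {N<..N1}"
      then have "ln (real n) > 0" using N by (intro ln_gt_zero) auto
      then show "(if ap_prime a d n then \<phi> n else 0)
        = of_real (1 / ln (real n)) * (if ap_prime a d n then of_real (ln (real n)) * \<phi> n else 0)"
        by (simp flip: of_real_mult mult.assoc)
    qed
    also have "norm \<dots> \<le> 2 * Q"
    proof (cases "N < N1")
      case False
      then show ?thesis using Q0 N by simp
    next
      case True
      have "norm (\<Sum>n\<in>{N<..N1}. of_real (1 / ln (real n)) * (if ap_prime a d n then of_real (ln (real n)) * \<phi> n else 0))
        \<le> Q * (norm (complex_of_real (1 / ln (real N1)))
          + (\<Sum>n\<in>{N<..<N1}. norm (complex_of_real (1 / ln (real (Suc n))) - complex_of_real (1 / ln (real n)))))"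
        by (rule partial_summation_bound[OF N(2) theta])
      also have "(\<Sum>n\<in>{N<..<N1}. norm (complex_of_real (1 / ln (real (Suc n))) - complex_of_real (1 / ln (real n))))
        = (\<Sum>n\<in>{N<..<N1}. - (1 / ln (real (Suc n))) - - (1 / ln (real n)))"
      proof (rule sum.cong[OF refl])
        fix n assume "n \<in> {N<..<N1}"
        then have "0 < ln (real n)" "ln (real n) \<le> ln (real (Suc n))" using N by auto
        then have "1 / ln (real (Suc n)) \<le> 1 / ln (real n)" by (intro divide_left_mono mult_pos_pos) linarith+
        then show "norm (complex_of_real (1 / ln (real (Suc n))) - complex_of_real (1 / ln (real n)))
          = - (1 / ln (real (Suc n))) - - (1 / ln (real n))"
          unfolding of_real_diff[symmetric] norm_of_real by simp
      qed
      also have "\<dots> = 1 / ln (real (Suc N)) - 1 / ln (real N1)"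
        using sum_Suc_diff_telescope[OF True, of "\<lambda>n. - (1 / ln (real n))"] by simp
      also have "norm (complex_of_real (1 / ln (real N1))) = 1 / ln (real N1)"
        using True N unfolding norm_of_real by simp
      also have "Q * (1 / ln (real N1) + (1 / ln (real (Suc N)) - 1 / ln (real N1))) = Q * (1 / ln (real (Suc N)))"
        by simp
      also have "\<dots> \<le> Q * 2"
      proof (rule mult_left_mono[OF _ Q0])
        have "ln 2 \<le> ln (real (Suc N))" using N by (subst ln_le_cancel_iff) auto
        then have "1 / 2 \<le> ln (real (Suc N))" using ln2_ge_two_thirds by linarith
        then have "1 / ln (real (Suc N)) \<le> 1 / (1 / 2)" by (intro divide_left_mono mult_pos_pos) linarith+
        then show "1 / ln (real (Suc N)) \<le> 2" by simp
      qed
      finally show ?thesis by simp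
    qed
    finally show "norm (\<Sum>n\<in>{N<..N1}. (if ap_prime a d n then ee (h * real n powr \<gamma>) else 0))
      \<le> 2 * (C + 4 * B) * real N powr (1 - s + \<epsilon>)"
      by (simp only: \<phi>_def Q_def mult.assoc)
  qed (use C0 B0 in auto)
qed

section \<open>Fourier terms and truncation error\<close>

lemma powr_increment_bounds:
  fixes n \<gamma> :: real
  assumes "0 < \<gamma>" "\<gamma> < 1" "0 < n"
  shows "\<gamma> * (n + 1) powr (\<gamma> - 1) \<le> (n + 1) powr \<gamma> - n powr \<gamma>"
    and "(n + 1) powr \<gamma> - n powr \<gamma> \<le> \<gamma> * n powr (\<gamma> - 1)"
proof -
  have "\<exists>\<xi>>n. \<xi> < n + 1 \<and> (n + 1) powr \<gamma> - n powr \<gamma> = (n + 1 - n) * (\<gamma> * \<xi> powr (\<gamma> - 1))"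
    using assms by (intro MVT2) (auto intro!: derivative_eq_intros)
  then obtain \<xi> where \<xi>: "n < \<xi>" "\<xi> < n + 1" "(n + 1) powr \<gamma> - n powr \<gamma> = \<gamma> * \<xi> powr (\<gamma> - 1)"
    by auto
  have "(n + 1) powr (\<gamma> - 1) \<le> \<xi> powr (\<gamma> - 1)" "\<xi> powr (\<gamma> - 1) \<le> n powr (\<gamma> - 1)"
    using assms \<xi> by (auto intro!: powr_mono2')
  then show "\<gamma> * (n + 1) powr (\<gamma> - 1) \<le> (n + 1) powr \<gamma> - n powr \<gamma>"
    "(n + 1) powr \<gamma> - n powr \<gamma> \<le> \<gamma> * n powr (\<gamma> - 1)"
    unfolding \<xi>(3) using assms by auto
qed

text \<open>The difference of exponentials is e(h n^\<gamma>) times \<open>W\<close>, of size h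
  N^(\<gamma>-1) and with variation of the same order because the increments of n^\<gamma> decrease.
  The factor h gained here compensates the 1/h of the Fourier coefficients.\<close>

lemma phase_increment_sum:
  fixes c :: "nat \<Rightarrow> complex" and N N1 :: nat
  assumes \<gamma>: "0 < \<gamma>" "\<gamma> < 1" and N: "1 \<le> N" "N \<le> N1" and h: "0 \<le> h"
    and B: "\<And>t. N \<le> t \<Longrightarrow> t \<le> N1 \<Longrightarrow> norm (\<Sum>n\<in>{N<..t}. c n * ee (h * real n powr \<gamma>)) \<le> B"
  shows "norm (\<Sum>n\<in>{N<..N1}. c n * (ee (h * real (Suc n) powr \<gamma>) - ee (h * real n powr \<gamma>)))
    \<le> B * (2 * pi * h * real N powr (\<gamma> - 1))"
proof (cases "N < N1")
  case False
  have "B \<ge> 0" using B[of N] N by simp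
  then show ?thesis using False N h by simp
next
  case True
  have B0: "B \<ge> 0" using B[of N] N by simp
  define D where "D n = real (Suc n) powr \<gamma> - real n powr \<gamma>" for n
  define W where "W n = ee (h * D n) - 1" for n
  have D0: "D n \<ge> 0" for n unfolding D_def using \<gamma> by (simp add: powr_mono2)
  have anti: "D (Suc n) \<le> D n" if "n > 0" for n
  proof -
    have "0 < real n" using that by simp
    from second_difference_powr[OF this, of \<gamma>]
    obtain \<eta> where "((real n + 2) powr \<gamma> - (real n + 1) powr \<gamma>) - ((real n + 1) powr \<gamma> - real n powr \<gamma>)
        = - (\<gamma> * (1 - \<gamma>) * \<eta> powr (\<gamma> - 2))" by blast
    moreover have "0 \<le> \<gamma> * (1 - \<gamma>) * \<eta> powr (\<gamma> - 2)" using \<gamma> by simp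
    ultimately have "(real n + 2) powr \<gamma> - (real n + 1) powr \<gamma> \<le> (real n + 1) powr \<gamma> - real n powr \<gamma>"
      by linarith
    then show ?thesis unfolding D_def by (simp add: add.commute)
  qed
  have "(\<Sum>n\<in>{N<..N1}. c n * (ee (h * real (Suc n) powr \<gamma>) - ee (h * real n powr \<gamma>)))
      = (\<Sum>n\<in>{N<..N1}. W n * (c n * ee (h * real n powr \<gamma>)))"
  proof (rule sum.cong[OF refl])
    fix n
    have "ee (h * real (Suc n) powr \<gamma>) = ee (h * D n) * ee (h * real n powr \<gamma>)"
      unfolding ee_add[symmetric] D_def by (simp add: algebra_simps)
    then show "c n * (ee (h * real (Suc n) powr \<gamma>) - ee (h * real n powr \<gamma>)) = W n * (c n * ee (h * real n powr \<gamma>))"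
      by (simp only: W_def) (simp add: algebra_simps)
  qed
  also have "norm \<dots> \<le> B * (norm (W N1) + (\<Sum>n\<in>{N<..<N1}. norm (W (Suc n) - W n)))"
    by (rule partial_summation_bound[OF N(2) B])
  also have "\<dots> \<le> B * (2 * pi * h * real N powr (\<gamma> - 1))"
  proof (rule mult_left_mono[OF _ B0])
    have W1: "norm (W N1) \<le> 2 * pi * (h * D N1)"
      using norm_ee_diff_le[of "h * D N1" 0] D0[of N1] h by (simp add: W_def)
    have "(\<Sum>n\<in>{N<..<N1}. norm (W (Suc n) - W n)) \<le> (\<Sum>n\<in>{N<..<N1}. 2 * pi * h * (- D (Suc n) - - D n))"
    proof (rule sum_mono)
      fix n assume n: "n \<in> {N<..<N1}"
      have "norm (W (Suc n) - W n) \<le> 2 * pi * \<bar>h * D (Suc n) - h * D n\<bar>"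
        using norm_ee_diff_le by (simp add: W_def)
      also have "h * D (Suc n) - h * D n = - (h * (D n - D (Suc n)))" by (simp add: algebra_simps)
      also have "\<bar>\<dots>\<bar> = h * (D n - D (Suc n))" using anti[of n] n h by simp
      finally show "norm (W (Suc n) - W n) \<le> 2 * pi * h * (- D (Suc n) - - D n)" by simp
    qed
    also have "\<dots> = 2 * pi * h * (D (Suc N) - D N1)"
      unfolding sum_distrib_left[symmetric] using sum_Suc_diff_telescope[OF True, of "\<lambda>n. - D n"] by simp
    \<comment> \<open>The end value contributes D(N1), which cancels the -D(N1) of the telescoped
      variation.\<close>
    finally have "norm (W N1) + (\<Sum>n\<in>{N<..<N1}. norm (W (Suc n) - W n)) \<le> 2 * pi * h * D (Suc N)"
      using W1 by (simp add: algebra_simps)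
    moreover have "D (Suc N) \<le> real N powr (\<gamma> - 1)"
    proof -
      have "D (Suc N) \<le> D N" using anti N by simp
      also have "D N \<le> \<gamma> * real N powr (\<gamma> - 1)"
        using powr_increment_bounds(2)[OF \<gamma>, of "real N"] N by (simp add: D_def add.commute)
      also have "\<dots> \<le> 1 * real N powr (\<gamma> - 1)" using \<gamma> by (intro mult_right_mono) auto
      finally show ?thesis by simp
    qed
    then have "2 * pi * h * D (Suc N) \<le> 2 * pi * h * real N powr (\<gamma> - 1)"
      using h by (intro mult_left_mono) auto
    ultimately show "norm (W N1) + (\<Sum>n\<in>{N<..<N1}. norm (W (Suc n) - W n)) \<le> 2 * pi * h * real N powr (\<gamma> - 1)"
      by linarith
  qed
  finally show ?thesis .
qed

text \<open>Expanding the square gives q diagonal terms and frequencies l - k of absolute value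
  between 1 and q, all covered by van der Corput's test. The range reaches 2N + 1 because the kernel
  is also needed at n + 1.\<close>

lemma fejer_sum_bound:
  fixes N N1 q :: nat
  assumes \<gamma>: "0 < \<gamma>" "\<gamma> < 1" and C: "vdc_const \<gamma> C" and N: "1 \<le> N" "N1 \<le> 2 * N + 1" and q: "1 \<le> q"
  shows "(\<Sum>n\<in>{N<..N1}. fejer q (real n powr \<gamma>))
    \<le> 2 * real N + real q * (C * (sqrt (real q * real N powr \<gamma>) + real N powr (1 - \<gamma> / 2)))"
proof -
  let ?R = "C * (sqrt (real q * real N powr \<gamma>) + real N powr (1 - \<gamma> / 2))"
  have C0: "C > 0" using C by (simp add: vdc_const_def)
  have R0: "?R \<ge> 0" using C0 by (intro mult_nonneg_nonneg add_nonneg_nonneg) auto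
  have pair: "norm (\<Sum>n\<in>{N<..N1}. ee (real l * real n powr \<gamma>) * cnj (ee (real k * real n powr \<gamma>)))
    \<le> (if l = k then 2 * real N else 0) + ?R" if lk: "l \<in> {..<q}" "k \<in> {..<q}" for l k
  proof (cases "l = k")
    case True
    have "norm (\<Sum>n\<in>{N<..N1}. ee (real l * real n powr \<gamma>) * cnj (ee (real k * real n powr \<gamma>)))
      \<le> (\<Sum>n\<in>{N<..N1}. 1)" by (rule sum_norm_le) (simp add: norm_mult)
    also have "\<dots> \<le> 2 * real N" using N by simp
    finally show ?thesis using True R0 by simp
  next
    case False
    have "(\<Sum>n\<in>{N<..N1}. ee (real l * real n powr \<gamma>) * cnj (ee (real k * real n powr \<gamma>)))
      = (\<Sum>n\<in>{N<..N1}. ee ((real l - real k) * real n powr \<gamma> + 0 * real n))"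
      unfolding ee_minus[symmetric] ee_add[symmetric] by (simp add: algebra_simps)
    also have "norm \<dots> \<le> C * (sqrt (real q * real N powr \<gamma>) + real N / sqrt (real N powr \<gamma>))"
    proof (rule phase_sum_bound[OF C])
      have "1 \<le> \<bar>real l - real k\<bar>" using False by linarith
      then show "real N powr \<gamma> \<le> \<bar>real l - real k\<bar> * real N powr \<gamma>"
        using mult_right_mono[of 1 _ "real N powr \<gamma>"] by simp
      have "\<bar>real l - real k\<bar> \<le> real q" using lk by auto
      then show "\<bar>real l - real k\<bar> * real N powr \<gamma> \<le> real q * real N powr \<gamma>"
        by (intro mult_right_mono) auto
    qed (use N False in auto)
    also have "real N / sqrt (real N powr \<gamma>) = real N powr (1 - \<gamma> / 2)"
      using N by (simp add: powr_half_sqrt[symmetric] powr_powr powr_diff)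
    finally show ?thesis using False by simp
  qed
  have "(\<Sum>n\<in>{N<..N1}. fejer q (real n powr \<gamma>))
      = (\<Sum>n\<in>{N<..N1}. (norm (\<Sum>l\<in>{..<q}. ee (real l * real n powr \<gamma>)))\<^sup>2) / real q"
    by (simp add: fejer_def sum_divide_distrib)
  also have "\<dots> \<le> (\<Sum>l\<in>{..<q}. \<Sum>k\<in>{..<q}. norm (\<Sum>n\<in>{N<..N1}.
      ee (real l * real n powr \<gamma>) * cnj (ee (real k * real n powr \<gamma>)))) / real q"
    by (intro divide_right_mono norm_sum_square_le) auto
  also have "\<dots> \<le> (\<Sum>l\<in>{..<q}. \<Sum>k\<in>{..<q}. (if l = k then 2 * real N else 0) + ?R) / real q"
    by (intro divide_right_mono sum_mono pair) auto
  also have "\<dots> = 2 * real N + real q * ?R"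
  proof -
    have "(\<Sum>l<q. \<Sum>k<q. (if l = k then x else 0) + y) / real q = x + real q * y" for x y :: real
      using q by (simp add: sum.distrib sum.delta add_divide_distrib)
    then show ?thesis .
  qed
  finally show ?thesis .
qed

section \<open>Counting primes\<close>

text \<open>The sawtooth splits into a trigonometric polynomial, handled by the prime sums frequency
  by frequency, and a remainder bounded by Fejer kernels, summed over all integers of the
  range.\<close>

theorem saw_sum_over_primes:
  fixes \<gamma> \<epsilon> :: real
  defines "E \<equiv> 17 / 39 + 7 * \<gamma> / 13"
  assumes \<gamma>: "17 / 18 < \<gamma>" "\<gamma> < 1" and \<epsilon>: "0 < \<epsilon>"
  shows "\<exists>C>0. \<forall>N N1 (a::int) (d::int). 1 \<le> N \<longrightarrow> N \<le> N1 \<longrightarrow> N1 \<le> 2 * N \<longrightarrow> 1 \<le> d \<longrightarrow>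
    \<bar>\<Sum>n\<in>{N<..N1}. (if ap_prime a d n then saw (- (real (Suc n) powr \<gamma>)) - saw (- (real n powr \<gamma>)) else 0)\<bar>
      \<le> C * real N powr (E + \<epsilon>)"
proof -
  define s where "s = (5 - 3 * \<gamma>) / 39"
  have \<gamma>01: "0 < \<gamma>" "\<gamma> < 1" using \<gamma> by auto
  obtain Cv where Cv: "vdc_const \<gamma> Cv" using van_der_corput_powr[OF \<gamma>01] unfolding vdc_const_def by blast
  have Cv0: "Cv > 0" using Cv by (simp add: vdc_const_def)
  obtain Cp where Cp0: "Cp > 0" and CC: "\<forall>N N1 h (a::int) (d::int). 1 \<le> N \<longrightarrow> N \<le> N1 \<longrightarrow> N1 \<le> 2 * N \<longrightarrow> 1 \<le> h \<longrightarrow>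
    h \<le> 2 * real N powr (1 - E) \<longrightarrow> 1 \<le> d \<longrightarrow>
    norm (\<Sum>n\<in>{N<..N1}. (if ap_prime a d n then ee (h * real n powr \<gamma>) else 0))
      \<le> Cp * real N powr (1 - s + \<epsilon>)"
    using prime_phase_sum[OF \<gamma> \<epsilon>] unfolding E_def s_def by (elim exE conjE)
  note Cp = CC[rule_format]
  obtain B where B0: "B > 0" and B: "\<And>N::nat. 1 \<le> N \<Longrightarrow> (1 + ln (2 * real N)) ^ 1 \<le> B * real N powr \<epsilon>"
    using log_power_bound[OF \<epsilon>, of 1] by blast
  define C2 where "C2 = 2 * (192 + 288 * Cv)"
  have C20: "C2 > 0" using Cv0 by (simp add: C2_def)
  show ?thesis
  proof (intro exI[of _ "4 * Cp + C2 * B"] conjI allI impI)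
    fix N N1 :: nat and a d :: int
    assume N: "1 \<le> N" "N \<le> N1" "N1 \<le> 2 * N" and d: "1 \<le> d"
    define y where "y = real N powr (1 - E)"
    define Lg where "Lg = 1 + ln (2 * real N)"
    have Lg: "Lg \<ge> 1" using N by (simp add: Lg_def)
    have N0: "real N \<ge> 1" "real N > 0" using N by auto
    have mono: "real N powr a \<le> real N powr b" if "a \<le> b" for a b using N0 that by (intro powr_mono) auto
    have sqrt_powr: "sqrt (real N powr a) = real N powr (a / 2)" for a
      using N0 by (simp add: powr_half_sqrt[symmetric] powr_powr)
    have E: "1 / 2 \<le> E" "E \<le> 1" using \<gamma> by (auto simp: E_def)
    have y1: "1 \<le> y" unfolding y_def using N0 E by (intro ge_one_powr_ge_zero) auto
    have "y \<le> real N powr 1" unfolding y_def using E by (intro mono) auto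
    then have yN: "y \<le> real N" using N0 by simp
    have "1 \<le> nat \<lfloor>y\<rfloor>" using y1 by linarith
    then obtain j where j: "2 ^ j \<le> nat \<lfloor>y\<rfloor>" "nat \<lfloor>y\<rfloor> < 2 ^ (j + 1)"
      using ex_power_ivl1[of 2 "nat \<lfloor>y\<rfloor>"] by auto
    \<comment> \<open>\<open>H\<close> is the first power of two above N^(1-E), since the majorant
      is built from dyadic kernels. The rounding costs a factor 2, hence the allowance h \<le> 2
      N^(1-E) in the prime sums.\<close>
    define J where "J = j + 1"
    define H :: nat where "H = 2 ^ J"
    have H: "y \<le> real H" "real H \<le> 2 * y"
    proof -
      have "real (2 ^ j) \<le> real (nat \<lfloor>y\<rfloor>)" using j(1) by (rule of_nat_mono)
      then have "real (2 ^ j) \<le> y" using y1 by linarith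
      then show "real H \<le> 2 * y" by (simp add: H_def J_def)
      have "real (nat \<lfloor>y\<rfloor> + 1) \<le> real H" unfolding H_def J_def using j(2) by (intro of_nat_mono) simp
      then show "y \<le> real H" using y1 by linarith
    qed
    have H0: "real H > 0" by (simp add: H_def)
    have JL: "real J + 1 \<le> 2 * Lg"
    proof -
      have "2 ^ J \<le> 2 * real N" using H yN by (simp add: H_def)
      then have "ln (2 ^ J) \<le> ln (2 * real N)" by (subst ln_le_cancel_iff) (use N in auto)
      then have "real J * ln 2 \<le> ln (2 * real N)" by (simp add: ln_realpow)
      moreover have "real J * (1 / 2) \<le> real J * ln 2"
        using ln2_ge_two_thirds by (intro mult_left_mono) auto
      ultimately have "real J * (1 / 2) \<le> ln (2 * real N)" by (rule order.trans[rotated])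
      then show ?thesis unfolding Lg_def by simp
    qed
    define t where "t n = real n powr \<gamma>" for n :: nat
    define R where "R u = 48 / real H * (\<Sum>j\<le>J. fejer (2 ^ j) u)" for u
    have R0: "R u \<ge> 0" for u unfolding R_def by (intro mult_nonneg_nonneg sum_nonneg fejer_nonneg) auto
    define err where "err u = saw (- u) - saw_sum H u" for u
    have err: "\<bar>err u\<bar> \<le> R u" for u
      using saw_approximation[OF H_def, of "- u"] unfolding saw_sum_minus fejer_minus err_def R_def by simp
    define I where "I n = (if ap_prime a d n then 1 else 0 :: real)" for n

    have main: "\<bar>\<Sum>n\<in>{N<..N1}. I n * (saw_sum H (t (Suc n)) - saw_sum H (t n))\<bar> \<le> 4 * Cp * real N powr (E + \<epsilon>)"
    proof -
      define T where "T h = (\<Sum>n\<in>{N<..N1}. of_real (I n) * (ee (real h * t (Suc n)) - ee (real h * t n)))" for h :: nat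
      have T: "norm (T h) \<le> Cp * real N powr (1 - s + \<epsilon>) * (2 * pi * real h * real N powr (\<gamma> - 1))"
        if h: "h \<in> {1..H}" for h
        unfolding T_def t_def
      proof (rule phase_increment_sum[OF \<gamma>01 N(1,2)])
        fix u assume u: "N \<le> u" "u \<le> N1"
        have "real h \<le> real H" using h by simp
        then have hy: "real h \<le> 2 * real N powr (1 - E)" using H unfolding y_def by linarith
        have "(\<Sum>n\<in>{N<..u}. of_real (I n) * ee (real h * real n powr \<gamma>))
          = (\<Sum>n\<in>{N<..u}. if ap_prime a d n then ee (real h * real n powr \<gamma>) else 0)"
          by (intro sum.cong) (auto simp: I_def)
        then show "norm (\<Sum>n\<in>{N<..u}. of_real (I n) * ee (real h * real n powr \<gamma>)) \<le> Cp * real N powr (1 - s + \<epsilon>)"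
          using Cp[OF N(1), of u "real h" d a] u N h hy d by simp
      qed simp
      have "(\<Sum>n\<in>{N<..N1}. I n * (saw_sum H (t (Suc n)) - saw_sum H (t n)))
          = (\<Sum>n\<in>{N<..N1}. \<Sum>h\<in>{1..H}. Im (of_real (I n) * (ee (real h * t (Suc n)) - ee (real h * t n))) / (pi * real h))"
        unfolding saw_sum_def sum_subtractf[symmetric] sum_distrib_left
        by (intro sum.cong refl) (simp add: diff_divide_distrib right_diff_distrib)
      also have "\<dots> = (\<Sum>h\<in>{1..H}. \<Sum>n\<in>{N<..N1}. Im (of_real (I n) * (ee (real h * t (Suc n)) - ee (real h * t n))) / (pi * real h))"
        by (rule sum.swap)
      also have "\<dots> = (\<Sum>h\<in>{1..H}. Im (T h) / (pi * real h))"
        unfolding T_def Im_sum sum_divide_distrib ..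
      also have "\<bar>\<dots>\<bar> \<le> (\<Sum>h\<in>{1..H}. 2 * (Cp * real N powr (1 - s + \<epsilon>)) * real N powr (\<gamma> - 1))"
      proof (rule order.trans[OF sum_abs], rule sum_mono)
        fix h assume h: "h \<in> {1..H}"
        have "\<bar>Im (T h) / (pi * real h)\<bar> \<le> norm (T h) / (pi * real h)"
          using abs_Im_le_cmod[of "T h"] h by (simp add: divide_right_mono)
        also have "\<dots> \<le> Cp * real N powr (1 - s + \<epsilon>) * (2 * pi * real h * real N powr (\<gamma> - 1)) / (pi * real h)"
          using T[OF h] by (intro divide_right_mono) auto
        also have "\<dots> = 2 * (Cp * real N powr (1 - s + \<epsilon>)) * real N powr (\<gamma> - 1)" using h by simp
        finally show "\<bar>Im (T h) / (pi * real h)\<bar> \<le> 2 * (Cp * real N powr (1 - s + \<epsilon>)) * real N powr (\<gamma> - 1)" .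
      qed
      also have "\<dots> = real H * (2 * Cp * (real N powr (1 - s + \<epsilon>) * real N powr (\<gamma> - 1)))" by simp
      also have "\<dots> \<le> 2 * y * (2 * Cp * (real N powr (1 - s + \<epsilon>) * real N powr (\<gamma> - 1)))"
        using H Cp0 by (intro mult_right_mono) auto
      also have "\<dots> = 4 * Cp * real N powr (1 - E + (1 - s + \<epsilon> + (\<gamma> - 1)))"
        unfolding y_def powr_add[of "real N" "1 - E"] powr_add[of "real N" "1 - s + \<epsilon>" "\<gamma> - 1"] by simp
      \<comment> \<open>This is 1 + \<gamma> - s = 2E, the other equation that determines E and
        s.\<close>
      also have "1 - E + (1 - s + \<epsilon> + (\<gamma> - 1)) = E + \<epsilon>" by (simp add: E_def s_def field_simps)
      finally show ?thesis .
    qed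

    have Rsum: "(\<Sum>n\<in>{N<..2 * N + 1}. R (t n)) \<le> (192 + 288 * Cv) * B * real N powr (E + \<epsilon>)"
    proof -
      let ?V = "Cv * (sqrt (real H * real N powr \<gamma>) + real N powr (1 - \<gamma> / 2))"
      have "sqrt (real H * real N powr \<gamma>) \<le> sqrt (4 * real N powr (1 - E + \<gamma>))"
      proof (rule real_sqrt_le_mono)
        have "real H * real N powr \<gamma> \<le> (2 * y) * real N powr \<gamma>" using H by (intro mult_right_mono) auto
        also have "\<dots> = 2 * real N powr (1 - E + \<gamma>)" by (simp add: y_def powr_add)
        finally show "real H * real N powr \<gamma> \<le> 4 * real N powr (1 - E + \<gamma>)"
          by (smt (verit) powr_ge_zero)
      qed
      also have "\<dots> = 2 * real N powr ((1 - E + \<gamma>) / 2)" by (simp add: real_sqrt_mult sqrt_powr)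
      also have "\<dots> \<le> 2 * real N powr E"
        using \<gamma> by (intro mult_left_mono mono) (auto simp: E_def field_simps)
      finally have V1: "sqrt (real H * real N powr \<gamma>) \<le> 2 * real N powr E" .
      have V2: "real N powr (1 - \<gamma> / 2) \<le> real N powr E"
        using \<gamma> by (intro mono) (auto simp: E_def field_simps)
      have V: "?V \<le> 3 * Cv * real N powr E"
        using V1 V2 Cv0 mult_left_mono[of "sqrt (real H * real N powr \<gamma>) + real N powr (1 - \<gamma> / 2)" "3 * real N powr E" Cv]
        by simp
      have "(\<Sum>n\<in>{N<..2 * N + 1}. R (t n)) = 48 / real H * (\<Sum>j\<le>J. \<Sum>n\<in>{N<..2 * N + 1}. fejer (2 ^ j) (t n))"
        unfolding R_def sum_distrib_left[symmetric] by (subst sum.swap) simp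
      also have "\<dots> \<le> 48 / real H * (\<Sum>j\<le>J. 2 * real N + 2 ^ j * ?V)"
      proof (intro mult_left_mono sum_mono)
        fix j assume j: "j \<in> {..J}"
        have "(\<Sum>n\<in>{N<..2 * N + 1}. fejer (2 ^ j) (t n)) \<le> 2 * real N
            + real (2 ^ j) * (Cv * (sqrt (real (2 ^ j) * real N powr \<gamma>) + real N powr (1 - \<gamma> / 2)))"
          unfolding t_def by (rule fejer_sum_bound[OF \<gamma>01 Cv N(1)]) auto
        also have "\<dots> \<le> 2 * real N + real (2 ^ j) * ?V"
          using j Cv0 by (intro add_left_mono mult_left_mono add_right_mono real_sqrt_le_mono mult_right_mono)
            (auto simp: H_def)
        finally show "(\<Sum>n\<in>{N<..2 * N + 1}. fejer (2 ^ j) (t n)) \<le> 2 * real N + 2 ^ j * ?V" by simp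
      qed simp
      also have "(\<Sum>j\<le>J. 2 * real N + 2 ^ j * ?V) = (real J + 1) * (2 * real N) + (\<Sum>j\<le>J. 2 ^ j) * ?V"
        by (simp add: sum.distrib sum_distrib_right)
      also have "(\<Sum>j\<le>J. 2 ^ j) = 2 * real H - 1"
        by (simp add: H_def flip: lessThan_Suc_atMost) (simp add: geometric_sum)
      also have "48 / real H * ((real J + 1) * (2 * real N) + (2 * real H - 1) * ?V)
          \<le> 48 / real H * (2 * Lg * (2 * real N) + (2 * real H) * ?V)"
        using JL H0 Cv0 by (intro mult_left_mono add_mono mult_right_mono) (auto intro!: mult_nonneg_nonneg)
      also have "\<dots> = 192 * Lg * (real N / real H) + 96 * ?V" using H0 by (simp add: field_simps)
      also have "\<dots> \<le> 192 * Lg * real N powr E + 96 * (3 * Cv * real N powr E)"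
      proof (rule add_mono)
        have "real N / real H \<le> real N / y" using H y1 N0 by (intro divide_left_mono) auto
        also have "\<dots> = real N powr E" using N0 by (simp add: y_def powr_diff)
        finally show "192 * Lg * (real N / real H) \<le> 192 * Lg * real N powr E"
          using Lg by (intro mult_left_mono) auto
        show "96 * ?V \<le> 96 * (3 * Cv * real N powr E)" using V by simp
      qed
      also have "\<dots> \<le> 192 * Lg * real N powr E + 288 * Cv * Lg * real N powr E"
        using Lg Cv0 mult_left_mono[of 1 Lg "288 * Cv * real N powr E"] by (simp add: mult_ac)
      also have "\<dots> = (192 + 288 * Cv) * (real N powr E * Lg)" by (simp add: algebra_simps)
      also have "\<dots> \<le> (192 + 288 * Cv) * (real N powr E * (B * real N powr \<epsilon>))"
        using B[OF N(1)] Cv0 unfolding Lg_def by (intro mult_left_mono) auto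
      also have "\<dots> = (192 + 288 * Cv) * B * real N powr (E + \<epsilon>)" by (simp add: powr_add)
      finally show ?thesis .
    qed
    have errs: "\<bar>\<Sum>n\<in>{N<..N1}. I n * (err (t (Suc n)) - err (t n))\<bar> \<le> C2 * B * real N powr (E + \<epsilon>)"
    proof -
      \<comment> \<open>Since \<open>R\<close> is nonnegative, the indicator of the primes may be
        dropped here.\<close>
      have "\<bar>\<Sum>n\<in>{N<..N1}. I n * (err (t (Suc n)) - err (t n))\<bar> \<le> (\<Sum>n\<in>{N<..N1}. R (t (Suc n)) + R (t n))"
      proof (rule order.trans[OF sum_abs], rule sum_mono)
        fix n
        show "\<bar>I n * (err (t (Suc n)) - err (t n))\<bar> \<le> R (t (Suc n)) + R (t n)"
          using err[of "t n"] err[of "t (Suc n)"] R0[of "t n"] R0[of "t (Suc n)"] by (auto simp: I_def)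
      qed
      also have "\<dots> = (\<Sum>n\<in>{Suc N<..Suc N1}. R (t n)) + (\<Sum>n\<in>{N<..N1}. R (t n))"
      proof -
        have "(\<Sum>n\<in>{N<..N1}. R (t (Suc n))) = (\<Sum>n\<in>{Suc N<..Suc N1}. R (t n))"
          by (rule sum.reindex_bij_witness[of _ "\<lambda>n. n - 1" Suc]) auto
        then show ?thesis by (simp add: sum.distrib)
      qed
      also have "\<dots> \<le> (\<Sum>n\<in>{N<..2 * N + 1}. R (t n)) + (\<Sum>n\<in>{N<..2 * N + 1}. R (t n))"
        using N by (intro add_mono sum_mono2 R0) auto
      also have "\<dots> \<le> C2 * B * real N powr (E + \<epsilon>)" using Rsum unfolding C2_def by linarith
      finally show ?thesis .
    qed
    have "(\<Sum>n\<in>{N<..N1}. (if ap_prime a d n then saw (- (real (Suc n) powr \<gamma>)) - saw (- (real n powr \<gamma>)) else 0))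
      = (\<Sum>n\<in>{N<..N1}. I n * (saw_sum H (t (Suc n)) - saw_sum H (t n)))
        + (\<Sum>n\<in>{N<..N1}. I n * (err (t (Suc n)) - err (t n)))"
      unfolding sum.distrib[symmetric] by (intro sum.cong refl) (simp add: I_def err_def t_def)
    then show "\<bar>\<Sum>n\<in>{N<..N1}. (if ap_prime a d n then saw (- (real (Suc n) powr \<gamma>)) - saw (- (real n powr \<gamma>)) else 0)\<bar>
      \<le> (4 * Cp + C2 * B) * real N powr (E + \<epsilon>)"
      using main errs unfolding distrib_right by linarith
  qed (use Cp0 C20 B0 in \<open>auto intro!: add_pos_pos\<close>)
qed

section \<open>Assembly of dyadic ranges\<close>

text \<open>Halving X repeatedly gives a geometric series with ratio at most (3/4)^\<eta>; the
  constant K is the fixed point of K q + C = K. The dyadic ranges start at 2, so n = 1 is treated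
  separately.\<close>

lemma dyadic_sum_bound:
  fixes f :: "nat \<Rightarrow> real"
  assumes \<eta>: "0 < \<eta>" and C: "0 \<le> C" and f1: "f 1 = 0"
    and bound: "\<And>N N1. 1 \<le> N \<Longrightarrow> N \<le> N1 \<Longrightarrow> N1 \<le> 2 * N \<Longrightarrow> \<bar>\<Sum>n\<in>{N<..N1}. f n\<bar> \<le> C * real N powr \<eta>"
    and X: "1 \<le> X"
  shows "\<bar>\<Sum>n\<in>{1..X}. f n\<bar> \<le> C / (1 - (3 / 4) powr \<eta>) * real X powr \<eta>"
  using X
proof (induction X rule: less_induct)
  case (less X)
  define q :: real where "q = (3 / 4) powr \<eta>"
  have q: "0 < q" "q < 1"
    using powr_less_mono2[of \<eta> "3 / 4" 1] \<eta> by (auto simp: q_def)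
  define K where "K = C / (1 - q)"
  have K0: "K \<ge> 0" using C q by (simp add: K_def)
  show ?case
  proof (cases "X = 1")
    case True
    then show ?thesis using f1 K0 by (simp add: K_def q_def)
  next
    case False
    \<comment> \<open>Rounding up ensures X \<le> 2N. The ratio N/X is worst at X = 3, where it is
      2/3, hence the 3/4.\<close>
    define N where "N = (X + 1) div 2"
    have N: "1 \<le> N" "N < X" "X \<le> 2 * N" "4 * N \<le> 3 * X" using False less.prems by (auto simp: N_def)
    have "real N \<le> 3 / 4 * real X" using N(4) by simp
    then have "real N powr \<eta> \<le> (3 / 4 * real X) powr \<eta>" using \<eta> by (intro powr_mono2) auto
    then have Nq: "real N powr \<eta> \<le> q * real X powr \<eta>" unfolding q_def powr_mult .
    have "{1..X} = {1..N} \<union> {N<..X}" using N by auto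
    then have "(\<Sum>n\<in>{1..X}. f n) = (\<Sum>n\<in>{1..N}. f n) + (\<Sum>n\<in>{N<..X}. f n)"
      by (simp only:) (intro sum.union_disjoint, auto)
    then have "\<bar>\<Sum>n\<in>{1..X}. f n\<bar> \<le> K * real N powr \<eta> + C * real N powr \<eta>"
      using less.IH[OF N(2,1)] bound[of N X] N unfolding K_def q_def by linarith
    also have "\<dots> \<le> K * (q * real X powr \<eta>) + C * (1 * real X powr \<eta>)"
    proof (intro add_mono mult_left_mono Nq K0 C)
      have "real N powr \<eta> \<le> real X powr \<eta>" using N \<eta> by (intro powr_mono2) auto
      then show "real N powr \<eta> \<le> 1 * real X powr \<eta>" by simp
    qed
    also have "\<dots> = (K * q + C) * real X powr \<eta>" by (simp add: algebra_simps)
    also have "K * q + C = K" using q by (simp add: K_def field_simps)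
    finally show ?thesis by (simp add: K_def q_def)
  qed
qed

section \<open>Counting Piatetski--Shapiro primes\<close>

lemma PS_primes_iff:
  fixes c \<gamma> :: real and p :: nat
  assumes c: "1 < c" "\<gamma> = 1 / c" and p: "prime p"
  shows "p \<in> PS_primes c \<longleftrightarrow> (\<exists>k::nat. real p powr \<gamma> \<le> real k \<and> real k < real (Suc p) powr \<gamma>)"
proof -
  have \<gamma>: "0 < \<gamma>" "c * \<gamma> = 1" using c by auto
  have p0: "p > 0" using p prime_gt_0_nat by blast
  have pow: "(real n powr \<gamma>) powr c = real n" "(real n powr c) powr \<gamma> = real n" for n :: nat
    using \<gamma> by (auto simp: powr_powr mult.commute)
  have le: "real m powr \<gamma> \<le> real k \<longleftrightarrow> real m \<le> real k powr c" for m k :: nat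
  proof
    assume "real m powr \<gamma> \<le> real k"
    then have "(real m powr \<gamma>) powr c \<le> real k powr c" using c by (intro powr_mono2) auto
    then show "real m \<le> real k powr c" by (simp add: pow)
  next
    assume "real m \<le> real k powr c"
    then have "real m powr \<gamma> \<le> (real k powr c) powr \<gamma>" using \<gamma> by (intro powr_mono2) auto
    then show "real m powr \<gamma> \<le> real k" by (simp add: pow)
  qed
  have "int p = \<lfloor>real k powr c\<rfloor> \<longleftrightarrow> real p powr \<gamma> \<le> real k \<and> real k < real (Suc p) powr \<gamma>" for k :: nat
  proof -
    have "int p = \<lfloor>real k powr c\<rfloor> \<longleftrightarrow> real p \<le> real k powr c \<and> real k powr c < real p + 1"
      by linarith
    also have "\<dots> \<longleftrightarrow> real p powr \<gamma> \<le> real k \<and> \<not> real (Suc p) powr \<gamma> \<le> real k"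
      unfolding le by auto
    finally show ?thesis by auto
  qed
  then show ?thesis using p by (simp add: PS_primes_def)
qed

text \<open>The interval from p^\<gamma> to (p+1)^\<gamma> is shorter than 1, so it holds at most
  one integer, and a half-open interval [x, y) contains ceiling(y) - ceiling(x) integers. Taking
  \<open>saw\<close> at negative arguments produces exactly these ceilings, also when an end point
  is an integer.\<close>

lemma PS_indicator:
  fixes c \<gamma> :: real and p :: nat
  assumes c: "1 < c" "\<gamma> = 1 / c" and p: "prime p"
  shows "(if p \<in> PS_primes c then 1 else 0) = (real (Suc p) powr \<gamma> - real p powr \<gamma>)
    + (saw (- (real (Suc p) powr \<gamma>)) - saw (- (real p powr \<gamma>)))"
proof -
  have \<gamma>: "0 < \<gamma>" "\<gamma> < 1" using c by auto
  have p1: "1 \<le> real p" using prime_ge_1_nat[OF p] by simp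
  let ?x = "real p powr \<gamma>" and ?y = "real (Suc p) powr \<gamma>"
  have saw: "saw (- u) = of_int \<lceil>u\<rceil> - u - 1 / 2" for u
    by (simp add: saw_def frac_def ceiling_def)
  have "?y - ?x \<le> \<gamma> * real p powr (\<gamma> - 1)"
    using powr_increment_bounds(2)[OF \<gamma>, of "real p"] p1 by (simp add: add.commute)
  also have "\<dots> \<le> \<gamma> * 1"
    using p1 \<gamma> powr_mono[of "\<gamma> - 1" 0 "real p"] by (intro mult_left_mono) auto
  finally have lt: "?y < ?x + 1" using \<gamma> by simp
  have le: "?x \<le> ?y" using \<gamma> by (intro powr_mono2) auto
  have "of_int \<lceil>?y\<rceil> - of_int \<lceil>?x\<rceil> = (if p \<in> PS_primes c then 1 else 0 :: real)"
  proof (cases "p \<in> PS_primes c")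
    case True
    then obtain k :: nat where k: "?x \<le> real k" "real k < ?y" using PS_primes_iff[OF c p] by blast
    have "\<lceil>?x\<rceil> = int k" using k lt by (intro ceiling_unique) auto
    moreover have "\<lceil>?y\<rceil> = int k + 1" using k lt by (intro ceiling_unique) auto
    ultimately show ?thesis using True by simp
  next
    case False
    have "\<not> real (nat \<lceil>?x\<rceil>) < ?y"
      using False PS_primes_iff[OF c p] of_nat_ceiling[of ?x] by blast
    moreover have "0 \<le> \<lceil>?x\<rceil>" using ceiling_mono[of 0 ?x] by simp
    ultimately have "?y \<le> of_int \<lceil>?x\<rceil>" by simp
    then have "\<lceil>?y\<rceil> \<le> \<lceil>?x\<rceil>" by (simp only: ceiling_le_iff)
    then have "\<lceil>?y\<rceil> = \<lceil>?x\<rceil>" using ceiling_mono[OF le] by (rule antisym)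
    then show ?thesis using False by simp
  qed
  then show ?thesis unfolding saw by linarith
qed

text \<open>Partial summation in integral form: the counting function is a sum of indicators of
  [p, x], and integrating u^(\<gamma>-2) over each interval is elementary. All primes are at least
  2, so the main term of the theorem is exactly this weighted sum.\<close>

lemma weighted_prime_count:
  fixes \<gamma> x :: real and a d :: int
  assumes \<gamma>: "0 < \<gamma>" "\<gamma> < 1" and x: "2 \<le> x"
  shows "\<gamma> * x powr (\<gamma> - 1) * real (prime_count_ap x d a)
     + \<gamma> * (1 - \<gamma>) * integral {2..x} (\<lambda>u. u powr (\<gamma> - 2) * real (prime_count_ap u d a))
    = (\<Sum>p\<in>{p. prime p \<and> real p \<le> x \<and> [int p = a] (mod d)}. \<gamma> * real p powr (\<gamma> - 1))"
proof -
  let ?P = "{p. prime p \<and> real p \<le> x \<and> [int p = a] (mod d)}"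
  have fin: "finite ?P"
  proof (rule finite_subset)
    show "?P \<subseteq> {..nat \<lfloor>x\<rfloor>}" by (auto simp: le_nat_floor)
  qed simp
  define J where "J p = (x powr (\<gamma> - 1) - real p powr (\<gamma> - 1)) / (\<gamma> - 1)" for p :: nat
  have single: "((\<lambda>u. if u \<in> {real p..x} then u powr (\<gamma> - 2) else 0) has_integral J p) {2..x}"
    if p: "p \<in> ?P" for p
  proof -
    have p2: "2 \<le> real p" using p prime_ge_2_nat[of p] by auto
    have "((\<lambda>u. u powr (\<gamma> - 2)) has_integral (x powr (\<gamma> - 1) / (\<gamma> - 1) - real p powr (\<gamma> - 1) / (\<gamma> - 1))) {real p..x}"
    proof (rule fundamental_theorem_of_calculus)
      fix u assume u: "u \<in> {real p..x}"
      have "((\<lambda>u. u powr (\<gamma> - 1) / (\<gamma> - 1)) has_real_derivative u powr (\<gamma> - 2)) (at u within {real p..x})"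
        using u p2 \<gamma> by (auto intro!: derivative_eq_intros simp: diff_diff_eq)
      then show "((\<lambda>u. u powr (\<gamma> - 1) / (\<gamma> - 1)) has_vector_derivative u powr (\<gamma> - 2)) (at u within {real p..x})"
        by (simp add: has_real_derivative_iff_has_vector_derivative)
    qed (use p in auto)
    then show ?thesis using p2 by (subst has_integral_restrict) (auto simp: J_def diff_divide_distrib)
  qed
  have "((\<lambda>u. \<Sum>p\<in>?P. if u \<in> {real p..x} then u powr (\<gamma> - 2) else 0) has_integral (\<Sum>p\<in>?P. J p)) {2..x}"
    by (intro has_integral_sum fin single)
  moreover have "(\<Sum>p\<in>?P. if u \<in> {real p..x} then u powr (\<gamma> - 2) else 0) = u powr (\<gamma> - 2) * real (prime_count_ap u d a)"
    if u: "u \<in> {2..x}" for u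
  proof -
    have "(\<Sum>p\<in>?P. if u \<in> {real p..x} then u powr (\<gamma> - 2) else 0) = (\<Sum>p\<in>{p\<in>?P. u \<in> {real p..x}}. u powr (\<gamma> - 2))"
      by (simp only: sum.inter_filter[OF fin])
    also have "{p\<in>?P. u \<in> {real p..x}} = {p. prime p \<and> real p \<le> u \<and> [int p = a] (mod d)}"
      using u by auto
    finally show ?thesis by (simp add: prime_count_ap_def)
  qed
  ultimately have "((\<lambda>u. u powr (\<gamma> - 2) * real (prime_count_ap u d a)) has_integral (\<Sum>p\<in>?P. J p)) {2..x}"
    by (rule has_integral_eq[rotated])
  then have "integral {2..x} (\<lambda>u. u powr (\<gamma> - 2) * real (prime_count_ap u d a)) = (\<Sum>p\<in>?P. J p)"
    by (rule integral_unique)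
  moreover have "real (prime_count_ap x d a) = (\<Sum>p\<in>?P. 1)" by (simp add: prime_count_ap_def)
  ultimately have "\<gamma> * x powr (\<gamma> - 1) * real (prime_count_ap x d a)
     + \<gamma> * (1 - \<gamma>) * integral {2..x} (\<lambda>u. u powr (\<gamma> - 2) * real (prime_count_ap u d a))
     = (\<Sum>p\<in>?P. \<gamma> * x powr (\<gamma> - 1) + \<gamma> * (1 - \<gamma>) * J p)"
    by (simp add: sum.distrib sum_distrib_left)
  also have "\<dots> = (\<Sum>p\<in>?P. \<gamma> * real p powr (\<gamma> - 1))"
  proof (rule sum.cong[OF refl])
    fix p
    have "(1 - \<gamma>) * J p = real p powr (\<gamma> - 1) - x powr (\<gamma> - 1)"
      using \<gamma> by (simp add: J_def field_simps)
    then show "\<gamma> * x powr (\<gamma> - 1) + \<gamma> * (1 - \<gamma>) * J p = \<gamma> * real p powr (\<gamma> - 1)"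
      by (simp only: mult.assoc) (simp add: algebra_simps)
  qed
  finally show ?thesis .
qed

theorem theorem8:
  fixes c \<gamma> :: real
  assumes "1 < c" and "c < 18 / 17" and "\<gamma> = 1 / c"
  shows "\<exists>\<epsilon>\<^sub>0>0. \<forall>\<epsilon>. 0 < \<epsilon> \<and> \<epsilon> < \<epsilon>\<^sub>0 \<longrightarrow>
    (\<exists>C::real. \<forall>(a::int) (d::int) (x::real). coprime a d \<and> d \<ge> 1 \<and> x \<ge> 2 \<longrightarrow>
      \<bar>real (PS_prime_count_ap c x d a)
         - (\<gamma> * x powr (\<gamma> - 1) * real (prime_count_ap x d a)
            + \<gamma> * (1 - \<gamma>) *
                integral {2..x} (\<lambda>u. u powr (\<gamma> - 2) * real (prime_count_ap u d a)))\<bar>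
      \<le> C * x powr (17 / 39 + 7 * \<gamma> / 13 + \<epsilon>))"
proof (rule exI[of _ 1], intro conjI allI impI)
  fix \<epsilon> :: real assume "0 < \<epsilon> \<and> \<epsilon> < 1"
  then have \<epsilon>: "0 < \<epsilon>" by simp
  have \<gamma>: "17 / 18 < \<gamma>" "\<gamma> < 1" unfolding assms(3) using assms(1,2) by (auto simp: field_simps)
  have \<gamma>01: "0 < \<gamma>" "\<gamma> < 1" using \<gamma> by auto
  define \<eta> where "\<eta> = 17 / 39 + 7 * \<gamma> / 13 + \<epsilon>"
  have \<eta>: "0 < \<eta>" using \<gamma> \<epsilon> by (simp add: \<eta>_def)
  obtain C where C0: "C > 0" and CC: "\<forall>N N1 (a::int) (d::int). 1 \<le> N \<longrightarrow> N \<le> N1 \<longrightarrow> N1 \<le> 2 * N \<longrightarrow> 1 \<le> d \<longrightarrow>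
    \<bar>\<Sum>n\<in>{N<..N1}. (if ap_prime a d n then saw (- (real (Suc n) powr \<gamma>)) - saw (- (real n powr \<gamma>)) else 0)\<bar>
      \<le> C * real N powr \<eta>"
    using saw_sum_over_primes[OF \<gamma> \<epsilon>] unfolding \<eta>_def by (elim exE conjE)
  define K where "K = C / (1 - (3 / 4) powr \<eta>)"
  have "(3 / 4 :: real) powr \<eta> < 1" using powr_less_mono2[of \<eta> "3 / 4" 1] \<eta> by simp
  then have K0: "K \<ge> 0" using C0 by (simp add: K_def)
  show "\<exists>C::real. \<forall>(a::int) (d::int) (x::real). coprime a d \<and> d \<ge> 1 \<and> x \<ge> 2 \<longrightarrow>
      \<bar>real (PS_prime_count_ap c x d a)
         - (\<gamma> * x powr (\<gamma> - 1) * real (prime_count_ap x d a)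
            + \<gamma> * (1 - \<gamma>) *
                integral {2..x} (\<lambda>u. u powr (\<gamma> - 2) * real (prime_count_ap u d a)))\<bar>
      \<le> C * x powr (17 / 39 + 7 * \<gamma> / 13 + \<epsilon>)"
  \<comment> \<open>\<open>K\<close> bounds the sawtooth sum; the 1 pays for replacing
    (p+1)^\<gamma> - p^\<gamma> by \<gamma> p^(\<gamma>-1).\<close>
  proof (intro exI[of _ "K + 1"] allI impI)
    fix a d :: int and x :: real
    assume "coprime a d \<and> d \<ge> 1 \<and> x \<ge> 2"
    then have d: "1 \<le> d" and x: "2 \<le> x" by auto
    define X where "X = nat \<lfloor>x\<rfloor>"
    have X: "1 \<le> X" "real X \<le> x" using x by (auto simp: X_def le_nat_iff le_floor_iff)
    define P where "P = {p. prime p \<and> real p \<le> x \<and> [int p = a] (mod d)}"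
    have P: "P = {n \<in> {1..X}. ap_prime a d n}"
    proof -
      have "real n \<le> x \<longleftrightarrow> n \<le> X" for n :: nat
        unfolding X_def using x by (simp add: le_nat_iff le_floor_iff)
      then show ?thesis unfolding P_def ap_prime_def by (auto dest: prime_ge_1_nat)
    qed
    then have fin: "finite P" by simp
    define D where "D n = real (Suc n) powr \<gamma> - real n powr \<gamma>" for n
    define f where "f n = (if ap_prime a d n then saw (- (real (Suc n) powr \<gamma>)) - saw (- (real n powr \<gamma>)) else 0)" for n
    have PS: "real (PS_prime_count_ap c x d a) = (\<Sum>p\<in>P. D p) + (\<Sum>n\<in>{1..X}. f n)"
    proof -
      have "{p. p \<in> PS_primes c \<and> real p \<le> x \<and> [int p = a] (mod d)} = {p\<in>P. p \<in> PS_primes c}"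
        by (auto simp: P_def PS_primes_def)
      then have "real (PS_prime_count_ap c x d a) = (\<Sum>p\<in>{p\<in>P. p \<in> PS_primes c}. 1)"
        by (simp add: PS_prime_count_ap_def)
      also have "\<dots> = (\<Sum>p\<in>P. if p \<in> PS_primes c then 1 else 0)"
        by (simp only: sum.inter_filter[OF fin])
      also have "\<dots> = (\<Sum>p\<in>P. D p + f p)"
      proof (rule sum.cong[OF refl])
        fix p assume p: "p \<in> P"
        then have "ap_prime a d p" "prime p" unfolding P by (auto simp: ap_prime_def)
        then show "(if p \<in> PS_primes c then 1 else 0) = D p + f p"
          unfolding PS_indicator[OF assms(1,3) \<open>prime p\<close>] by (simp add: D_def f_def)
      qed
      also have "(\<Sum>p\<in>P. D p + f p) = (\<Sum>p\<in>P. D p) + (\<Sum>n\<in>{1..X}. f n)"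
      proof -
        have "(\<Sum>n\<in>P. f n) = (\<Sum>n\<in>{1..X}. f n)"
          unfolding P by (intro sum.mono_neutral_left) (auto simp: f_def)
        then show ?thesis by (simp add: sum.distrib)
      qed
      finally show ?thesis .
    qed
    have S: "\<bar>\<Sum>n\<in>{1..X}. f n\<bar> \<le> K * x powr \<eta>"
    proof -
      have "\<bar>\<Sum>n\<in>{1..X}. f n\<bar> \<le> K * real X powr \<eta>"
        unfolding K_def
      proof (rule dyadic_sum_bound[OF \<eta> _ _ _ X(1)])
        show "f 1 = 0" by (simp add: f_def ap_prime_def)
        show "\<bar>\<Sum>n\<in>{N<..N1}. f n\<bar> \<le> C * real N powr \<eta>" if "1 \<le> N" "N \<le> N1" "N1 \<le> 2 * N" for N N1
          using CC[rule_format, OF that d] unfolding f_def .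
      qed (use C0 in simp)
      also have "\<dots> \<le> K * x powr \<eta>" using X \<eta> by (intro mult_left_mono powr_mono2 K0) auto
      finally show ?thesis .
    qed
    \<comment> \<open>The increment at p lies between the values of \<gamma> t^(\<gamma>-1) at p + 1
      and at p. The gaps between these values are nonnegative, so their sum may be extended to all
      integers, where it telescopes to at most \<gamma>.\<close>
    have W: "\<bar>(\<Sum>p\<in>P. D p) - (\<Sum>p\<in>P. \<gamma> * real p powr (\<gamma> - 1))\<bar> \<le> 1"
    proof -
      have inc: "\<gamma> * real (Suc n) powr (\<gamma> - 1) \<le> D n" "D n \<le> \<gamma> * real n powr (\<gamma> - 1)" if "1 \<le> n" for n
        using powr_increment_bounds[OF \<gamma>01, of "real n"] that by (auto simp: D_def add.commute)
      have "\<bar>(\<Sum>p\<in>P. D p) - (\<Sum>p\<in>P. \<gamma> * real p powr (\<gamma> - 1))\<bar>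
          \<le> (\<Sum>p\<in>P. \<gamma> * real p powr (\<gamma> - 1) - \<gamma> * real (Suc p) powr (\<gamma> - 1))"
        unfolding sum_subtractf[symmetric]
      proof (rule order.trans[OF sum_abs], rule sum_mono)
        fix p assume "p \<in> P"
        then have "1 \<le> p" by (simp add: P)
        from inc[OF this] show "\<bar>D p - \<gamma> * real p powr (\<gamma> - 1)\<bar>
          \<le> \<gamma> * real p powr (\<gamma> - 1) - \<gamma> * real (Suc p) powr (\<gamma> - 1)" by linarith
      qed
      also have "\<dots> \<le> (\<Sum>n\<in>{1..X}. \<gamma> * real n powr (\<gamma> - 1) - \<gamma> * real (Suc n) powr (\<gamma> - 1))"
      proof (rule sum_mono2)
        fix n assume "n \<in> {1..X} - P"
        then have "1 \<le> n" by simp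
        from inc[OF this] show "0 \<le> \<gamma> * real n powr (\<gamma> - 1) - \<gamma> * real (Suc n) powr (\<gamma> - 1)" by linarith
      qed (auto simp: P)
      also have "\<dots> = \<gamma> - \<gamma> * real (Suc X) powr (\<gamma> - 1)"
        using sum_Suc_diff[of 1 X "\<lambda>n. - (\<gamma> * real n powr (\<gamma> - 1))"] X(1) by simp
      also have "\<dots> \<le> 1" using \<gamma>01 by (smt (verit) mult_nonneg_nonneg powr_ge_zero)
      finally show ?thesis .
    qed
    have "1 \<le> x powr \<eta>" using x \<eta> by (intro ge_one_powr_ge_zero) auto
    then have "\<bar>real (PS_prime_count_ap c x d a) - (\<Sum>p\<in>P. \<gamma> * real p powr (\<gamma> - 1))\<bar> \<le> (K + 1) * x powr \<eta>"
      using S W unfolding PS distrib_right by linarith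
    then show "\<bar>real (PS_prime_count_ap c x d a)
         - (\<gamma> * x powr (\<gamma> - 1) * real (prime_count_ap x d a)
            + \<gamma> * (1 - \<gamma>) *
                integral {2..x} (\<lambda>u. u powr (\<gamma> - 2) * real (prime_count_ap u d a)))\<bar>
      \<le> (K + 1) * x powr (17 / 39 + 7 * \<gamma> / 13 + \<epsilon>)"
      unfolding weighted_prime_count[OF \<gamma>01 x] P_def \<eta>_def .
  qed
qed simp

end
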